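(* Let $\mathbb G$ be a positively graded group and let $\alpha\in E_0^{k-1}$ be a Rumin form of homogeneous weight $w(\alpha)=p$, i.e. $\alpha\in E_0^{k-1}\cap\Omega^{p,k-1-p}(\mathbb G)$. (1) If $p$ is the maximum of the weights of nonzero homogeneous forms $\beta\in\Omega^{k-1}(\mathbb G)$, then $\Pi_E\alpha=\alpha$. (2) If $d\Pi_E\alpha=(d\Pi_E\alpha)_{p+j_1}+\dots+(d\Pi_E\alpha)_{p+j_t}\in\bigoplus_{i=1}^t\Omega^{p+j_i,\,k-p-j_i}(\mathbb G)$ with $j_1<\dots<j_t$, where $(\cdot)_q$ denotes the component of weight $q$, then the component of lowest weight satisfies $(d\Pi_E\alpha)_{p+j_1}\in E_0^k$.
   Context: Positively graded group: a connected, simply connected Lie group $\mathbb{G}$ whose Lie algebra has a decomposition $\mathfrak g=\bigoplus_{i=1}^s\mathfrak g_{w_i}$ with integers $0<w_1<\dots<w_s$ and $[\mathfrak g_{w_i},\mathfrak g_{w_j}]\subseteq\mathfrak g_{w_i+w_j}$ (with $\mathfrak g_w=0$ if $w$ is not one of the $w_i$). Weights: a left-invariant 1-form that vanishes on all layers except $\mathfrak g_{w_i}$ has weight $w_i$; a wedge product of such forms has weight the sum of the weights. $\Omega^{p,k-p}(\mathbb G)$ is the space of smooth $k$-forms of weight $p$, i.e. the $C^\infty(\mathbb G)$-span of left-invariant $k$-forms of weight $p$ (the second index is degree minus weight); $\Omega^k(\mathbb G)=\bigoplus_p\Omega^{p,k-p}(\mathbb G)$. The exterior derivative splits as $d=d_0+d_1+\dots+d_{w_s}$,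 where $d_i$ raises the weight by exactly $i$; $d_0$ is $C^\infty(\mathbb G)$-linear and coincides with $d$ on left-invariant forms. Fix a scalar product on $\mathfrak g$ for which the layers $\mathfrak g_{w_i}$ are mutually orthogonal; it induces scalar products on $\bigwedge^k\mathfrak g^*$ and pointwise on forms. $\delta_0$ is the ($C^\infty$-linear) adjoint of $d_0$. $d_0^{-1}:\Omega^{k}(\mathbb G)\to\Omega^{k-1}(\mathbb G)$ is the inverse of the bijection $d_0:\operatorname{Im}\delta_0=(\ker d_0)^\perp\to\operatorname{Im}d_0$ precomposed with the orthogonal projection onto $\operatorname{Im}d_0$. Rumin forms: $E_0^k=\ker d_0\cap\ker\delta_0\cap\Omega^k(\mathbb G)$. The operator $b=-d_0^{-1}(d-d_0)$ is nilpotent; $\Pi=(\mathrm{Id}-b)^{-1}d_0^{-1}d+d(\mathrm{Id}-b)^{-1}d_0^{-1}$ and $\Pi_E=\mathrm{Id}-\Pi$. *)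

theory Defs
  imports
    "HOL-Analysis.Analysis"
    "HOL-Algebra.Group"
    "HOL-Library.Function_Algebras"
begin

text \<open>
  Functions, vector fields and forms are added and subtracted pointwise; the operations are those
  of \<^theory>\<open>HOL-Library.Function_Algebras\<close>.
\<close>

section \<open>Smooth manifolds\<close>

primrec Ck_on :: "nat \<Rightarrow> 'a::real_normed_vector set \<Rightarrow> ('a \<Rightarrow> 'b::real_normed_vector) \<Rightarrow> bool"
where
  "Ck_on 0 S f = continuous_on S f"
| "Ck_on (Suc k) S f =
     (f differentiable_on S \<and> (\<forall>v. Ck_on k S (\<lambda>x. frechet_derivative f (at x) v)))"

text \<open>Only used for open sets \<open>S\<close>.\<close>

definition smooth_on :: "'a::real_normed_vector set \<Rightarrow> ('a \<Rightarrow> 'b::real_normed_vector) \<Rightarrow> bool"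
  where "smooth_on S f \<longleftrightarrow> (\<forall>k. Ck_on k S f)"

text \<open>
  A chart is a pair \<open>(U, \<phi>)\<close>; the values of \<open>\<phi>\<close> outside \<open>U\<close> are irrelevant. The topological space
  is a whole type, so that the Hausdorff property and second countability are type class
  constraints.
\<close>

type_synonym ('g, 'v) atlas = "('g set \<times> ('g \<Rightarrow> 'v)) set"

definition smooth_atlas ::
    "('g::{t2_space,second_countable_topology}, 'v::euclidean_space) atlas \<Rightarrow> bool"
  where "smooth_atlas A \<longleftrightarrow>
    (\<Union>(U, \<phi>)\<in>A. U) = UNIV \<and>
    (\<forall>(U, \<phi>)\<in>A. open U \<and> open (\<phi> ` U) \<and> homeomorphism U (\<phi> ` U) \<phi> (inv_into U \<phi>)) \<and>
    (\<forall>(U, \<phi>)\<in>A. \<forall>(U', \<phi>')\<in>A. smooth_on (\<phi> ` (U \<inter> U')) (\<phi>' \<circ> inv_into U \<phi>))"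

definition prod_atlas :: "('g, 'v) atlas \<Rightarrow> ('h, 'w) atlas \<Rightarrow> ('g \<times> 'h, 'v \<times> 'w) atlas"
  where "prod_atlas A B = {(U \<times> V, map_prod \<phi> \<psi>) | U \<phi> V \<psi>. (U, \<phi>) \<in> A \<and> (V, \<psi>) \<in> B}"

definition smooth_map ::
    "('g::topological_space, 'v::euclidean_space) atlas \<Rightarrow>
     ('h::topological_space, 'w::euclidean_space) atlas \<Rightarrow> ('g \<Rightarrow> 'h) \<Rightarrow> bool"
  where "smooth_map A B F \<longleftrightarrow> continuous_on UNIV F \<and>
    (\<forall>(U, \<phi>)\<in>A. \<forall>(V, \<psi>)\<in>B. smooth_on (\<phi> ` (U \<inter> F -` V)) (\<psi> \<circ> F \<circ> inv_into U \<phi>))"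

definition smooth_funs :: "('g, 'v::euclidean_space) atlas \<Rightarrow> ('g \<Rightarrow> real) set"
  where "smooth_funs A = {f. \<forall>(U, \<phi>)\<in>A. smooth_on (\<phi> ` U) (f \<circ> inv_into U \<phi>)}"

text \<open>
  A smooth vector field is the operator on smooth functions that it induces: it preserves smooth
  functions, and in each chart \<open>\<phi>\<close> it is at each point the directional derivative along some vector
  \<open>a\<close>. Functions that are not smooth are sent to \<open>0\<close>, so that equality of operators is equality of
  vector fields.
\<close>

type_synonym 'g vfield = "('g \<Rightarrow> real) \<Rightarrow> 'g \<Rightarrow> real"

definition vector_fields :: "('g, 'v::euclidean_space) atlas \<Rightarrow> 'g vfield set"
  where "vector_fields A = {Y.
    (\<forall>f\<in>smooth_funs A. Y f \<in> smooth_funs A) \<and>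
    (\<forall>f. f \<notin> smooth_funs A \<longrightarrow> Y f = 0) \<and>
    (\<forall>(U, \<phi>)\<in>A. \<forall>x\<in>U. \<exists>a. \<forall>f\<in>smooth_funs A.
       Y f x = frechet_derivative (f \<circ> inv_into U \<phi>) (at (\<phi> x)) a)}"

definition vf_bracket :: "'g vfield \<Rightarrow> 'g vfield \<Rightarrow> 'g vfield"
  where "vf_bracket Y Z = (\<lambda>f. Y (Z f) - Z (Y f))"

section \<open>Differential forms\<close>

text \<open>
  Forms are alternating maps on vector fields, multilinear over the smooth functions. A tuple of
  vector fields is a list, and its length is the degree; \<open>forms\<close> is the direct sum of the spaces
  of \<open>k\<close>-forms over all \<open>k\<close> (forms of degree larger than the dimension vanish, so
  that no finiteness condition is needed). Outside tuples of vector fields a form is \<open>0\<close>.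
\<close>

type_synonym 'g form = "'g vfield list \<Rightarrow> 'g \<Rightarrow> real"

definition forms :: "('g, 'v::euclidean_space) atlas \<Rightarrow> 'g form set"
  where "forms A = {\<omega>.
    (\<forall>Ys. \<not> set Ys \<subseteq> vector_fields A \<longrightarrow> \<omega> Ys = 0) \<and>
    (\<forall>Ys. set Ys \<subseteq> vector_fields A \<longrightarrow> \<omega> Ys \<in> smooth_funs A) \<and>
    (\<forall>Ys i. \<forall>Y\<in>vector_fields A. \<forall>Z\<in>vector_fields A.
       set Ys \<subseteq> vector_fields A \<longrightarrow> i < length Ys \<longrightarrow>
       \<omega> (Ys[i := Y + Z]) = \<omega> (Ys[i := Y]) + \<omega> (Ys[i := Z])) \<and>
    (\<forall>Ys i. \<forall>Y\<in>vector_fields A. \<forall>h\<in>smooth_funs A.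
       set Ys \<subseteq> vector_fields A \<longrightarrow> i < length Ys \<longrightarrow>
       \<omega> (Ys[i := (\<lambda>f. h * Y f)]) = h * \<omega> (Ys[i := Y])) \<and>
    (\<forall>Ys i j. set Ys \<subseteq> vector_fields A \<longrightarrow> i < j \<longrightarrow> j < length Ys \<longrightarrow> Ys ! i = Ys ! j \<longrightarrow>
       \<omega> Ys = 0)}"

definition kforms :: "('g, 'v::euclidean_space) atlas \<Rightarrow> nat \<Rightarrow> 'g form set"
  where "kforms A k = {\<omega> \<in> forms A. \<forall>Ys. length Ys \<noteq> k \<longrightarrow> \<omega> Ys = 0}"

definition fun_mult_form :: "('g \<Rightarrow> real) \<Rightarrow> 'g form \<Rightarrow> 'g form"
  where "fun_mult_form h \<omega> = (\<lambda>Ys. h * \<omega> Ys)"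

text \<open>
  The exterior derivative, by the invariant (Koszul) formula. \<open>nths Ys (- {i})\<close> is \<open>Ys\<close> with the
  entry of index \<open>i\<close> omitted.
\<close>

definition ext_d :: "('g, 'v::euclidean_space) atlas \<Rightarrow> 'g form \<Rightarrow> 'g form"
  where "ext_d A \<omega> = (\<lambda>Ys x.
    if set Ys \<subseteq> vector_fields A
    then (\<Sum>i<length Ys. (-1) ^ i * (Ys ! i) (\<omega> (nths Ys (- {i}))) x)
       + (\<Sum>j<length Ys. \<Sum>i<j.
            (-1) ^ (i + j) * \<omega> (vf_bracket (Ys ! i) (Ys ! j) # nths Ys (- {i, j})) x)
    else 0)"

text \<open>The wedge product of a list of 1-forms; the empty wedge product is the constant function 1.\<close>

definition wedge :: "'g form list \<Rightarrow> 'g form"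
  where "wedge \<theta>s = (\<lambda>Ys x.
    if length Ys = length \<theta>s
    then \<Sum>\<sigma> | \<sigma> permutes {..<length \<theta>s}.
           of_int (sign \<sigma>) * (\<Prod>i<length \<theta>s. (\<theta>s ! i) [Ys ! \<sigma> i] x)
    else 0)"

section \<open>Lie groups\<close>

definition lie_group ::
    "('g::{t2_space,second_countable_topology}) monoid \<Rightarrow> ('g, 'v::euclidean_space) atlas \<Rightarrow> bool"
  where "lie_group G A \<longleftrightarrow>
    group G \<and> carrier G = UNIV \<and> smooth_atlas A \<and>
    smooth_map (prod_atlas A A) A (\<lambda>(x, y). x \<otimes>\<^bsub>G\<^esub> y) \<and>
    smooth_map A A (\<lambda>x. inv\<^bsub>G\<^esub> x)"

text \<open>Push-forward of a vector field along the left translation by \<open>g\<close>.\<close>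

definition push_left :: "('g, 'b) monoid_scheme \<Rightarrow> 'g \<Rightarrow> 'g vfield \<Rightarrow> 'g vfield"
  where "push_left G g Y = (\<lambda>f x. Y (\<lambda>y. f (g \<otimes>\<^bsub>G\<^esub> y)) (inv\<^bsub>G\<^esub> g \<otimes>\<^bsub>G\<^esub> x))"

definition left_inv_fields ::
    "('g, 'b) monoid_scheme \<Rightarrow> ('g, 'v::euclidean_space) atlas \<Rightarrow> 'g vfield set"
  where "left_inv_fields G A = {Y \<in> vector_fields A. \<forall>g. push_left G g Y = Y}"

text \<open>Invariance under pull-back along left translations.\<close>

definition left_inv_kforms ::
    "('g, 'b) monoid_scheme \<Rightarrow> ('g, 'v::euclidean_space) atlas \<Rightarrow> nat \<Rightarrow> 'g form set"
  where "left_inv_kforms G A k = {\<omega> \<in> kforms A k.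
    \<forall>g Ys x. set Ys \<subseteq> vector_fields A \<longrightarrow>
      \<omega> (map (push_left G g) Ys) (g \<otimes>\<^bsub>G\<^esub> x) = \<omega> Ys x}"

section \<open>Positively graded groups and the Rumin complex\<close>

text \<open>
  The Lie algebra of left-invariant vector fields, equipped with the chosen scalar product, is
  given by a linear bijection \<open>X\<close> from the Euclidean space \<open>'v\<close>, whose inner product is the scalar
  product. The charts take values in the same space \<open>'v\<close>, which has the right dimension.
  \<open>V w\<close> is the layer of weight \<open>w\<close>, with \<open>V w = {0}\<close> if \<open>w\<close> is not a weight. Finitely many layers
  are nonzero and the sum of the layers is direct, because they are mutually orthogonal.
\<close>

locale positively_graded_group =
  fixes G :: "('g::{t2_space,second_countable_topology}) monoid"
    and A :: "('g, 'v::euclidean_space) atlas"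
    and X :: "'v \<Rightarrow> 'g vfield"
    and V :: "int \<Rightarrow> 'v set"
  assumes lie_group: "lie_group G A"
    and connected: "connected (UNIV :: 'g set)"
    and simply_connected: "simply_connected (UNIV :: 'g set)"
    and X_linear: "\<And>f x. linear (\<lambda>v. X v f x)"
    and X_bij: "bij_betw X UNIV (left_inv_fields G A)"
    and layer_subspace: "\<And>w. subspace (V w)"
    and layer_nonpos: "\<And>w. w \<le> 0 \<Longrightarrow> V w = {0}"
    and layers_span: "span (\<Union>w. V w) = UNIV"
    and layers_orthogonal: "\<And>w w' u v. w \<noteq> w' \<Longrightarrow> u \<in> V w \<Longrightarrow> v \<in> V w' \<Longrightarrow> u \<bullet> v = 0"
    and layers_bracket:
      "\<And>w w' u v. u \<in> V w \<Longrightarrow> v \<in> V w' \<Longrightarrow> vf_bracket (X u) (X v) \<in> X ` V (w + w')"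
begin

definition weight_1forms :: "int \<Rightarrow> 'g form set"
  where "weight_1forms w =
    {\<theta> \<in> left_inv_kforms G A 1. \<forall>w' v. w' \<noteq> w \<longrightarrow> v \<in> V w' \<longrightarrow> \<theta> [X v] = 0}"

text \<open>
  The forms of weight \<open>p\<close> (of all degrees): the span over the smooth functions of the wedge
  products of left-invariant 1-forms \<open>\<theta>s ! i\<close> of weights \<open>ws ! i\<close>, with total weight \<open>p\<close>.
\<close>

inductive_set weight_forms :: "int \<Rightarrow> 'g form set" for p
where
  zero: "0 \<in> weight_forms p"
| add: "\<omega> \<in> weight_forms p \<Longrightarrow> h \<in> smooth_funs A \<Longrightarrow>
    list_all2 (\<lambda>\<theta> w. \<theta> \<in> weight_1forms w) \<theta>s ws \<Longrightarrow> sum_list ws = p \<Longrightarrow>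
    \<omega> + fun_mult_form h (wedge \<theta>s) \<in> weight_forms p"

definition weight_kforms :: "nat \<Rightarrow> int \<Rightarrow> 'g form set"
  where "weight_kforms k p = kforms A k \<inter> weight_forms p"

definition weight_decomp :: "'g form \<Rightarrow> int \<Rightarrow> 'g form"
  where "weight_decomp \<omega> = (THE c. (\<forall>q. c q \<in> weight_forms q) \<and> finite {q. c q \<noteq> 0} \<and>
    \<omega> = (\<Sum>q | c q \<noteq> 0. c q))"

definition weight_comp :: "int \<Rightarrow> 'g form \<Rightarrow> 'g form"
  where "weight_comp q \<omega> = weight_decomp \<omega> q"

text \<open>The part of the exterior derivative that raises the weight by exactly \<open>i\<close>.\<close>

definition d_part :: "int \<Rightarrow> 'g form \<Rightarrow> 'g form"
  where "d_part i \<omega> =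
    (\<Sum>q | weight_comp q \<omega> \<noteq> 0. weight_comp (q + i) (ext_d A (weight_comp q \<omega>)))"

abbreviation d0 :: "'g form \<Rightarrow> 'g form"
  where "d0 \<equiv> d_part 0"

text \<open>
  The pointwise scalar product of forms. On \<open>k\<close>-covectors the induced scalar product is the sum
  over increasing \<open>k\<close>-tuples of an orthonormal basis; here the sum is over all \<open>k\<close>-tuples of
  distinct basis vectors, which counts each term \<open>fact k\<close> times. Forms of different degrees
  are orthogonal.
\<close>

definition form_inner :: "'g form \<Rightarrow> 'g form \<Rightarrow> 'g \<Rightarrow> real"
  where "form_inner \<alpha> \<beta> = (\<lambda>x. \<Sum>es | distinct es \<and> set es \<subseteq> (Basis :: 'v set).
    \<alpha> (map X es) x * \<beta> (map X es) x / fact (length es))"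

definition delta0 :: "'g form \<Rightarrow> 'g form"
  where "delta0 \<beta> =
    (THE \<gamma>. \<gamma> \<in> forms A \<and> (\<forall>\<alpha>\<in>forms A. form_inner (d0 \<alpha>) \<beta> = form_inner \<alpha> \<gamma>))"

definition proj_im_d0 :: "'g form \<Rightarrow> 'g form"
  where "proj_im_d0 \<beta> =
    (THE \<pi>. \<pi> \<in> d0 ` forms A \<and> (\<forall>\<eta>\<in>d0 ` forms A. form_inner (\<beta> - \<pi>) \<eta> = 0))"

definition d0_inv :: "'g form \<Rightarrow> 'g form"
  where "d0_inv \<beta> = the_inv_into (delta0 ` forms A) d0 (proj_im_d0 \<beta>)"

definition rumin_forms :: "nat \<Rightarrow> 'g form set"
  where "rumin_forms k = {\<omega> \<in> kforms A k. d0 \<omega> = 0 \<and> delta0 \<omega> = 0}"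

definition b_op :: "'g form \<Rightarrow> 'g form"
  where "b_op \<omega> = - d0_inv (ext_d A \<omega> - d0 \<omega>)"

definition Id_minus_b_inv :: "'g form \<Rightarrow> 'g form"
  where "Id_minus_b_inv = the_inv_into (forms A) (\<lambda>\<omega>. \<omega> - b_op \<omega>)"

definition Pi_op :: "'g form \<Rightarrow> 'g form"
  where "Pi_op \<omega> =
    Id_minus_b_inv (d0_inv (ext_d A \<omega>)) + ext_d A (Id_minus_b_inv (d0_inv \<omega>))"

definition Pi_E :: "'g form \<Rightarrow> 'g form"
  where "Pi_E \<omega> = \<omega> - Pi_op \<omega>"

end

end

(*
Because the left-invariant fields of an orthonormal basis adapted to the layers form a global frame,
a form is the same as an alternating family of smooth coefficients. On these coefficients d_0 is the
bracket part of the Koszul formula: it is linear over the smooth functions and has constant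
coefficients, so that Gram-Schmidt over constant forms yields its adjoint and all orthogonal
projections.

For a Rumin form alpha one has d_0^{-1} alpha = 0 and d_0^{-1} d alpha = - b alpha, hence
Pi_E alpha = g with g := (Id - b)^{-1} alpha, that is, g - b g = alpha. As b raises the weight and
preserves the degree, b alpha = 0 if alpha has maximal weight, which gives (1). For (2),
d_0^{-1} d_0 g = b g (because b g lies in the image of delta_0 and d_0 (b g) = d_0 g) together with
b g = - d_0^{-1} (d - d_0) g yields d_0^{-1} d g = 0, so delta_0 kills d g and each of its
components; and the component of lowest weight of d (d g) = 0 is d_0 of the one of d g.
*)
theory Submission
  imports Defs
begin

section \<open>Smooth functions\<close>

text \<open>Vector fields are operators on globally defined smooth functions, so the frame has to be
  detected by such functions. Left invariance does this: a field \<open>X v\<close> that kills all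
  functions at one point kills them at every point by translation, hence \<open>v = 0\<close>. So
  the frame is represented in a chart at each point by an injective, hence bijective, linear map,
  and the frame coordinates of any field solve a linear system whose matrix is the identity at a
  chosen point. Their smoothness is then elimination over germs, which is why smoothness is
  localised first.

  Gram-Schmidt over the smooth functions breaks down where the norm of a residue vanishes at some
  points only. For forms with constant frame coefficients this norm is a constant, so the residue is
  zero or can be normalised on the whole group; by linearity over the smooth functions the resulting
  frames serve all forms.

  The scalar product is given by the canonical \<open>Basis\<close>, the weights by the layers. Sums
  over all tuples, repetitions allowed, can be moved from \<open>Basis\<close> to an adapted basis
  one slot at a time.\<close>

lemma Ck_on_cong:
  assumes "open S" "\<And>x. x \<in> S \<Longrightarrow> f x = g x" "Ck_on k S f"
  shows "Ck_on k S g"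
  using assms(2,3)
proof (induction k arbitrary: f g)
  case 0
  then show ?case using continuous_on_cong by force
next
  case (Suc k)
  have *: "frechet_derivative f (at x) = frechet_derivative g (at x)" if "x \<in> S" for x
    using Suc.prems that assms(1)
    by (intro frechet_derivative_transform_within_open)
      (auto simp: differentiable_on_eq_differentiable_at)
  have "g differentiable_on S"
    using Suc.prems by (auto simp: differentiable_on_def intro: differentiable_transform_within
        [where d = 1])
  moreover have "Ck_on k S (\<lambda>x. frechet_derivative g (at x) v)" for v
    by (rule Suc.IH[where f = "\<lambda>x. frechet_derivative f (at x) v"]) (use Suc.prems * in auto)
  ultimately show ?case by simp
qed

lemma Ck_on_subset:
  assumes "T \<subseteq> S" "Ck_on k S f"
  shows "Ck_on k T f"
  using assms(2)
  by (induction k arbitrary: f)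
    (use assms(1) in \<open>auto intro: continuous_on_subset differentiable_on_subset\<close>)

lemma Ck_on_local:
  assumes "\<And>x. x \<in> S \<Longrightarrow> \<exists>T. open T \<and> x \<in> T \<and> Ck_on k T f"
  shows "Ck_on k S f"
  using assms
proof (induction k arbitrary: f)
  case 0
  then show ?case
    by (metis Ck_on.simps(1) continuous_at_imp_continuous_on continuous_on_eq_continuous_at)
next
  case (Suc k)
  have "f differentiable_on S"
    unfolding differentiable_on_def
  proof
    fix x assume "x \<in> S"
    then obtain T where "open T" "x \<in> T" "f differentiable_on T"
      using Suc.prems by force
    then show "f differentiable at x within S"
      using differentiable_at_withinI differentiable_on_eq_differentiable_at by blast
  qed
  moreover have "Ck_on k S (\<lambda>x. frechet_derivative f (at x) v)" for v
    by (rule Suc.IH) (use Suc.prems in force)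
  ultimately show ?case by simp
qed

lemma Ck_on_Suc_imp:
  assumes "Ck_on (Suc k) S f"
  shows "Ck_on k S f"
  using assms
proof (induction k arbitrary: f)
  case 0
  then show ?case by (simp add: differentiable_imp_continuous_on)
next
  case (Suc k)
  then show ?case by (meson Ck_on.simps(2))
qed

lemma Ck_on_const: "Ck_on k S (\<lambda>x. c)"
  by (induction k arbitrary: c) auto

lemma Ck_on_add:
  assumes "open S" "Ck_on k S f" "Ck_on k S g"
  shows "Ck_on k S (\<lambda>x. f x + g x)"
  using assms(2,3)
proof (induction k arbitrary: f g)
  case 0
  then show ?case by (simp add: continuous_on_add)
next
  case (Suc k)
  have "Ck_on k S (\<lambda>x. frechet_derivative (\<lambda>x. f x + g x) (at x) v)" for v
  proof (rule Ck_on_cong[OF assms(1)])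
    show "Ck_on k S (\<lambda>x. frechet_derivative f (at x) v + frechet_derivative g (at x) v)"
      using Suc by simp
    show "frechet_derivative f (at x) v + frechet_derivative g (at x) v =
        frechet_derivative (\<lambda>x. f x + g x) (at x) v" if "x \<in> S" for x
    proof -
      have "f differentiable at x" "g differentiable at x"
        using Suc.prems that assms(1) by (auto simp: differentiable_on_eq_differentiable_at)
      then have "((\<lambda>x. f x + g x) has_derivative
          (\<lambda>v. frechet_derivative f (at x) v + frechet_derivative g (at x) v)) (at x)"
        by (intro has_derivative_add) (auto simp: frechet_derivative_works)
      from frechet_derivative_at[OF this] show ?thesis by metis
    qed
  qed
  then show ?case using Suc.prems by simp
qed

lemma Ck_on_mult:
  fixes f g :: "'a::real_normed_vector \<Rightarrow> real"
  assumes "open S" "Ck_on k S f" "Ck_on k S g"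
  shows "Ck_on k S (\<lambda>x. f x * g x)"
  using assms(2,3)
proof (induction k arbitrary: f g)
  case 0
  then show ?case by (simp add: continuous_on_mult)
next
  case (Suc k)
  \<comment> \<open>The product rule contains the factors themselves, so the induction needs them,
    and not only their derivatives, to be of class C^k.\<close>
  have fg: "Ck_on k S f" "Ck_on k S g"
    using Suc.prems Ck_on_Suc_imp by blast+
  have "Ck_on k S (\<lambda>x. frechet_derivative (\<lambda>x. f x * g x) (at x) v)" for v
  proof (rule Ck_on_cong[OF assms(1)])
    show "Ck_on k S (\<lambda>x. f x * frechet_derivative g (at x) v + frechet_derivative f (at x) v * g x)"
      using Suc fg by (intro Ck_on_add[OF assms(1)] Suc.IH) auto
    show "f x * frechet_derivative g (at x) v + frechet_derivative f (at x) v * g x =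
        frechet_derivative (\<lambda>x. f x * g x) (at x) v" if "x \<in> S" for x
    proof -
      have "f differentiable at x" "g differentiable at x"
        using Suc.prems that assms(1) by (auto simp: differentiable_on_eq_differentiable_at)
      then have "((\<lambda>x. f x * g x) has_derivative
          (\<lambda>v. f x * frechet_derivative g (at x) v + frechet_derivative f (at x) v * g x)) (at x)"
        by (intro has_derivative_mult) (auto simp: frechet_derivative_works)
      from frechet_derivative_at[OF this] show ?thesis by metis
    qed
  qed
  then show ?case using Suc.prems by (simp add: differentiable_on_mult)
qed

lemma Ck_on_inverse:
  fixes f :: "'a::real_normed_vector \<Rightarrow> real"
  assumes "open S" "Ck_on k S f" "\<And>x. x \<in> S \<Longrightarrow> f x \<noteq> 0"
  shows "Ck_on k S (\<lambda>x. inverse (f x))"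
  using assms(2)
proof (induction k)
  case 0
  then show ?case using assms(3) by (auto intro: continuous_on_inverse)
next
  case (Suc k)
  have IH: "Ck_on k S (\<lambda>x. inverse (f x))"
    using Suc Ck_on_Suc_imp by blast
  have diff: "f differentiable at x" if "x \<in> S" for x
    using Suc.prems that assms(1) by (auto simp: differentiable_on_eq_differentiable_at)
  \<comment> \<open>The derivative is arranged as a plain product, to which
    \<open>Ck_on_mult\<close> and the induction hypothesis for the reciprocal apply.\<close>
  have der: "((\<lambda>x. inverse (f x)) has_derivative
      (\<lambda>v. - 1 * frechet_derivative f (at x) v * inverse (f x) * inverse (f x))) (at x)"
    if "x \<in> S" for x
  proof -
    have "((\<lambda>x. inverse (f x)) has_derivative
        (\<lambda>v. - (inverse (f x) * frechet_derivative f (at x) v * inverse (f x)))) (at x)"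
      using diff that assms(3) by (intro Deriv.has_derivative_inverse)
        (auto simp: frechet_derivative_works)
    then show ?thesis by (simp add: mult_ac)
  qed
  have "Ck_on k S (\<lambda>x. frechet_derivative (\<lambda>x. inverse (f x)) (at x) v)" for v
  proof (rule Ck_on_cong[OF assms(1)])
    show "Ck_on k S (\<lambda>x. - 1 * frechet_derivative f (at x) v * inverse (f x) * inverse (f x))"
      using Suc IH by (intro Ck_on_mult[OF assms(1)] Ck_on_const) auto
    show "- 1 * frechet_derivative f (at x) v * inverse (f x) * inverse (f x) =
        frechet_derivative (\<lambda>x. inverse (f x)) (at x) v" if "x \<in> S" for x
      using frechet_derivative_at[OF der[OF that]] by metis
  qed
  moreover have "(\<lambda>x. inverse (f x)) differentiable_on S"
    using der by (auto simp: differentiable_on_def differentiable_def intro: has_derivative_at_withinI)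
  ultimately show ?case by simp
qed

section \<open>Charts and local smoothness\<close>

lemma smooth_atlasD:
  assumes "smooth_atlas A" "(U, \<phi>) \<in> A"
  shows "open U" "open (\<phi> ` U)" "homeomorphism U (\<phi> ` U) \<phi> (inv_into U \<phi>)" "inj_on \<phi> U"
proof -
  show "open U" "open (\<phi> ` U)" and h: "homeomorphism U (\<phi> ` U) \<phi> (inv_into U \<phi>)"
    using assms by (auto simp: smooth_atlas_def)
  show "inj_on \<phi> U"
    by (rule inj_on_inverseI[where g = "inv_into U \<phi>"]) (rule homeomorphism_apply1[OF h])
qed

lemma smooth_atlas_cover:
  assumes "smooth_atlas A"
  obtains U \<phi> where "(U, \<phi>) \<in> A" "x \<in> U"
proof -
  have "x \<in> (\<Union>(U, \<phi>)\<in>A. U)"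
    using assms by (simp add: smooth_atlas_def)
  then show ?thesis using that by auto
qed

lemma open_chart_image:
  assumes "smooth_atlas A" "(U, \<phi>) \<in> A" "open W"
  shows "open (\<phi> ` (U \<inter> W))"
proof -
  note U = smooth_atlasD[OF assms(1,2)]
  have "openin (top_of_set (\<phi> ` U)) (\<phi> ` (U \<inter> W))"
    by (rule homeomorphism_imp_open_map[OF U(3)]) (use assms in auto)
  then show ?thesis using U openin_open_trans by blast
qed

text \<open>Reciprocals of pivots exist only near a point where the pivot does not vanish, so
  elimination has to work with germs instead of \<open>smooth_funs\<close>.\<close>

definition smooth_at :: "('g::topological_space, 'v::euclidean_space) atlas \<Rightarrow> ('g \<Rightarrow> real) \<Rightarrow> 'g \<Rightarrow> bool"
  where "smooth_at A f x \<longleftrightarrow> (\<exists>W. open W \<and> x \<in> W \<and>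
    (\<forall>(U, \<phi>)\<in>A. smooth_on (\<phi> ` (U \<inter> W)) (f \<circ> inv_into U \<phi>)))"

lemma smooth_funs_iff_smooth_at:
  assumes "smooth_atlas A"
  shows "f \<in> smooth_funs A \<longleftrightarrow> (\<forall>x. smooth_at A f x)"
proof
  assume "f \<in> smooth_funs A"
  then show "\<forall>x. smooth_at A f x"
    by (auto simp: smooth_funs_def smooth_at_def intro!: exI[of _ UNIV])
next
  assume *: "\<forall>x. smooth_at A f x"
  have "Ck_on k (\<phi> ` U) (f \<circ> inv_into U \<phi>)" if U: "(U, \<phi>) \<in> A" for U \<phi> k
  proof (rule Ck_on_local)
    fix y assume "y \<in> \<phi> ` U"
    then obtain x where x: "x \<in> U" "y = \<phi> x" by auto
    obtain W where W: "open W" "x \<in> W" "smooth_on (\<phi> ` (U \<inter> W)) (f \<circ> inv_into U \<phi>)"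
      using *[rule_format, of x] U by (auto simp: smooth_at_def)
    show "\<exists>T. open T \<and> y \<in> T \<and> Ck_on k T (f \<circ> inv_into U \<phi>)"
      using W x open_chart_image[OF assms U W(1)]
      by (intro exI[of _ "\<phi> ` (U \<inter> W)"]) (auto simp: smooth_on_def)
  qed
  then show "f \<in> smooth_funs A"
    by (auto simp: smooth_funs_def smooth_on_def)
qed

lemma smooth_at_cong:
  assumes "smooth_atlas A" "smooth_at A f x" "open T" "x \<in> T" "\<And>y. y \<in> T \<Longrightarrow> f y = g y"
  shows "smooth_at A g x"
proof -
  obtain W where W: "open W" "x \<in> W" "\<forall>(U, \<phi>)\<in>A. smooth_on (\<phi> ` (U \<inter> W)) (f \<circ> inv_into U \<phi>)"
    using assms(2) by (auto simp: smooth_at_def)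
  have "Ck_on k (\<phi> ` (U \<inter> (W \<inter> T))) (g \<circ> inv_into U \<phi>)" if U: "(U, \<phi>) \<in> A" for U \<phi> k
  proof (rule Ck_on_cong[where f = "f \<circ> inv_into U \<phi>"])
    show "open (\<phi> ` (U \<inter> (W \<inter> T)))"
      using open_chart_image[OF assms(1) U] W assms by blast
    show "Ck_on k (\<phi> ` (U \<inter> (W \<inter> T))) (f \<circ> inv_into U \<phi>)"
      by (rule Ck_on_subset[where S = "\<phi> ` (U \<inter> W)"]) (use W(3) U in \<open>auto simp: smooth_on_def\<close>)
    show "(f \<circ> inv_into U \<phi>) z = (g \<circ> inv_into U \<phi>) z" if "z \<in> \<phi> ` (U \<inter> (W \<inter> T))" for z
      using that smooth_atlasD(4)[OF assms(1) U] assms(5) by auto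
  qed
  then show ?thesis
    unfolding smooth_at_def using W assms
    by (intro exI[of _ "W \<inter> T"]) (auto simp: smooth_on_def)
qed

text \<open>The two neighbourhoods are intersected once here; sums and products then follow from the
  closure properties of \<open>Ck_on\<close>.\<close>

lemma smooth_at_combine:
  assumes A: "smooth_atlas A" and fg: "smooth_at A f x" "smooth_at A g x"
    and C: "\<And>k S (u :: 'v \<Rightarrow> real) w. open S \<Longrightarrow> Ck_on k S u \<Longrightarrow> Ck_on k S w \<Longrightarrow>
      Ck_on k S (\<lambda>z. F (u z) (w z))"
  shows "smooth_at (A :: ('g::{t2_space,second_countable_topology}, 'v::euclidean_space) atlas)
    (\<lambda>y. F (f y) (g y)) x"
proof -
  obtain W where W: "open W" "x \<in> W" "\<forall>(U, \<phi>)\<in>A. smooth_on (\<phi> ` (U \<inter> W)) (f \<circ> inv_into U \<phi>)"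
    using fg by (auto simp: smooth_at_def)
  obtain T where T: "open T" "x \<in> T" "\<forall>(U, \<phi>)\<in>A. smooth_on (\<phi> ` (U \<inter> T)) (g \<circ> inv_into U \<phi>)"
    using fg by (auto simp: smooth_at_def)
  have "Ck_on k (\<phi> ` (U \<inter> (W \<inter> T))) ((\<lambda>y. F (f y) (g y)) \<circ> inv_into U \<phi>)"
    if U: "(U, \<phi>) \<in> A" for U \<phi> k
  proof -
    have "Ck_on k (\<phi> ` (U \<inter> (W \<inter> T))) (f \<circ> inv_into U \<phi>)"
      by (rule Ck_on_subset[where S = "\<phi> ` (U \<inter> W)"]) (use W(3) U in \<open>auto simp: smooth_on_def\<close>)
    moreover have "Ck_on k (\<phi> ` (U \<inter> (W \<inter> T))) (g \<circ> inv_into U \<phi>)"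
      by (rule Ck_on_subset[where S = "\<phi> ` (U \<inter> T)"]) (use T(3) U in \<open>auto simp: smooth_on_def\<close>)
    ultimately show ?thesis
      using C open_chart_image[OF A U open_Int[OF W(1) T(1)]] by (fastforce simp: o_def)
  qed
  then show ?thesis
    unfolding smooth_at_def using W T
    by (intro exI[of _ "W \<inter> T"]) (auto simp: smooth_on_def)
qed

lemma smooth_at_const: "smooth_at A (\<lambda>y. c) x"
  unfolding smooth_at_def
  by (intro exI[of _ UNIV]) (auto simp: smooth_on_def o_def Ck_on_const)

lemma smooth_at_add:
  assumes "smooth_atlas A" "smooth_at A f x" "smooth_at A g x"
  shows "smooth_at A (\<lambda>y. f y + g y) x"
  by (rule smooth_at_combine[OF assms, where F = "(+)"]) (rule Ck_on_add)

lemma smooth_at_mult: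
  assumes "smooth_atlas A" "smooth_at A f x" "smooth_at A g x"
  shows "smooth_at A (\<lambda>y. f y * g y) x"
  by (rule smooth_at_combine[OF assms, where F = "(*)"]) (rule Ck_on_mult)

lemma smooth_at_diff:
  assumes "smooth_atlas A" "smooth_at A f x" "smooth_at A g x"
  shows "smooth_at A (\<lambda>y. f y - g y) x"
  using smooth_at_add[OF assms(1,2) smooth_at_mult[OF assms(1) smooth_at_const[of A "-1"] assms(3)]]
  by simp

lemma smooth_at_nonzero_nbhd:
  assumes A: "smooth_atlas A" and f: "smooth_at A f x" "f x \<noteq> 0"
  obtains T where "open T" "x \<in> T" "\<And>y. y \<in> T \<Longrightarrow> f y \<noteq> 0"
proof -
  obtain U \<phi> where U: "(U, \<phi>) \<in> A" "x \<in> U" using A by (rule smooth_atlas_cover)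
  note UD = smooth_atlasD[OF A U(1)]
  obtain W where W: "open W" "x \<in> W" "smooth_on (\<phi> ` (U \<inter> W)) (f \<circ> inv_into U \<phi>)"
    using f U by (auto simp: smooth_at_def)
  then have "Ck_on 0 (\<phi> ` (U \<inter> W)) (f \<circ> inv_into U \<phi>)"
    unfolding smooth_on_def by blast
  then have "continuous_on (\<phi> ` (U \<inter> W)) (f \<circ> inv_into U \<phi>)" by simp
  moreover have "continuous_on (U \<inter> W) \<phi>"
    using UD(3) by (auto simp: homeomorphism_def intro: continuous_on_subset)
  ultimately have "continuous_on (U \<inter> W) ((f \<circ> inv_into U \<phi>) \<circ> \<phi>)"
    using continuous_on_compose by blast
  then have c: "continuous_on (U \<inter> W) f"
    by (rule continuous_on_eq) (use UD(4) in auto)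
  have "open ((U \<inter> W) \<inter> f -` (- {0}))"
    by (rule continuous_open_preimage[OF c]) (use UD W in auto)
  then show ?thesis
    by (rule that) (use U W f in auto)
qed

lemma smooth_at_inverse:
  assumes A: "smooth_atlas A" and f: "smooth_at A f x" "f x \<noteq> 0"
  shows "smooth_at A (\<lambda>y. inverse (f y)) x"
proof -
  obtain W where W: "open W" "x \<in> W" "\<forall>(U, \<phi>)\<in>A. smooth_on (\<phi> ` (U \<inter> W)) (f \<circ> inv_into U \<phi>)"
    using f by (auto simp: smooth_at_def)
  obtain T where T: "open T" "x \<in> T" "\<And>y. y \<in> T \<Longrightarrow> f y \<noteq> 0"
    using smooth_at_nonzero_nbhd[OF assms] by metis
  have "Ck_on k (\<phi> ` (U \<inter> (W \<inter> T))) ((\<lambda>y. inverse (f y)) \<circ> inv_into U \<phi>)"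
    if U: "(U, \<phi>) \<in> A" for U \<phi> k
  proof -
    have "Ck_on k (\<phi> ` (U \<inter> (W \<inter> T))) (f \<circ> inv_into U \<phi>)"
      by (rule Ck_on_subset[where S = "\<phi> ` (U \<inter> W)"]) (use W(3) U in \<open>auto simp: smooth_on_def\<close>)
    then have "Ck_on k (\<phi> ` (U \<inter> (W \<inter> T))) (\<lambda>z. inverse ((f \<circ> inv_into U \<phi>) z))"
      by (rule Ck_on_inverse[OF open_chart_image[OF A U open_Int[OF W(1) T(1)]]])
        (use T(3) smooth_atlasD(4)[OF A U] in auto)
    then show ?thesis by (simp add: o_def)
  qed
  then show ?thesis
    unfolding smooth_at_def using W T
    by (intro exI[of _ "W \<inter> T"]) (auto simp: smooth_on_def)
qed

text \<open>Gaussian elimination over the germs of smooth functions.\<close>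

lemma smooth_at_linear_system:
  assumes A: "smooth_atlas A" and "finite I"
    and "\<And>i j. i \<in> I \<Longrightarrow> j \<in> I \<Longrightarrow> smooth_at A (M i j) x"
    and "\<And>i j. i \<in> I \<Longrightarrow> j \<in> I \<Longrightarrow> M i j x = (if i = j then 1 else 0)"
    and "\<And>j. j \<in> I \<Longrightarrow> smooth_at A (r j) x"
    and "open T" "x \<in> T" "\<And>j y. j \<in> I \<Longrightarrow> y \<in> T \<Longrightarrow> (\<Sum>i\<in>I. c i y * M i j y) = r j y"
    and "i \<in> I"
  shows "smooth_at A (c i) x"
  using assms(2-)
proof (induction I arbitrary: M r T i rule: finite_induct)
  case empty
  then show ?case by simp
next
  case (insert e I)
  have Me: "smooth_at A (M e e) x" "M e e x \<noteq> 0" using insert.prems(1,2) by auto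
  obtain T' where T': "open T'" "x \<in> T'" "\<And>y. y \<in> T' \<Longrightarrow> M e e y \<noteq> 0"
    using smooth_at_nonzero_nbhd[OF A Me] by metis
  define q where "q = (\<lambda>y. inverse (M e e y))"
  have q: "smooth_at A q x"
    unfolding q_def by (rule smooth_at_inverse[OF A Me])
  have ce: "c e y = (r e y - (\<Sum>i\<in>I. c i y * M i e y)) * q y" if "y \<in> T \<inter> T'" for y
    using insert.prems(6)[of e y] insert.hyps that T'(3)[of y] by (auto simp: q_def field_simps)
  \<comment> \<open>After elimination with the pivot \<open>M e e\<close>, the Schur complement is
    again the identity matrix at \<open>x\<close>, because the off-diagonal entries of
    \<open>M\<close> vanish there. So the induction hypothesis applies to it.\<close>
  have sm: "smooth_at A (c i) x" if "i \<in> I" for i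
  proof (rule insert.IH[where T = "T \<inter> T'"
        and M = "\<lambda>i j y. M i j y - M i e y * q y * M e j y" and r = "\<lambda>j y. r j y - r e y * q y * M e j y"])
    fix j y assume j: "j \<in> I" "y \<in> T \<inter> T'"
    have "r j y = c e y * M e j y + (\<Sum>i\<in>I. c i y * M i j y)"
      using insert.prems(6)[of j y] insert.hyps j by simp
    then have "r j y - r e y * q y * M e j y =
        (\<Sum>i\<in>I. c i y * M i j y) - (\<Sum>i\<in>I. c i y * M i e y) * q y * M e j y"
      using ce[OF j(2)] by (simp add: algebra_simps)
    also have "\<dots> = (\<Sum>i\<in>I. c i y * (M i j y - M i e y * q y * M e j y))"
      by (simp add: algebra_simps sum_subtractf sum_distrib_left sum_distrib_right)
    finally show "(\<Sum>i\<in>I. c i y * (M i j y - M i e y * q y * M e j y)) = r j y - r e y * q y * M e j y"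
      by simp
  next
    fix i j assume "i \<in> I" "j \<in> I"
    then show "smooth_at A (\<lambda>y. M i j y - M i e y * q y * M e j y) x"
      using insert.prems(1) by (intro smooth_at_diff[OF A] smooth_at_mult[OF A] q) auto
    show "M i j x - M i e x * q x * M e j x = (if i = j then 1 else 0)"
      using insert.prems(2) insert.hyps \<open>i \<in> I\<close> \<open>j \<in> I\<close> by auto
  next
    fix j assume "j \<in> I"
    then show "smooth_at A (\<lambda>y. r j y - r e y * q y * M e j y) x"
      using insert.prems(1,3) by (intro smooth_at_diff[OF A] smooth_at_mult[OF A] q) auto
  qed (use that insert.prems T' in auto)
  have s: "smooth_at A (\<lambda>y. \<Sum>i\<in>I. c i y * M i e y) x"
  proof -
    have "smooth_at A (\<lambda>y. \<Sum>i\<in>J. c i y * M i e y) x" if "finite J" "J \<subseteq> I" for J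
      using that
      by (induction J rule: finite_induct)
        (auto intro!: smooth_at_const smooth_at_add[OF A] smooth_at_mult[OF A] sm insert.prems(1))
    then show ?thesis using insert.hyps by blast
  qed
  have "smooth_at A (c e) x"
    by (rule smooth_at_cong[OF A, where T = "T \<inter> T'"
          and f = "\<lambda>y. (r e y - (\<Sum>i\<in>I. c i y * M i e y)) * q y"])
      (use ce s q insert.prems T' in \<open>auto intro!: smooth_at_diff[OF A] smooth_at_mult[OF A]\<close>)
  then show ?case using sm insert.prems(7) by blast
qed

section \<open>Global smooth functions and vector fields as derivations\<close>

lemma sum_apply_fun: "sum f I x = (\<Sum>i\<in>I. f i x)"
  by (induction I rule: infinite_finite_induct) auto

lemma smooth_funs_const: "smooth_atlas A \<Longrightarrow> (\<lambda>x. c) \<in> smooth_funs A"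
  by (simp add: smooth_funs_iff_smooth_at smooth_at_const)

lemma smooth_funs_add: "smooth_atlas A \<Longrightarrow> f \<in> smooth_funs A \<Longrightarrow> g \<in> smooth_funs A \<Longrightarrow>
    f + g \<in> smooth_funs A"
  by (simp add: smooth_funs_iff_smooth_at smooth_at_add plus_fun_def)

lemma smooth_funs_mult: "smooth_atlas A \<Longrightarrow> f \<in> smooth_funs A \<Longrightarrow> g \<in> smooth_funs A \<Longrightarrow>
    f * g \<in> smooth_funs A"
  by (simp add: smooth_funs_iff_smooth_at smooth_at_mult times_fun_def)

lemma smooth_funs_differentiable:
  assumes "smooth_atlas A" "f \<in> smooth_funs A" "(U, \<phi>) \<in> A" "x \<in> U"
  shows "(f \<circ> inv_into U \<phi>) differentiable at (\<phi> x)"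
proof -
  have "smooth_on (\<phi> ` U) (f \<circ> inv_into U \<phi>)"
    using assms by (auto simp: smooth_funs_def)
  then have "Ck_on (Suc 0) (\<phi> ` U) (f \<circ> inv_into U \<phi>)"
    unfolding smooth_on_def by blast
  then show ?thesis
    using smooth_atlasD(2)[OF assms(1,3)] assms(4)
    by (auto simp: differentiable_on_eq_differentiable_at)
qed

lemma smooth_funs_chart_deriv:
  assumes "smooth_atlas A" "f \<in> smooth_funs A" "(U, \<phi>) \<in> A" "x \<in> U"
  shows "((f \<circ> inv_into U \<phi>) has_derivative frechet_derivative (f \<circ> inv_into U \<phi>) (at (\<phi> x))) (at (\<phi> x))"
    and "linear (frechet_derivative (f \<circ> inv_into U \<phi>) (at (\<phi> x)))"
  using smooth_funs_differentiable[OF assms]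
  by (simp_all add: frechet_derivative_works linear_frechet_derivative)

abbreviation (input) vf_smult :: "('g \<Rightarrow> real) \<Rightarrow> 'g vfield \<Rightarrow> 'g vfield"
  where "vf_smult h Y \<equiv> (\<lambda>f. h * Y f)"

lemma vfD:
  assumes "Y \<in> vector_fields A"
  shows vf_smooth: "f \<in> smooth_funs A \<Longrightarrow> Y f \<in> smooth_funs A"
    and vf_nonsmooth: "f \<notin> smooth_funs A \<Longrightarrow> Y f = 0"
    and vf_tangent: "(U, \<phi>) \<in> A \<Longrightarrow> x \<in> U \<Longrightarrow> \<exists>a. \<forall>f\<in>smooth_funs A.
       Y f x = frechet_derivative (f \<circ> inv_into U \<phi>) (at (\<phi> x)) a"
  using assms unfolding vector_fields_def by auto

lemma vf_add:
  assumes A: "smooth_atlas A" and Y: "Y \<in> vector_fields A"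
    and fg: "f \<in> smooth_funs A" "g \<in> smooth_funs A"
  shows "Y (f + g) = Y f + Y g"
proof
  fix x
  obtain U \<phi> where U: "(U, \<phi>) \<in> A" "x \<in> U" using A by (rule smooth_atlas_cover)
  obtain a where a: "\<forall>f\<in>smooth_funs A. Y f x = frechet_derivative (f \<circ> inv_into U \<phi>) (at (\<phi> x)) a"
    using vf_tangent[OF Y U] by blast
  have "((\<lambda>z. (f \<circ> inv_into U \<phi>) z + (g \<circ> inv_into U \<phi>) z) has_derivative
      (\<lambda>v. frechet_derivative (f \<circ> inv_into U \<phi>) (at (\<phi> x)) v +
           frechet_derivative (g \<circ> inv_into U \<phi>) (at (\<phi> x)) v)) (at (\<phi> x))"
    by (intro has_derivative_add smooth_funs_chart_deriv[OF A _ U] fg)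
  moreover have "(\<lambda>z. (f \<circ> inv_into U \<phi>) z + (g \<circ> inv_into U \<phi>) z) = (f + g) \<circ> inv_into U \<phi>"
    by (auto simp: plus_fun_def)
  ultimately have der: "((f + g) \<circ> inv_into U \<phi> has_derivative
      (\<lambda>v. frechet_derivative (f \<circ> inv_into U \<phi>) (at (\<phi> x)) v +
           frechet_derivative (g \<circ> inv_into U \<phi>) (at (\<phi> x)) v)) (at (\<phi> x))"
    by simp
  then show "Y (f + g) x = (Y f + Y g) x"
    using a fg smooth_funs_add[OF A fg] frechet_derivative_at[OF der, symmetric] by simp
qed

text \<open>One tangent vector at the point serves all functions at once, so this is the product
  rule for the derivative in a chart.\<close>

lemma vf_mult:
  assumes A: "smooth_atlas A" and Y: "Y \<in> vector_fields A"
    and fg: "f \<in> smooth_funs A" "g \<in> smooth_funs A"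
  shows "Y (f * g) = f * Y g + Y f * g"
proof
  fix x
  obtain U \<phi> where U: "(U, \<phi>) \<in> A" "x \<in> U" using A by (rule smooth_atlas_cover)
  obtain a where a: "\<forall>f\<in>smooth_funs A. Y f x = frechet_derivative (f \<circ> inv_into U \<phi>) (at (\<phi> x)) a"
    using vf_tangent[OF Y U] by blast
  have "((\<lambda>z. (f \<circ> inv_into U \<phi>) z * (g \<circ> inv_into U \<phi>) z) has_derivative
      (\<lambda>v. (f \<circ> inv_into U \<phi>) (\<phi> x) * frechet_derivative (g \<circ> inv_into U \<phi>) (at (\<phi> x)) v +
        frechet_derivative (f \<circ> inv_into U \<phi>) (at (\<phi> x)) v * (g \<circ> inv_into U \<phi>) (\<phi> x))) (at (\<phi> x))"
    by (intro has_derivative_mult smooth_funs_chart_deriv[OF A _ U] fg)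
  moreover have "(\<lambda>z. (f \<circ> inv_into U \<phi>) z * (g \<circ> inv_into U \<phi>) z) = (f * g) \<circ> inv_into U \<phi>"
    by (auto simp: times_fun_def)
  ultimately have der: "((f * g) \<circ> inv_into U \<phi> has_derivative
      (\<lambda>v. (f \<circ> inv_into U \<phi>) (\<phi> x) * frechet_derivative (g \<circ> inv_into U \<phi>) (at (\<phi> x)) v +
        frechet_derivative (f \<circ> inv_into U \<phi>) (at (\<phi> x)) v * (g \<circ> inv_into U \<phi>) (\<phi> x))) (at (\<phi> x))"
    by simp
  then show "Y (f * g) x = (f * Y g + Y f * g) x"
    using a fg smooth_funs_mult[OF A fg] smooth_atlasD(4)[OF A U(1)] U(2)
      frechet_derivative_at[OF der, symmetric] by simp
qed

lemma vf_const:
  assumes A: "smooth_atlas A" and Y: "Y \<in> vector_fields A"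
  shows "Y (\<lambda>x. c) = 0"
proof
  fix x
  obtain U \<phi> where U: "(U, \<phi>) \<in> A" "x \<in> U" using A by (rule smooth_atlas_cover)
  obtain a where a: "\<forall>f\<in>smooth_funs A. Y f x = frechet_derivative (f \<circ> inv_into U \<phi>) (at (\<phi> x)) a"
    using vf_tangent[OF Y U] by blast
  show "Y (\<lambda>x. c) x = 0 x"
    using a smooth_funs_const[OF A, of c] by (simp add: o_def)
qed

lemma vf_zero:
  assumes A: "smooth_atlas A"
  shows "0 \<in> vector_fields A"
proof -
  have z: "(0 :: 'a \<Rightarrow> real) \<in> smooth_funs A"
    using smooth_funs_const[OF A, of 0] by (simp add: zero_fun_def)
  have "\<exists>a. \<forall>f\<in>smooth_funs A. 0 = frechet_derivative (f \<circ> inv_into U \<phi>) (at (\<phi> x)) a"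
    if "(U, \<phi>) \<in> A" "x \<in> U" for U \<phi> x
    by (rule exI[of _ 0]) (use smooth_funs_chart_deriv(2)[OF A _ that] linear_0 in force)
  then show ?thesis using z by (auto simp: vector_fields_def)
qed

lemma vf_plus:
  assumes A: "smooth_atlas A" and "Y \<in> vector_fields A" "Z \<in> vector_fields A"
  shows "Y + Z \<in> vector_fields A"
proof -
  have "\<exists>a. \<forall>f\<in>smooth_funs A. (Y + Z) f x = frechet_derivative (f \<circ> inv_into U \<phi>) (at (\<phi> x)) a"
    if U: "(U, \<phi>) \<in> A" "x \<in> U" for U \<phi> x
  proof -
    obtain a where "\<forall>f\<in>smooth_funs A. Y f x = frechet_derivative (f \<circ> inv_into U \<phi>) (at (\<phi> x)) a"
      using vf_tangent[OF assms(2) U] by blast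
    moreover obtain b where "\<forall>f\<in>smooth_funs A. Z f x = frechet_derivative (f \<circ> inv_into U \<phi>) (at (\<phi> x)) b"
      using vf_tangent[OF assms(3) U] by blast
    ultimately show ?thesis
      by (intro exI[of _ "a + b"]) (simp add: linear_add[OF smooth_funs_chart_deriv(2)[OF A _ U]])
  qed
  then show ?thesis
    using vf_smooth[OF assms(2)] vf_smooth[OF assms(3)] vf_nonsmooth[OF assms(2)]
      vf_nonsmooth[OF assms(3)]
    by (auto simp: vector_fields_def smooth_funs_add[OF A])
qed

lemma vf_smult:
  assumes A: "smooth_atlas A" and "Y \<in> vector_fields A" "h \<in> smooth_funs A"
  shows "vf_smult h Y \<in> vector_fields A"
proof -
  have "\<exists>a. \<forall>f\<in>smooth_funs A. (h * Y f) x = frechet_derivative (f \<circ> inv_into U \<phi>) (at (\<phi> x)) a"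
    if U: "(U, \<phi>) \<in> A" "x \<in> U" for U \<phi> x
  proof -
    obtain a where "\<forall>f\<in>smooth_funs A. Y f x = frechet_derivative (f \<circ> inv_into U \<phi>) (at (\<phi> x)) a"
      using vf_tangent[OF assms(2) U] by blast
    then show ?thesis
      by (intro exI[of _ "h x *\<^sub>R a"])
        (simp add: linear_scale[OF smooth_funs_chart_deriv(2)[OF A _ U]])
  qed
  then show ?thesis
    using vf_smooth[OF assms(2)] vf_nonsmooth[OF assms(2)] assms(3)
    by (auto simp: vector_fields_def smooth_funs_mult[OF A])
qed

section \<open>The left-invariant frame\<close>

context positively_graded_group
begin

lemma atlas: "smooth_atlas A"
  using lie_group by (simp add: lie_group_def)

lemma group_G: "group G" "carrier G = UNIV"
  using lie_group by (simp_all add: lie_group_def)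

abbreviation (input) "SF \<equiv> smooth_funs A"
abbreviation (input) "VF \<equiv> vector_fields A"

lemma SF_const [simp, intro]: "(\<lambda>x. c) \<in> SF"
  and SF_add [simp, intro]: "f \<in> SF \<Longrightarrow> g \<in> SF \<Longrightarrow> f + g \<in> SF"
  and SF_mult [simp, intro]: "f \<in> SF \<Longrightarrow> g \<in> SF \<Longrightarrow> f * g \<in> SF"
  by (simp_all add: atlas smooth_funs_const smooth_funs_add smooth_funs_mult)

lemma SF_zero [simp, intro]: "0 \<in> SF"
  using SF_const[of 0] by (simp add: zero_fun_def)

lemma SF_one [simp, intro]: "1 \<in> SF"
  using SF_const[of 1] by (simp add: one_fun_def)

lemma SF_uminus [simp, intro]: "f \<in> SF \<Longrightarrow> - f \<in> SF"
  using SF_mult[OF SF_const[of "-1"], of f] by (simp add: times_fun_def fun_Compl_def)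

lemma SF_diff [simp, intro]: "f \<in> SF \<Longrightarrow> g \<in> SF \<Longrightarrow> f - g \<in> SF"
  using SF_add[OF _ SF_uminus, of f g] by simp

lemma SF_sum [intro]: "(\<And>i. i \<in> I \<Longrightarrow> f i \<in> SF) \<Longrightarrow> sum f I \<in> SF"
  by (induction I rule: infinite_finite_induct) auto

lemma VF_zero [simp, intro]: "0 \<in> VF"
  and VF_add [simp, intro]: "Y \<in> VF \<Longrightarrow> Z \<in> VF \<Longrightarrow> Y + Z \<in> VF"
  and VF_smult [simp, intro]: "h \<in> SF \<Longrightarrow> Y \<in> VF \<Longrightarrow> vf_smult h Y \<in> VF"
  by (simp_all add: atlas vf_zero vf_plus vf_smult)

lemma VF_sum [intro]: "(\<And>i. i \<in> I \<Longrightarrow> Y i \<in> VF) \<Longrightarrow> sum Y I \<in> VF"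
  by (induction I rule: infinite_finite_induct) auto

lemma VF_app [simp, intro]: "Y \<in> VF \<Longrightarrow> Y f \<in> SF"
  by (metis SF_zero vf_nonsmooth vf_smooth)

lemma VF_app_add: "Y \<in> VF \<Longrightarrow> f \<in> SF \<Longrightarrow> g \<in> SF \<Longrightarrow> Y (f + g) = Y f + Y g"
  and VF_app_mult: "Y \<in> VF \<Longrightarrow> f \<in> SF \<Longrightarrow> g \<in> SF \<Longrightarrow> Y (f * g) = f * Y g + Y f * g"
  and VF_app_const: "Y \<in> VF \<Longrightarrow> Y (\<lambda>x. c) = 0"
  by (rule vf_add[OF atlas] vf_mult[OF atlas] vf_const[OF atlas]; assumption)+

lemma VF_app_zero: "Y \<in> VF \<Longrightarrow> Y 0 = 0"
  using VF_app_const[of Y 0] by (simp add: zero_fun_def)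

lemma VF_app_uminus: "Y \<in> VF \<Longrightarrow> f \<in> SF \<Longrightarrow> Y (- f) = - Y f"
  by (metis SF_uminus VF_app_add VF_app_zero add.right_inverse minus_unique)

lemma VF_app_diff: "Y \<in> VF \<Longrightarrow> f \<in> SF \<Longrightarrow> g \<in> SF \<Longrightarrow> Y (f - g) = Y f - Y g"
  using VF_app_add[of Y f "- g"] VF_app_uminus[of Y g] by simp

lemma X_VF [simp, intro]: "X v \<in> VF"
  using X_bij by (auto simp: bij_betw_def left_inv_fields_def)

lemma X_app_zero [simp]: "X v 0 = 0"
  by (rule VF_app_zero[OF X_VF])

lemma X_push: "push_left G g (X v) = X v"
  using X_bij by (auto simp: bij_betw_def left_inv_fields_def)

lemma X_add: "X (u + v) = X u + X v"
  using linear_add[OF X_linear] by (auto simp: fun_eq_iff)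

lemma X_scale: "X (c *\<^sub>R v) = vf_smult (\<lambda>x. c) (X v)"
  using linear_scale[OF X_linear] by (auto simp: fun_eq_iff)

lemma X_zero [simp]: "X 0 = 0"
  using linear_0[OF X_linear] by (auto simp: fun_eq_iff)

section \<open>The frame at a point and the coordinates of vector fields\<close>

lemma X_app_expand: "X v f x = (\<Sum>e\<in>Basis. (v \<bullet> e) * X e f x)"
proof -
  have "X (\<Sum>e\<in>Basis. (v \<bullet> e) *\<^sub>R e) f x = (\<Sum>e\<in>Basis. (v \<bullet> e) * X e f x)"
    by (simp add: linear_sum[OF X_linear] linear_scale[OF X_linear])
  then show ?thesis by (simp add: euclidean_representation)
qed

lemma X_translate: "X v f y = X v (\<lambda>z. f (g \<otimes>\<^bsub>G\<^esub> z)) (inv\<^bsub>G\<^esub> g \<otimes>\<^bsub>G\<^esub> y)"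
  using X_push[of g v] by (auto simp: push_left_def fun_eq_iff)

text \<open>Left translation carries the vanishing at \<open>x\<close> to every other point, so
  \<open>X v\<close> is the zero operator and injectivity of \<open>X\<close> applies.\<close>

lemma frame_injective:
  assumes "\<And>f. f \<in> SF \<Longrightarrow> X v f x = 0"
  shows "v = 0"
proof -
  interpret group G by (rule group_G)
  \<comment> \<open>Functions that are not smooth are sent to 0 by every field, so this covers the
    translates of smooth functions, whatever their smoothness.\<close>
  have *: "X v f x = 0" for f
    using assms vf_nonsmooth[OF X_VF] by (cases "f \<in> SF") auto
  have "X v f y = 0" for f y
  proof -
    define g where "g = y \<otimes>\<^bsub>G\<^esub> inv\<^bsub>G\<^esub> x"
    have "inv\<^bsub>G\<^esub> g \<otimes>\<^bsub>G\<^esub> y = x"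
      by (simp add: g_def group_G inv_mult_group m_assoc)
    then show ?thesis using X_translate[of v f y g] * by simp
  qed
  then have "X v = X 0" by (auto simp: fun_eq_iff)
  then show ?thesis using X_bij by (auto simp: bij_betw_def inj_on_def)
qed

text \<open>Injectivity comes from \<open>frame_injective\<close>, and surjectivity from equality of
  dimensions, since the charts and the Lie algebra share the space \<open>'v\<close>.\<close>

lemma frame_chart:
  assumes U: "(U, \<phi>) \<in> A" "x \<in> U"
  obtains a :: "'v \<Rightarrow> 'v" where "linear a" "surj a"
    "\<And>v f. f \<in> SF \<Longrightarrow> X v f x = frechet_derivative (f \<circ> inv_into U \<phi>) (at (\<phi> x)) (a v)"
proof -
  let ?D = "\<lambda>f. frechet_derivative (f \<circ> inv_into U \<phi>) (at (\<phi> x))"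
  have "\<exists>a. \<forall>f\<in>SF. X v f x = ?D f a" for v
    by (rule vf_tangent[OF X_VF U])
  then obtain a where a: "\<And>v f. f \<in> SF \<Longrightarrow> X v f x = ?D f (a v)"
    by metis
  \<comment> \<open>The tangent vectors \<open>a v\<close> were chosen separately for each
    \<open>v\<close> and need not depend linearly on it; extending linearly from
    \<open>Basis\<close> repairs this.\<close>
  define a' where "a' v = (\<Sum>e\<in>Basis. (v \<bullet> e) *\<^sub>R a e)" for v
  have lin: "linear a'"
    unfolding a'_def
    by (intro linearI) (auto simp: inner_add_left scaleR_left_distrib sum.distrib scaleR_sum_right)
  have D: "X v f x = ?D f (a' v)" if "f \<in> SF" for v f
    using smooth_funs_chart_deriv(2)[OF atlas that U] a that
    by (simp add: a'_def linear_sum linear_scale X_app_expand[of v])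
  have "v = 0" if "a' v = 0" for v
  proof (rule frame_injective)
    show "X v f x = 0" if "f \<in> SF" for f
      using D[OF that, of v] linear_0[OF smooth_funs_chart_deriv(2)[OF atlas that U]] \<open>a' v = 0\<close>
      by simp
  qed
  then have "inj a'" using lin linear_injective_0 by blast
  then have "surj a'" using lin linear_injective_imp_surjective by blast
  then show ?thesis using that lin D by blast
qed

lemma frame_spans:
  assumes "Y \<in> VF"
  shows "\<exists>!v. \<forall>f\<in>SF. Y f x = X v f x"
proof -
  obtain U \<phi> where U: "(U, \<phi>) \<in> A" "x \<in> U" using atlas by (rule smooth_atlas_cover)
  obtain a where a: "surj a"
    "\<And>v f. f \<in> SF \<Longrightarrow> X v f x = frechet_derivative (f \<circ> inv_into U \<phi>) (at (\<phi> x)) (a v)"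
    using frame_chart[OF U] by metis
  obtain b where "\<forall>f\<in>SF. Y f x = frechet_derivative (f \<circ> inv_into U \<phi>) (at (\<phi> x)) b"
    using vf_tangent[OF assms U] by blast
  moreover obtain v where "b = a v"
    using a(1) by (metis surjD)
  ultimately have ex: "\<forall>f\<in>SF. Y f x = X v f x"
    using a(2) by simp
  show ?thesis
  proof (rule ex1I[of _ v])
    show "\<forall>f\<in>SF. Y f x = X v f x" by fact
    fix w assume w: "\<forall>f\<in>SF. Y f x = X w f x"
    have "w - v = 0"
    proof (rule frame_injective)
      fix f assume "f \<in> SF"
      then have "X w f x = X v f x" using w ex by metis
      then show "X (w - v) f x = 0" by (simp add: linear_diff[OF X_linear])
    qed
    then show "w = v" by simp
  qed
qed

definition coord :: "'g vfield \<Rightarrow> 'g \<Rightarrow> 'v"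
  where "coord Y x = (THE v. \<forall>f\<in>SF. Y f x = X v f x)"

lemma coord:
  assumes "Y \<in> VF"
  shows "Y f x = X (coord Y x) f x"
proof (cases "f \<in> SF")
  case True
  then show ?thesis using theI'[OF frame_spans[OF assms, of x]] unfolding coord_def by blast
qed (simp add: vf_nonsmooth[OF assms] vf_nonsmooth[OF X_VF])

lemma coord_eqI:
  assumes "Y \<in> VF" "\<And>f. f \<in> SF \<Longrightarrow> Y f x = X v f x"
  shows "coord Y x = v"
  using frame_spans[OF assms(1), of x] coord[OF assms(1)] assms(2) by metis

lemma coord_X [simp]: "coord (X v) x = v"
  by (rule coord_eqI) auto

lemma coord_add: "Y \<in> VF \<Longrightarrow> Z \<in> VF \<Longrightarrow> coord (Y + Z) x = coord Y x + coord Z x"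
  by (rule coord_eqI) (auto simp: X_add coord[symmetric])

lemma coord_smult: "Y \<in> VF \<Longrightarrow> h \<in> SF \<Longrightarrow> coord (vf_smult h Y) x = h x *\<^sub>R coord Y x"
  by (rule coord_eqI) (auto simp: X_scale coord[symmetric])

text \<open>If the gradients of the smooth functions along the frame filled only a proper subspace,
  a nonzero \<open>v\<close> orthogonal to it would give a field killing all functions at
  \<open>x\<close>.\<close>

lemma dual_functions:
  obtains f where "\<And>e. f e \<in> SF" "\<And>v e. X v (f e) x = v \<bullet> e"
proof -
  define T where "T = (\<lambda>f. \<Sum>e\<in>Basis. X e f x *\<^sub>R e) ` SF"
  have T: "v \<bullet> (\<Sum>e\<in>Basis. X e f x *\<^sub>R e) = X v f x" for v f
    by (simp add: inner_sum_right X_app_expand[of v] mult.commute)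
  have "subspace T"
    unfolding subspace_def
  proof (intro conjI ballI allI)
    show "0 \<in> T" unfolding T_def by (rule image_eqI[of _ _ 0]) auto
  next
    fix u v assume "u \<in> T" "v \<in> T"
    then obtain f g where "f \<in> SF" "g \<in> SF" "u = (\<Sum>e\<in>Basis. X e f x *\<^sub>R e)" "v = (\<Sum>e\<in>Basis. X e g x *\<^sub>R e)"
      by (auto simp: T_def)
    then show "u + v \<in> T"
      unfolding T_def
      by (intro image_eqI[of _ _ "f + g"]) (auto simp: VF_app_add scaleR_left_distrib sum.distrib)
  next
    fix c u assume "u \<in> T"
    then obtain f where "f \<in> SF" "u = (\<Sum>e\<in>Basis. X e f x *\<^sub>R e)"
      by (auto simp: T_def)
    then show "c *\<^sub>R u \<in> T"
      unfolding T_def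
      by (intro image_eqI[of _ _ "(\<lambda>x. c) * f"])
        (auto simp: VF_app_mult VF_app_const scaleR_sum_right)
  qed
  have "T = UNIV"
  proof (rule ccontr)
    assume "T \<noteq> UNIV"
    then obtain v where v: "v \<noteq> 0" "\<forall>u\<in>T. v \<bullet> u = 0"
      using span_not_UNIV_orthogonal[of T] \<open>subspace T\<close> span_eq_iff by metis
    then have "v = 0" using T by (intro frame_injective) (auto simp: T_def)
    then show False using v by simp
  qed
  then have "\<exists>f\<in>SF. (\<Sum>e\<in>Basis. X e f x *\<^sub>R e) = u" for u
    unfolding T_def by (metis (no_types, lifting) UNIV_I imageE)
  then obtain f where f: "\<And>u. f u \<in> SF" "\<And>u. (\<Sum>e\<in>Basis. X e (f u) x *\<^sub>R e) = u"
    by metis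
  show ?thesis using that[of f] f T by metis
qed

text \<open>Applying \<open>Y\<close> to functions that are dual to the frame at \<open>x\<close>
  gives a linear system for the coordinates, with smooth entries and the identity matrix at
  \<open>x\<close>.\<close>

lemma coord_smooth:
  assumes "Y \<in> VF"
  shows "(\<lambda>x. coord Y x \<bullet> u) \<in> SF"
proof -
  have *: "(\<lambda>x. coord Y x \<bullet> e) \<in> SF" if "e \<in> Basis" for e
    unfolding smooth_funs_iff_smooth_at[OF atlas]
  proof
    fix x
    obtain f where f: "\<And>e. f e \<in> SF" "\<And>v e. X v (f e) x = v \<bullet> e"
      using dual_functions by metis
    have sm: "smooth_at A g x" if "g \<in> SF" for g
      using that smooth_funs_iff_smooth_at[OF atlas] by blast
    show "smooth_at A (\<lambda>x. coord Y x \<bullet> e) x"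
      by (rule smooth_at_linear_system[OF atlas, where I = Basis and M = "\<lambda>i j. X i (f j)"
            and r = "\<lambda>j. Y (f j)" and c = "\<lambda>i y. coord Y y \<bullet> i" and T = UNIV])
        (use that f in \<open>auto simp: inner_Basis assms coord[OF assms] X_app_expand[of "coord Y _"] intro!: sm\<close>)
  qed
  have "(\<lambda>x. coord Y x \<bullet> u) = (\<Sum>e\<in>Basis. (\<lambda>x. u \<bullet> e) * (\<lambda>x. coord Y x \<bullet> e))"
    by (auto simp: fun_eq_iff sum_apply_fun euclidean_inner[of _ u] mult.commute)
  also have "\<dots> \<in> SF" using * by auto
  finally show ?thesis .
qed

section \<open>Left translations of functions and fields\<close>

lemma constant_if_frame_zero:
  assumes f: "f \<in> SF" and "\<And>v y. X v f y = 0"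
  shows "f x = f y"
proof (rule connected_local_const[where A = UNIV and f = f and a = x and b = y])
  show "connected (UNIV :: 'g set)" by (rule connected)
  show "\<forall>a\<in>UNIV. \<forall>\<^sub>F b in at a within UNIV. f a = f b"
  proof
    fix z
    obtain U \<phi> where U: "(U, \<phi>) \<in> A" "z \<in> U" using atlas by (rule smooth_atlas_cover)
    note UD = smooth_atlasD[OF atlas U(1)]
    have der: "((f \<circ> inv_into U \<phi>) has_derivative (\<lambda>h. 0)) (at w)" if "w \<in> \<phi> ` U" for w
    proof -
      obtain y where y: "y \<in> U" "w = \<phi> y" using \<open>w \<in> \<phi> ` U\<close> by blast
      obtain a where a: "surj a"
        "\<And>v f. f \<in> SF \<Longrightarrow> X v f y = frechet_derivative (f \<circ> inv_into U \<phi>) (at (\<phi> y)) (a v)"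
        using frame_chart[OF U(1) y(1)] by metis
      \<comment> \<open>The frame spans all directions of the chart, so vanishing along the frame is
        vanishing of the whole derivative.\<close>
      have "frechet_derivative (f \<circ> inv_into U \<phi>) (at (\<phi> y)) = (\<lambda>h. 0)"
      proof
        fix h
        obtain v where "h = a v" using a(1) by auto
        then show "frechet_derivative (f \<circ> inv_into U \<phi>) (at (\<phi> y)) h = 0"
          using a(2)[OF f, of v] assms(2) by simp
      qed
      then show ?thesis using smooth_funs_chart_deriv(1)[OF atlas f U(1) y(1)] y by simp
    qed
    \<comment> \<open>A ball in the chart image is convex, so that a vanishing derivative makes the
      function constant on it.\<close>
    obtain r where r: "r > 0" "ball (\<phi> z) r \<subseteq> \<phi> ` U"
      using UD(2) U(2) by (metis imageI open_contains_ball)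
    define W where "W = U \<inter> \<phi> -` ball (\<phi> z) r"
    have "open W"
      unfolding W_def using UD by (intro continuous_open_preimage) (auto simp: homeomorphism_def)
    have "f z = f b" if "b \<in> W" for b
    proof -
      have "(f \<circ> inv_into U \<phi>) (\<phi> z) = (f \<circ> inv_into U \<phi>) (\<phi> b)"
      proof (rule has_derivative_zero_unique[where s = "ball (\<phi> z) r"])
        show "(f \<circ> inv_into U \<phi> has_derivative (\<lambda>h. 0)) (at w within ball (\<phi> z) r)"
          if "w \<in> ball (\<phi> z) r" for w
          by (rule has_derivative_at_withinI) (use der r(2) that in blast)
      qed (use r that in \<open>auto simp: W_def\<close>)
      then show ?thesis using UD(4) U that by (simp add: W_def)
    qed
    then show "\<forall>\<^sub>F b in at z within UNIV. f z = f b"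
      unfolding eventually_at_topological using \<open>open W\<close> U r
      by (intro exI[of _ W]) (auto simp: W_def)
  qed
qed auto

text \<open>
  A function whose left translate is not smooth is annihilated by all left-invariant fields
  (they send the translate to 0), hence is constant, and its translate is smooth after all.
\<close>

lemma translate_smooth:
  assumes f: "f \<in> SF"
  shows "(\<lambda>z. f (g \<otimes>\<^bsub>G\<^esub> z)) \<in> SF"
proof (rule ccontr)
  assume n: "(\<lambda>z. f (g \<otimes>\<^bsub>G\<^esub> z)) \<notin> SF"
  have "X v f y = 0" for v y
    using X_translate[of v f y g] vf_nonsmooth[OF X_VF n] by simp
  then have "\<And>x y. f x = f y" using constant_if_frame_zero[OF f] by blast
  then have "(\<lambda>z. f (g \<otimes>\<^bsub>G\<^esub> z)) = (\<lambda>z. f g)" by blast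
  then show False using n by simp
qed

text \<open>Push-forward only translates the frame coordinates, and these stay smooth by
  \<open>translate_smooth\<close>.\<close>

lemma push_left_VF:
  assumes Y: "Y \<in> VF"
  shows "push_left G g Y \<in> VF" and "coord (push_left G g Y) x = coord Y (inv\<^bsub>G\<^esub> g \<otimes>\<^bsub>G\<^esub> x)"
proof -
  have *: "push_left G g Y f x = X (coord Y (inv\<^bsub>G\<^esub> g \<otimes>\<^bsub>G\<^esub> x)) f x" for f x
    using coord[OF Y, of "\<lambda>y. f (g \<otimes>\<^bsub>G\<^esub> y)" "inv\<^bsub>G\<^esub> g \<otimes>\<^bsub>G\<^esub> x"]
    unfolding push_left_def
    by (rule trans[OF _ X_translate[of _ f x g, symmetric]])
  have "push_left G g Y = (\<Sum>e\<in>Basis. vf_smult (\<lambda>x. coord Y (inv\<^bsub>G\<^esub> g \<otimes>\<^bsub>G\<^esub> x) \<bullet> e) (X e))"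
  proof (intro ext)
    fix f x
    show "push_left G g Y f x =
        (\<Sum>e\<in>Basis. vf_smult (\<lambda>x. coord Y (inv\<^bsub>G\<^esub> g \<otimes>\<^bsub>G\<^esub> x) \<bullet> e) (X e)) f x"
      unfolding * sum_apply_fun times_fun_apply by (rule X_app_expand)
  qed
  also have "\<dots> \<in> VF"
    by (intro VF_sum VF_smult translate_smooth[OF coord_smooth[OF Y]] X_VF)
  finally show "push_left G g Y \<in> VF" .
  then show "coord (push_left G g Y) x = coord Y (inv\<^bsub>G\<^esub> g \<otimes>\<^bsub>G\<^esub> x)"
    by (rule coord_eqI) (rule *)
qed

end

text \<open>
  Rules of function type are instantiated in eta-expanded form by simplification, so that these
  rules would also rewrite sums of functions that are not applied to an argument.
\<close>

lemmas pointwise = plus_fun_apply times_fun_apply zero_fun_apply minus_apply uminus_apply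

declare pointwise [simp del]

section \<open>The Lie algebra of vector fields\<close>

context positively_graded_group
begin

lemma VF_expand:
  assumes "Y \<in> VF"
  shows "Y = (\<Sum>e\<in>Basis. vf_smult (\<lambda>x. coord Y x \<bullet> e) (X e))"
proof (intro ext)
  fix f x
  show "Y f x = (\<Sum>e\<in>Basis. vf_smult (\<lambda>x. coord Y x \<bullet> e) (X e)) f x"
    unfolding sum_apply_fun times_fun_apply coord[OF assms, of f x] by (rule X_app_expand)
qed

text \<open>Reduces statements about a field to multiples of single frame fields by smooth
  functions; the coefficients are the coordinates, smooth by \<open>coord_smooth\<close>.\<close>

lemma VF_induct [consumes 1, case_names zero add frame]:
  assumes "Y \<in> VF" "P 0" "\<And>Y Z. Y \<in> VF \<Longrightarrow> Z \<in> VF \<Longrightarrow> P Y \<Longrightarrow> P Z \<Longrightarrow> P (Y + Z)"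
    and "\<And>h e. h \<in> SF \<Longrightarrow> e \<in> Basis \<Longrightarrow> P (vf_smult h (X e))"
  shows "P Y"
proof -
  have "P (\<Sum>e\<in>I. vf_smult (\<lambda>x. coord Y x \<bullet> e) (X e)) \<and>
      (\<Sum>e\<in>I. vf_smult (\<lambda>x. coord Y x \<bullet> e) (X e)) \<in> VF"
    if "finite I" "I \<subseteq> Basis" for I
    using that by (induction I rule: finite_induct) (auto intro!: assms coord_smooth)
  from this[of Basis] show ?thesis using VF_expand[OF assms(1)] by simp
qed

abbreviation (input) br :: "'g vfield \<Rightarrow> 'g vfield \<Rightarrow> 'g vfield"
  where "br \<equiv> vf_bracket"

lemma br_swap: "br Y Z = - br Z Y"
  by (auto simp: vf_bracket_def fun_eq_iff pointwise)

lemma br_self: "br Y Y = 0"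
  by (auto simp: vf_bracket_def fun_eq_iff pointwise)

lemma br_zero: "Y \<in> VF \<Longrightarrow> br Y 0 = 0"
  by (simp add: vf_bracket_def VF_app_zero fun_eq_iff pointwise)

lemma br_add:
  assumes "Y \<in> VF" "Z \<in> VF" "W \<in> VF"
  shows "br Y (Z + W) = br Y Z + br Y W"
proof
  fix f
  show "br Y (Z + W) f = (br Y Z + br Y W) f"
    using assms by (simp add: vf_bracket_def pointwise VF_app_add[OF assms(1)])
qed

lemma br_smult:
  assumes "Y \<in> VF" "Z \<in> VF" "h \<in> SF"
  shows "br Y (vf_smult h Z) = vf_smult h (br Y Z) + vf_smult (Y h) Z"
proof
  fix f
  show "br Y (vf_smult h Z) f = (vf_smult h (br Y Z) + vf_smult (Y h) Z) f"
    using assms by (simp add: vf_bracket_def pointwise VF_app_mult[OF assms(1)] algebra_simps)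
qed

lemma VF_uminus [simp, intro]: "Y \<in> VF \<Longrightarrow> - Y \<in> VF"
proof -
  assume "Y \<in> VF"
  then have "vf_smult (\<lambda>x. - 1) Y \<in> VF" by simp
  moreover have "vf_smult (\<lambda>x. - 1) Y = - Y" by (auto simp: fun_eq_iff pointwise)
  ultimately show ?thesis by simp
qed

lemma VF_diff [simp, intro]: "Y \<in> VF \<Longrightarrow> Z \<in> VF \<Longrightarrow> Y - Z \<in> VF"
  using VF_add[OF _ VF_uminus, of Y Z] by simp

text \<open>\<open>layers_bracket\<close> settles arguments taken from layers. As the layers span,
  the second argument is extended linearly, then antisymmetry exchanges the arguments and the other
  one is extended in the same way.\<close>

lemma br_X_VF: "br (X u) (X v) \<in> VF"
proof -
  have hom: "br (X u) (X v) \<in> VF" if "u \<in> V w" "v \<in> V w'" for u v w w'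
    using layers_bracket[OF that] by auto
  have extend: "br Y (X v) \<in> VF" if "Y \<in> VF" "\<And>w v. v \<in> V w \<Longrightarrow> br Y (X v) \<in> VF" for Y v
  proof -
    have "subspace {v. br Y (X v) \<in> VF}"
      using that(1) by (auto simp: subspace_def br_zero X_add X_scale br_add br_smult)
    then have "span (\<Union>w. V w) \<subseteq> {v. br Y (X v) \<in> VF}"
      using that(2) by (intro span_minimal) auto
    then show ?thesis by (auto simp: layers_span)
  qed
  have "br (X u) (X v) \<in> VF" if "u \<in> V w" for u v w
    by (rule extend[OF X_VF hom[OF that]])
  then have "br (X v) (X u) \<in> VF" if "u \<in> V w" for u v w
    using that VF_uminus by (metis br_swap)
  then show ?thesis by (rule extend[OF X_VF])
qed

lemma br_VF [simp, intro]:
  assumes "Y \<in> VF" "Z \<in> VF"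
  shows "br Y Z \<in> VF"
proof -
  have *: "br (X u) Z \<in> VF" if "Z \<in> VF" for u Z
    using that by (induction Z rule: VF_induct)
      (auto simp: br_zero br_add br_smult intro: br_X_VF)
  have "br Z Y \<in> VF"
    using assms(1)
  proof (induction Y rule: VF_induct)
    case (frame h e)
    have "br Z (X e) \<in> VF" using *[OF assms(2), of e] br_swap[of Z "X e"] by auto
    then show ?case using assms(2) frame by (simp add: br_smult)
  qed (use assms(2) in \<open>auto simp: br_zero br_add\<close>)
  then show ?thesis using br_swap[of Y Z] by auto
qed

lemma br_jacobi:
  assumes "Y \<in> VF" "Z \<in> VF" "W \<in> VF"
  shows "br (br Y Z) W = br Y (br Z W) - br Z (br Y W)"
proof
  fix f
  show "br (br Y Z) W f = (br Y (br Z W) - br Z (br Y W)) f"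
    using assms by (simp add: vf_bracket_def pointwise VF_app_diff[OF assms(1)] VF_app_diff[OF assms(2)]
        VF_app_diff[OF assms(3)] algebra_simps)
qed

section \<open>Cartan calculus\<close>

text \<open>
  All identities below are required on lists of vector fields only; \<open>lie\<close> and \<open>dform\<close> are the Lie
  derivative and the exterior derivative, defined by recursion on the arguments through Cartan's
  formulas \<open>[L\<^sub>Y, \<iota>\<^sub>Z] = \<iota>\<^bsub>[Y,Z]\<^esub>\<close> and \<open>\<iota>\<^sub>Y d = L\<^sub>Y - d \<iota>\<^sub>Y\<close>.
\<close>

abbreviation (input) VFs :: "'g vfield list \<Rightarrow> bool"
  where "VFs Ys \<equiv> set Ys \<subseteq> VF"

text \<open>Values outside lists of vector fields are unconstrained, so that \<open>iota\<close>,
  \<open>lie\<close> and \<open>dform\<close> stay in this class. The shape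
  \<open>as @ Y # bs\<close> suits recursion on the first argument, and vanishing on adjacent equal
  arguments gives the general case by transpositions (\<open>af_alternating\<close>).\<close>

definition alt_form :: "'g form \<Rightarrow> bool"
  where "alt_form \<omega> \<longleftrightarrow>
    (\<forall>Ys. VFs Ys \<longrightarrow> \<omega> Ys \<in> SF) \<and>
    (\<forall>as bs. \<forall>Y\<in>VF. \<forall>Z\<in>VF. VFs as \<longrightarrow> VFs bs \<longrightarrow>
       \<omega> (as @ (Y + Z) # bs) = \<omega> (as @ Y # bs) + \<omega> (as @ Z # bs)) \<and>
    (\<forall>as bs. \<forall>Y\<in>VF. \<forall>h\<in>SF. VFs as \<longrightarrow> VFs bs \<longrightarrow>
       \<omega> (as @ vf_smult h Y # bs) = h * \<omega> (as @ Y # bs)) \<and>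
    (\<forall>as bs. \<forall>Y\<in>VF. VFs as \<longrightarrow> VFs bs \<longrightarrow> \<omega> (as @ Y # Y # bs) = 0)"

lemma alt_formI:
  assumes "\<And>Ys. VFs Ys \<Longrightarrow> \<omega> Ys \<in> SF"
    and "\<And>as bs Y Z. Y \<in> VF \<Longrightarrow> Z \<in> VF \<Longrightarrow> VFs as \<Longrightarrow> VFs bs \<Longrightarrow>
       \<omega> (as @ (Y + Z) # bs) = \<omega> (as @ Y # bs) + \<omega> (as @ Z # bs)"
    and "\<And>as bs Y h. Y \<in> VF \<Longrightarrow> h \<in> SF \<Longrightarrow> VFs as \<Longrightarrow> VFs bs \<Longrightarrow>
       \<omega> (as @ vf_smult h Y # bs) = h * \<omega> (as @ Y # bs)"
    and "\<And>as bs Y. Y \<in> VF \<Longrightarrow> VFs as \<Longrightarrow> VFs bs \<Longrightarrow> \<omega> (as @ Y # Y # bs) = 0"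
  shows "alt_form \<omega>"
  using assms by (simp add: alt_form_def)

lemma alt_formD:
  assumes "alt_form \<omega>"
  shows af_smooth: "VFs Ys \<Longrightarrow> \<omega> Ys \<in> SF"
    and af_add: "Y \<in> VF \<Longrightarrow> Z \<in> VF \<Longrightarrow> VFs as \<Longrightarrow> VFs bs \<Longrightarrow>
       \<omega> (as @ (Y + Z) # bs) = \<omega> (as @ Y # bs) + \<omega> (as @ Z # bs)"
    and af_smult: "Y \<in> VF \<Longrightarrow> h \<in> SF \<Longrightarrow> VFs as \<Longrightarrow> VFs bs \<Longrightarrow>
       \<omega> (as @ vf_smult h Y # bs) = h * \<omega> (as @ Y # bs)"
    and af_adj: "Y \<in> VF \<Longrightarrow> VFs as \<Longrightarrow> VFs bs \<Longrightarrow> \<omega> (as @ Y # Y # bs) = 0"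
  using assms by (simp_all add: alt_form_def)

lemma af_zero:
  assumes "alt_form \<omega>" "VFs as" "VFs bs"
  shows "\<omega> (as @ 0 # bs) = 0"
proof -
  have "\<omega> (as @ 0 # bs) + \<omega> (as @ 0 # bs) = \<omega> (as @ 0 # bs)"
    using af_add[OF assms(1) VF_zero VF_zero assms(2,3)] by simp
  then show ?thesis by simp
qed

lemma af_uminus:
  assumes "alt_form \<omega>" "Y \<in> VF" "VFs as" "VFs bs"
  shows "\<omega> (as @ (- Y) # bs) = - \<omega> (as @ Y # bs)"
  using af_add[OF assms(1,2) VF_uminus[OF assms(2)] assms(3,4)] af_zero[OF assms(1,3,4)]
  by (simp add: eq_neg_iff_add_eq_0 add.commute)

lemma af_diff:
  assumes "alt_form \<omega>" "Y \<in> VF" "Z \<in> VF" "VFs as" "VFs bs"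
  shows "\<omega> (as @ (Y - Z) # bs) = \<omega> (as @ Y # bs) - \<omega> (as @ Z # bs)"
  using af_add[OF assms(1,2) VF_uminus[OF assms(3)] assms(4,5)] af_uminus[OF assms(1,3,4,5)]
  by simp

lemma af_swap:
  assumes "alt_form \<omega>" "Y \<in> VF" "Z \<in> VF" "VFs as" "VFs bs"
  shows "\<omega> (as @ Y # Z # bs) = - \<omega> (as @ Z # Y # bs)"
proof -
  have 1: "\<omega> (as @ (Y + Z) # (Y + Z) # bs) = 0"
    using assms by (intro af_adj VF_add)
  have 2: "\<omega> (as @ (Y + Z) # (Y + Z) # bs) =
      \<omega> (as @ Y # (Y + Z) # bs) + \<omega> (as @ Z # (Y + Z) # bs)"
    using assms by (intro af_add VF_add) (auto)
  have 3: "\<omega> (as @ P # (Y + Z) # bs) = \<omega> (as @ P # Y # bs) + \<omega> (as @ P # Z # bs)"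
    if "P \<in> VF" for P
    using af_add[OF assms(1,2,3), of "as @ [P]" bs] assms that by simp
  have 4: "\<omega> (as @ P # P # bs) = 0" if "P \<in> VF" for P
    using af_adj[OF assms(1) that assms(4,5)] .
  show ?thesis
    using 1 2 3[of Y] 3[of Z] 4[of Y] 4[of Z] assms(2,3) by (simp add: eq_neg_iff_add_eq_0)
qed

text \<open>Transpositions of neighbours bring the two equal arguments together, at the cost of
  signs.\<close>

lemma af_alternating:
  assumes "alt_form \<omega>" "Y \<in> VF" "VFs as" "VFs bs" "VFs cs"
  shows "\<omega> (as @ Y # bs @ Y # cs) = 0"
  using assms(3,4)
proof (induction bs arbitrary: as)
  case Nil
  then show ?case using af_adj[OF assms(1,2) _ assms(5)] by simp
next
  case (Cons Z bs)
  have "\<omega> (as @ Y # Z # bs @ Y # cs) = - \<omega> (as @ Z # Y # bs @ Y # cs)"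
    using Cons.prems assms by (intro af_swap) auto
  also have "\<dots> = 0" using Cons.IH[of "as @ [Z]"] Cons.prems by simp
  finally show ?case by simp
qed

lemma forms_iff: "\<omega> \<in> forms A \<longleftrightarrow> alt_form \<omega> \<and> (\<forall>Ys. \<not> VFs Ys \<longrightarrow> \<omega> Ys = 0)"
proof
  assume w: "\<omega> \<in> forms A"
  have upd: "(as @ Y # bs)[length as := Z] = as @ Z # bs" for as bs and Y Z :: "'g vfield"
    by simp
  have s: "\<And>Ys. VFs Ys \<Longrightarrow> \<omega> Ys \<in> SF"
    and a: "\<And>Ys i Y Z. VFs Ys \<Longrightarrow> i < length Ys \<Longrightarrow> Y \<in> VF \<Longrightarrow> Z \<in> VF \<Longrightarrow>
       \<omega> (Ys[i := Y + Z]) = \<omega> (Ys[i := Y]) + \<omega> (Ys[i := Z])"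
    and m: "\<And>Ys i Y h. VFs Ys \<Longrightarrow> i < length Ys \<Longrightarrow> Y \<in> VF \<Longrightarrow> h \<in> SF \<Longrightarrow>
       \<omega> (Ys[i := vf_smult h Y]) = h * \<omega> (Ys[i := Y])"
    and t: "\<And>Ys i j. VFs Ys \<Longrightarrow> i < j \<Longrightarrow> j < length Ys \<Longrightarrow> Ys ! i = Ys ! j \<Longrightarrow> \<omega> Ys = 0"
    using w by (simp_all add: forms_def)
  have "alt_form \<omega>"
  proof (rule alt_formI)
    fix as bs Y Z assume "Y \<in> VF" "Z \<in> VF" "VFs as" "VFs bs"
    then show "\<omega> (as @ (Y + Z) # bs) = \<omega> (as @ Y # bs) + \<omega> (as @ Z # bs)"
      using a[of "as @ Y # bs" "length as" Y Z] by simp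
  next
    fix as bs Y h assume "Y \<in> VF" "h \<in> SF" "VFs as" "VFs bs"
    then show "\<omega> (as @ vf_smult h Y # bs) = h * \<omega> (as @ Y # bs)"
      using m[of "as @ Y # bs" "length as" Y h] by simp
  next
    fix as bs Y assume "Y \<in> VF" "VFs as" "VFs bs"
    then show "\<omega> (as @ Y # Y # bs) = 0"
      using t[of "as @ Y # Y # bs" "length as" "Suc (length as)"] by (simp add: nth_append)
  qed (rule s)
  then show "alt_form \<omega> \<and> (\<forall>Ys. \<not> VFs Ys \<longrightarrow> \<omega> Ys = 0)"
    using w by (simp add: forms_def)
next
  assume w: "alt_form \<omega> \<and> (\<forall>Ys. \<not> VFs Ys \<longrightarrow> \<omega> Ys = 0)"
  then have af: "alt_form \<omega>" by blast
  have td: "VFs (take i Ys)" "VFs (drop i Ys)" if "VFs Ys" for Ys i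
    using that set_take_subset[of i Ys] set_drop_subset[of i Ys] by auto
  show "\<omega> \<in> forms A"
    unfolding forms_def
  proof (intro CollectI conjI allI impI ballI)
    fix Ys :: "'g vfield list" and i Y Z assume *: "Y \<in> VF" "Z \<in> VF" "VFs Ys" "i < length Ys"
    then show "\<omega> (Ys[i := Y + Z]) = \<omega> (Ys[i := Y]) + \<omega> (Ys[i := Z])"
      using af_add[OF af *(1,2) td(1)[OF *(3)] td(2)[OF *(3)]] by (simp add: upd_conv_take_nth_drop)
  next
    fix Ys :: "'g vfield list" and i Y h assume *: "Y \<in> VF" "h \<in> SF" "VFs Ys" "i < length Ys"
    then show "\<omega> (Ys[i := vf_smult h Y]) = h * \<omega> (Ys[i := Y])"
      using af_smult[OF af *(1,2) td(1)[OF *(3)] td(2)[OF *(3)]] by (simp add: upd_conv_take_nth_drop)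
  next
    fix Ys :: "'g vfield list" and i j
    assume *: "VFs Ys" "i < j" "j < length Ys" "Ys ! i = Ys ! j"
    define as bs cs where "as = take i Ys" and "bs = drop (Suc i) (take j Ys)" and "cs = drop (Suc j) Ys"
    have "Ys = take j Ys @ Ys ! j # cs"
      unfolding cs_def by (rule id_take_nth_drop[OF *(3)])
    also have "take j Ys = as @ Ys ! i # bs"
      using id_take_nth_drop[of i "take j Ys"] *(2,3) by (simp add: as_def bs_def min_def)
    finally have Ys: "Ys = as @ Ys ! j # bs @ Ys ! j # cs"
      using *(4) by simp
    have "VFs as" "VFs bs" "VFs cs" "Ys ! j \<in> VF"
      using *(1,3) td by (auto simp: as_def bs_def cs_def)
    then have "\<omega> (as @ Ys ! j # bs @ Ys ! j # cs) = 0"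
      by (intro af_alternating[OF af])
    then show "\<omega> Ys = 0" using Ys by simp
  qed (use w af_smooth[OF af] in blast)+
qed

section \<open>Contraction, Lie derivative and exterior derivative\<close>

definition iota :: "'g vfield \<Rightarrow> 'g form \<Rightarrow> 'g form"
  where "iota Y \<omega> = (\<lambda>Ys. \<omega> (Y # Ys))"

lemma iota_app: "iota Y \<omega> Ys = \<omega> (Y # Ys)"
  by (simp add: iota_def)

text \<open>The recursion runs over the remaining arguments while the form changes by contraction;
  hence the list comes first, and \<open>lie\<close> and \<open>dform\<close> restore the usual
  order.\<close>

primrec lie_list :: "'g vfield list \<Rightarrow> 'g vfield \<Rightarrow> 'g form \<Rightarrow> 'g \<Rightarrow> real"
  where
    "lie_list [] Y \<omega> = Y (\<omega> [])"
  | "lie_list (Z # Zs) Y \<omega> = lie_list Zs Y (iota Z \<omega>) - \<omega> (br Y Z # Zs)"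

primrec d_list :: "'g vfield list \<Rightarrow> 'g form \<Rightarrow> 'g \<Rightarrow> real"
  where
    "d_list [] \<omega> = 0"
  | "d_list (Y # Ys) \<omega> = lie_list Ys Y \<omega> - d_list Ys (iota Y \<omega>)"

definition lie :: "'g vfield \<Rightarrow> 'g form \<Rightarrow> 'g form"
  where "lie Y \<omega> = (\<lambda>Zs. lie_list Zs Y \<omega>)"

definition dform :: "'g form \<Rightarrow> 'g form"
  where "dform \<omega> = (\<lambda>Zs. d_list Zs \<omega>)"

lemma lie_simps: "lie Y \<omega> [] = Y (\<omega> [])"
    "lie Y \<omega> (Z # Zs) = lie Y (iota Z \<omega>) Zs - \<omega> (br Y Z # Zs)"
  and dform_simps: "dform \<omega> [] = 0" "dform \<omega> (Z # Zs) = lie Z \<omega> Zs - dform (iota Z \<omega>) Zs"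
  by (simp_all add: lie_def dform_def)

lemma iota_lie: "iota Z (lie Y \<omega>) = lie Y (iota Z \<omega>) - iota (br Y Z) \<omega>"
  and iota_dform: "iota Z (dform \<omega>) = lie Z \<omega> - dform (iota Z \<omega>)"
  by (auto simp: fun_eq_iff lie_simps dform_simps pointwise iota_app)

lemma fun_mult_form_app: "fun_mult_form h \<omega> Ys = h * \<omega> Ys"
  by (simp add: fun_mult_form_def)

lemma iota_add: "iota Y (\<omega> + \<eta>) = iota Y \<omega> + iota Y \<eta>"
  and iota_uminus: "iota Y (- \<omega>) = - iota Y \<omega>"
  and iota_zero: "iota Y 0 = 0"
  and iota_smult: "iota Y (fun_mult_form h \<omega>) = fun_mult_form h (iota Y \<omega>)"
  by (auto simp: fun_eq_iff fun_mult_form_def pointwise iota_app)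

lemma af_iota [simp, intro]:
  assumes "alt_form \<omega>" "Y \<in> VF"
  shows "alt_form (iota Y \<omega>)"
proof (rule alt_formI)
  fix as bs P Q assume *: "P \<in> VF" "Q \<in> VF" "VFs as" "VFs bs"
  show "iota Y \<omega> (as @ (P + Q) # bs) = iota Y \<omega> (as @ P # bs) + iota Y \<omega> (as @ Q # bs)"
    using af_add[OF assms(1) *(1,2), of "Y # as" bs] * assms(2) by (simp add: iota_app)
next
  fix as bs P h assume *: "P \<in> VF" "h \<in> SF" "VFs as" "VFs bs"
  show "iota Y \<omega> (as @ vf_smult h P # bs) = h * iota Y \<omega> (as @ P # bs)"
    using af_smult[OF assms(1) *(1,2), of "Y # as" bs] * assms(2) by (simp add: iota_app)
next
  fix as bs P assume *: "P \<in> VF" "VFs as" "VFs bs"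
  show "iota Y \<omega> (as @ P # P # bs) = 0"
    using af_adj[OF assms(1) *(1), of "Y # as" bs] * assms(2) by (simp add: iota_app)
qed (use assms af_smooth[OF assms(1)] in \<open>auto simp: iota_app\<close>)

lemma af_plus [simp, intro]: "alt_form \<omega> \<Longrightarrow> alt_form \<eta> \<Longrightarrow> alt_form (\<omega> + \<eta>)"
  by (rule alt_formI) (auto simp: alt_formD pointwise algebra_simps)

lemma af_fun_mult [simp, intro]: "alt_form \<omega> \<Longrightarrow> h \<in> SF \<Longrightarrow> alt_form (fun_mult_form h \<omega>)"
  by (rule alt_formI) (auto simp: alt_formD fun_mult_form_app algebra_simps)

lemma af_neg [simp, intro]: "alt_form \<omega> \<Longrightarrow> alt_form (- \<omega>)"
  by (rule alt_formI) (auto simp: alt_formD pointwise algebra_simps)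

lemma af_minus [simp, intro]: "alt_form \<omega> \<Longrightarrow> alt_form \<eta> \<Longrightarrow> alt_form (\<omega> - \<eta>)"
  using af_plus[OF _ af_neg, of \<omega> \<eta>] by simp

lemma af_null [simp, intro]: "alt_form 0"
  by (rule alt_formI) (auto simp: zero_fun_apply)

text \<open>Equations such as
  \<open>iota (P + Q) \<omega> = iota P \<omega> + iota Q \<omega>\<close> are known on lists of
  vector fields only; this allows them to be used under \<open>lie\<close>.\<close>

lemma lie_cong:
  assumes "\<And>Zs. VFs Zs \<Longrightarrow> \<omega> Zs = \<eta> Zs" "Y \<in> VF" "VFs Zs"
  shows "lie Y \<omega> Zs = lie Y \<eta> Zs"
  using assms
proof (induction Zs arbitrary: \<omega> \<eta>)
  case (Cons Z Zs)
  have "lie Y (iota Z \<omega>) Zs = lie Y (iota Z \<eta>) Zs"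
    using Cons.prems by (intro Cons.IH) (auto simp: iota_app)
  then show ?case using Cons.prems by (simp add: lie_simps)
qed (simp add: lie_simps)

lemma dform_cong:
  assumes "\<And>Zs. VFs Zs \<Longrightarrow> \<omega> Zs = \<eta> Zs" "VFs Zs"
  shows "dform \<omega> Zs = dform \<eta> Zs"
  using assms
proof (induction Zs arbitrary: \<omega> \<eta>)
  case (Cons Z Zs)
  have "dform (iota Z \<omega>) Zs = dform (iota Z \<eta>) Zs"
    using Cons.prems by (intro Cons.IH) (auto simp: iota_app)
  moreover have "lie Z \<omega> Zs = lie Z \<eta> Zs"
    using Cons.prems by (intro lie_cong) auto
  ultimately show ?case by (simp add: dform_simps)
qed (simp add: dform_simps)

lemma lie_add:
  assumes "alt_form \<omega>" "alt_form \<eta>" "Y \<in> VF" "VFs Zs"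
  shows "lie Y (\<omega> + \<eta>) Zs = lie Y \<omega> Zs + lie Y \<eta> Zs"
  using assms
  by (induction Zs arbitrary: \<omega> \<eta>) (auto simp: lie_simps iota_add VF_app_add alt_formD pointwise)

lemma lie_fun_mult:
  assumes "alt_form \<omega>" "h \<in> SF" "Y \<in> VF" "VFs Zs"
  shows "lie Y (fun_mult_form h \<omega>) Zs = h * lie Y \<omega> Zs + Y h * \<omega> Zs"
  using assms
proof (induction Zs arbitrary: \<omega>)
  case (Cons Z Zs)
  then have IH: "lie Y (fun_mult_form h (iota Z \<omega>)) Zs = h * lie Y (iota Z \<omega>) Zs + Y h * iota Z \<omega> Zs"
    by (intro Cons.IH) auto
  have "lie Y (fun_mult_form h \<omega>) (Z # Zs) =
      lie Y (fun_mult_form h (iota Z \<omega>)) Zs - fun_mult_form h \<omega> (br Y Z # Zs)"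
    by (simp only: lie_simps iota_smult)
  also have "\<dots> = h * lie Y (iota Z \<omega>) Zs + Y h * \<omega> (Z # Zs) - h * \<omega> (br Y Z # Zs)"
    unfolding IH iota_app fun_mult_form_app ..
  also have "\<dots> = h * lie Y \<omega> (Z # Zs) + Y h * \<omega> (Z # Zs)"
    unfolding lie_simps by (simp add: algebra_simps)
  finally show ?case .
qed (simp add: lie_simps fun_mult_form_def VF_app_mult alt_formD)

lemma lie_null: "Y \<in> VF \<Longrightarrow> lie Y 0 Zs = 0"
proof (induction Zs)
  case Nil
  then show ?case by (subst lie_simps, subst zero_fun_apply) (rule VF_app_zero)
next
  case (Cons Z Zs)
  have "lie Y 0 (Z # Zs) = lie Y 0 Zs - (0 :: 'g form) (br Y Z # Zs)"
    by (simp only: lie_simps iota_zero)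
  also have "\<dots> = 0" by (subst zero_fun_apply) (simp add: Cons)
  finally show ?case .
qed

lemma lie_uminus:
  assumes "alt_form \<omega>" "Y \<in> VF" "VFs Zs"
  shows "lie Y (- \<omega>) Zs = - lie Y \<omega> Zs"
  using lie_add[OF assms(1) af_neg[OF assms(1)] assms(2,3)] lie_null[OF assms(2)]
  by (simp add: eq_neg_iff_add_eq_0 add.commute)

lemma lie_diff:
  assumes "alt_form \<omega>" "alt_form \<eta>" "Y \<in> VF" "VFs Zs"
  shows "lie Y (\<omega> - \<eta>) Zs = lie Y \<omega> Zs - lie Y \<eta> Zs"
  using lie_add[OF assms(1) af_neg[OF assms(2)] assms(3,4)] lie_uminus[OF assms(2-4)] by simp

lemma lie_smooth:
  assumes "alt_form \<omega>" "Y \<in> VF" "VFs Zs"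
  shows "lie Y \<omega> Zs \<in> SF"
  using assms by (induction Zs arbitrary: \<omega>) (auto simp: lie_simps alt_formD)

text \<open>In the first slot the derivative of the coefficient that \<open>lie_fun_mult\<close>
  produces cancels against the one from the Leibniz rule of the bracket. Later slots follow by
  contraction.\<close>

lemma af_lie [simp, intro]:
  assumes "alt_form \<omega>" "Y \<in> VF"
  shows "alt_form (lie Y \<omega>)"
proof (rule alt_formI)
  fix as bs P Q assume *: "P \<in> VF" "Q \<in> VF" "VFs as" "VFs bs"
  show "lie Y \<omega> (as @ (P + Q) # bs) = lie Y \<omega> (as @ P # bs) + lie Y \<omega> (as @ Q # bs)"
    using assms(1) *(3)
  proof (induction as arbitrary: \<omega>)
    case Nil
    have "lie Y (iota (P + Q) \<omega>) bs = lie Y (iota P \<omega> + iota Q \<omega>) bs"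
      using Nil * assms(2) af_add[OF Nil(1) *(1,2), of "[]"] by (intro lie_cong) (auto simp: iota_app pointwise)
    also have "\<dots> = lie Y (iota P \<omega>) bs + lie Y (iota Q \<omega>) bs"
      using Nil * assms(2) by (intro lie_add) auto
    finally show ?case
      using af_add[OF Nil(1), of "br Y P" "br Y Q" "[]" bs] * assms(2)
      by (simp add: lie_simps br_add algebra_simps)
  next
    case (Cons Z as)
    then show ?case
      using Cons.IH[of "iota Z \<omega>"] af_add[OF Cons.prems(1) *(1,2), of "br Y Z # as" bs] * assms(2)
      by (simp add: lie_simps algebra_simps)
  qed
next
  fix as bs P h assume *: "P \<in> VF" "h \<in> SF" "VFs as" "VFs bs"
  show "lie Y \<omega> (as @ vf_smult h P # bs) = h * lie Y \<omega> (as @ P # bs)"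
    using assms(1) *(3)
  proof (induction as arbitrary: \<omega>)
    case Nil
    have "lie Y (iota (vf_smult h P) \<omega>) bs = lie Y (fun_mult_form h (iota P \<omega>)) bs"
      using Nil * assms(2) af_smult[OF Nil(1) *(1,2), of "[]"]
      by (intro lie_cong) (auto simp: fun_mult_form_app iota_app)
    also have "\<dots> = h * lie Y (iota P \<omega>) bs + Y h * iota P \<omega> bs"
      using Nil * assms(2) by (intro lie_fun_mult) auto
    finally have 1: "lie Y (iota (vf_smult h P) \<omega>) bs = h * lie Y (iota P \<omega>) bs + Y h * \<omega> (P # bs)"
      by (simp add: iota_app)
    have "\<omega> (br Y (vf_smult h P) # bs) =
        \<omega> (vf_smult h (br Y P) # bs) + \<omega> (vf_smult (Y h) P # bs)"
      using af_add[OF Nil(1), of "vf_smult h (br Y P)" "vf_smult (Y h) P" "[]" bs] * assms(2)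
      by (simp add: br_smult)
    also have "\<dots> = h * \<omega> (br Y P # bs) + Y h * \<omega> (P # bs)"
      using af_smult[OF Nil(1), of "br Y P" h "[]" bs] af_smult[OF Nil(1), of P "Y h" "[]" bs] * assms(2)
      by simp
    finally show ?case using 1 by (simp add: lie_simps algebra_simps)
  next
    case (Cons Z as)
    then show ?case
      using Cons.IH[of "iota Z \<omega>"] af_smult[OF Cons.prems(1) *(1,2), of "br Y Z # as" bs] * assms(2)
      by (simp add: lie_simps algebra_simps)
  qed
next
  fix as bs P assume *: "P \<in> VF" "VFs as" "VFs bs"
  show "lie Y \<omega> (as @ P # P # bs) = 0"
    using assms(1) *(2)
  proof (induction as arbitrary: \<omega>)
    case Nil
    have "lie Y (iota P (iota P \<omega>)) bs = lie Y 0 bs"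
      using Nil * assms(2) af_adj[OF Nil(1) *(1), of "[]"] by (intro lie_cong) (auto simp: iota_app pointwise)
    then show ?case
      using af_swap[OF Nil(1), of "br Y P" P "[]" bs] * assms(2)
      by (simp add: lie_simps lie_null iota_app)
  next
    case (Cons Z as)
    then show ?case
      using Cons.IH[of "iota Z \<omega>"] af_adj[OF Cons.prems(1) *(1), of "br Y Z # as" bs] * assms(2)
      by (simp add: lie_simps algebra_simps)
  qed
qed (rule lie_smooth[OF assms])

text \<open>After contraction with \<open>W\<close>, the mixed terms are symmetric in
  \<open>Y\<close> and \<open>Z\<close> and cancel in the difference; the remaining double brackets
  are matched by the Jacobi identity.\<close>

lemma lie_lie:
  assumes "alt_form \<omega>" "Y \<in> VF" "Z \<in> VF" "VFs Ws"
  shows "lie (br Y Z) \<omega> Ws = lie Y (lie Z \<omega>) Ws - lie Z (lie Y \<omega>) Ws"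
  using assms
proof (induction Ws arbitrary: \<omega>)
  case Nil
  then show ?case by (simp add: lie_simps vf_bracket_def)
next
  case (Cons W Ws)
  have W: "W \<in> VF" "VFs Ws" using Cons.prems by auto
  have PQ: "lie P (lie Q \<omega>) (W # Ws) = lie P (lie Q (iota W \<omega>)) Ws - lie P (iota (br Q W) \<omega>) Ws
      - lie Q (iota (br P W) \<omega>) Ws + \<omega> (br Q (br P W) # Ws)" if "P \<in> VF" "Q \<in> VF" for P Q
    using that Cons.prems by (simp add: lie_simps iota_lie lie_diff)
  have jac: "\<omega> (br (br Y Z) W # Ws) = \<omega> (br Y (br Z W) # Ws) - \<omega> (br Z (br Y W) # Ws)"
    using af_diff[OF Cons.prems(1), of "br Y (br Z W)" "br Z (br Y W)" "[]" Ws] Cons.prems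
    by (simp add: br_jacobi)
  have IH: "lie (br Y Z) (iota W \<omega>) Ws = lie Y (lie Z (iota W \<omega>)) Ws - lie Z (lie Y (iota W \<omega>)) Ws"
    using Cons.prems by (intro Cons.IH) auto
  show ?case
    unfolding lie_simps(2)[of "br Y Z"] PQ[OF Cons.prems(2,3)] PQ[OF Cons.prems(3,2)] jac IH
    by (simp add: algebra_simps)
qed

lemma dform_add:
  assumes "alt_form \<omega>" "alt_form \<eta>" "VFs Zs"
  shows "dform (\<omega> + \<eta>) Zs = dform \<omega> Zs + dform \<eta> Zs"
  using assms
  by (induction Zs arbitrary: \<omega> \<eta>) (auto simp: dform_simps iota_add lie_add)

lemma dform_null: "VFs Zs \<Longrightarrow> dform 0 Zs = 0"
  by (induction Zs) (simp_all add: dform_simps iota_zero lie_null)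

lemma dform_uminus:
  assumes "alt_form \<omega>" "VFs Zs"
  shows "dform (- \<omega>) Zs = - dform \<omega> Zs"
  using dform_add[OF assms(1) af_neg[OF assms(1)] assms(2)] dform_null[OF assms(2)]
  by (simp add: eq_neg_iff_add_eq_0 add.commute)

lemma dform_diff:
  assumes "alt_form \<omega>" "alt_form \<eta>" "VFs Zs"
  shows "dform (\<omega> - \<eta>) Zs = dform \<omega> Zs - dform \<eta> Zs"
  using dform_add[OF assms(1) af_neg[OF assms(2)] assms(3)] dform_uminus[OF assms(2,3)] by simp

text \<open>\<open>dh_wedge Zs h \<omega>\<close> is \<open>dh \<and> \<omega>\<close> evaluated on \<open>Zs\<close>.\<close>

primrec dh_wedge :: "'g vfield list \<Rightarrow> ('g \<Rightarrow> real) \<Rightarrow> 'g form \<Rightarrow> 'g \<Rightarrow> real"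
  where
    "dh_wedge [] h \<omega> = 0"
  | "dh_wedge (Z # Zs) h \<omega> = Z h * \<omega> Zs - dh_wedge Zs h (iota Z \<omega>)"

lemma dform_fun_mult:
  assumes "alt_form \<omega>" "h \<in> SF" "VFs Zs"
  shows "dform (fun_mult_form h \<omega>) Zs = h * dform \<omega> Zs + dh_wedge Zs h \<omega>"
  using assms
proof (induction Zs arbitrary: \<omega>)
  case (Cons Z Zs)
  then have "dform (fun_mult_form h (iota Z \<omega>)) Zs = h * dform (iota Z \<omega>) Zs + dh_wedge Zs h (iota Z \<omega>)"
    by (intro Cons.IH) auto
  then show ?case
    using Cons.prems
    by (simp add: dform_simps iota_smult lie_fun_mult algebra_simps)
qed (simp add: dform_simps)

lemma dh_wedge_cong:
  assumes "\<And>Zs. VFs Zs \<Longrightarrow> \<omega> Zs = \<eta> Zs" "VFs Zs"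
  shows "dh_wedge Zs h \<omega> = dh_wedge Zs h \<eta>"
  using assms
proof (induction Zs arbitrary: \<omega> \<eta>)
  case (Cons Z Zs)
  have "dh_wedge Zs h (iota Z \<omega>) = dh_wedge Zs h (iota Z \<eta>)"
    using Cons.prems by (intro Cons.IH) (auto simp: iota_app)
  then show ?case using Cons.prems by simp
qed simp

lemma dh_wedge_uminus: "dh_wedge Zs h (- \<omega>) = - dh_wedge Zs h \<omega>"
  by (induction Zs arbitrary: \<omega>) (simp_all add: iota_uminus uminus_apply)

lemma lie_smult_vf:
  assumes "alt_form \<omega>" "h \<in> SF" "Y \<in> VF" "VFs Zs"
  shows "lie (vf_smult h Y) \<omega> Zs = h * lie Y \<omega> Zs + dh_wedge Zs h (iota Y \<omega>)"
  using assms
proof (induction Zs arbitrary: \<omega>)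
  case (Cons Z Zs)
  have Z: "Z \<in> VF" "VFs Zs" using Cons.prems by auto
  have 1: "br (vf_smult h Y) Z = vf_smult h (br Y Z) - vf_smult (Z h) Y"
  proof -
    have "br Z Y = - br Y Z" by (rule br_swap)
    then show ?thesis
      using br_swap[of "vf_smult h Y" Z] Cons.prems by (auto simp: br_smult fun_eq_iff pointwise)
  qed
  have 2: "\<omega> (br (vf_smult h Y) Z # Zs) = h * \<omega> (br Y Z # Zs) - Z h * \<omega> (Y # Zs)"
    using af_diff[OF Cons.prems(1), of "vf_smult h (br Y Z)" "vf_smult (Z h) Y" "[]" Zs]
      af_smult[OF Cons.prems(1), of "br Y Z" h "[]" Zs] af_smult[OF Cons.prems(1), of Y "Z h" "[]" Zs]
      Cons.prems by (simp add: 1)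
  have "dh_wedge Zs h (iota Z (iota Y \<omega>)) = dh_wedge Zs h (- iota Y (iota Z \<omega>))"
    using af_swap[OF Cons.prems(1), of Y Z "[]"] Cons.prems by (intro dh_wedge_cong) (auto simp: iota_app pointwise)
  then have "dh_wedge (Z # Zs) h (iota Y \<omega>) = Z h * \<omega> (Y # Zs) + dh_wedge Zs h (iota Y (iota Z \<omega>))"
    by (simp add: dh_wedge_uminus iota_app)
  moreover have "lie (vf_smult h Y) (iota Z \<omega>) Zs = h * lie Y (iota Z \<omega>) Zs + dh_wedge Zs h (iota Y (iota Z \<omega>))"
    using Cons.prems by (intro Cons.IH) auto
  ultimately show ?case
    by (simp only: lie_simps 2 algebra_simps)
qed (simp add: lie_simps)

lemma lie_add_vf:
  assumes "alt_form \<omega>" "Y \<in> VF" "Z \<in> VF" "VFs Ws"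
  shows "lie (Y + Z) \<omega> Ws = lie Y \<omega> Ws + lie Z \<omega> Ws"
  using assms
proof (induction Ws arbitrary: \<omega>)
  case (Cons W Ws)
  have "br (Y + Z) W = br Y W + br Z W"
    using br_add[of W Y Z] br_swap[of _ W] Cons.prems by simp
  moreover have "lie (Y + Z) (iota W \<omega>) Ws = lie Y (iota W \<omega>) Ws + lie Z (iota W \<omega>) Ws"
    using Cons.prems by (intro Cons.IH) auto
  ultimately show ?case
    using af_add[OF Cons.prems(1), of "br Y W" "br Z W" "[]" Ws] Cons.prems
    by (simp add: lie_simps)
qed (simp add: lie_simps plus_fun_def)

lemma dform_smooth:
  assumes "alt_form \<omega>" "VFs Zs"
  shows "dform \<omega> Zs \<in> SF"
  using assms by (induction Zs arbitrary: \<omega>) (auto simp: dform_simps lie_smooth)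

text \<open>In the first slot the term dh \<and> iota_P \<omega> occurs twice, from
  \<open>lie_smult_vf\<close> and from \<open>dform_fun_mult\<close>, with opposite signs.\<close>

lemma af_dform [simp, intro]:
  assumes "alt_form \<omega>"
  shows "alt_form (dform \<omega>)"
proof (rule alt_formI)
  fix as bs P Q assume *: "P \<in> VF" "Q \<in> VF" "VFs as" "VFs bs"
  show "dform \<omega> (as @ (P + Q) # bs) = dform \<omega> (as @ P # bs) + dform \<omega> (as @ Q # bs)"
    using assms *(3)
  proof (induction as arbitrary: \<omega>)
    case Nil
    have "dform (iota (P + Q) \<omega>) bs = dform (iota P \<omega> + iota Q \<omega>) bs"
      using Nil * af_add[OF Nil(1) *(1,2), of "[]"] by (intro dform_cong) (auto simp: iota_app pointwise)
    then show ?case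
      using Nil * by (simp add: dform_simps lie_add_vf dform_add)
  next
    case (Cons Z as)
    then show ?case
      using Cons.IH[of "iota Z \<omega>"] af_add[OF af_lie[OF Cons.prems(1)] *(1,2), of Z as bs] *
      by (simp add: dform_simps algebra_simps)
  qed
next
  fix as bs P h assume *: "P \<in> VF" "h \<in> SF" "VFs as" "VFs bs"
  show "dform \<omega> (as @ vf_smult h P # bs) = h * dform \<omega> (as @ P # bs)"
    using assms *(3)
  proof (induction as arbitrary: \<omega>)
    case Nil
    have "dform (iota (vf_smult h P) \<omega>) bs = dform (fun_mult_form h (iota P \<omega>)) bs"
      using Nil * af_smult[OF Nil(1) *(1,2), of "[]"]
      by (intro dform_cong) (auto simp: fun_mult_form_app iota_app)
    then show ?case
      using Nil * by (simp add: dform_simps lie_smult_vf dform_fun_mult algebra_simps)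
  next
    case (Cons Z as)
    then show ?case
      using Cons.IH[of "iota Z \<omega>"] af_smult[OF af_lie[OF Cons.prems(1)] *(1,2), of Z as bs] *
      by (simp add: dform_simps algebra_simps)
  qed
next
  fix as bs P assume *: "P \<in> VF" "VFs as" "VFs bs"
  show "dform \<omega> (as @ P # P # bs) = 0"
    using assms *(2)
  proof (induction as arbitrary: \<omega>)
    case Nil
    have "dform (iota P (iota P \<omega>)) bs = dform 0 bs"
      using Nil * af_adj[OF Nil(1) *(1), of "[]"] by (intro dform_cong) (auto simp: iota_app pointwise)
    then show ?case
      using af_zero[OF Nil(1), of "[]" bs] * by (simp add: dform_simps lie_simps br_self dform_null)
  next
    case (Cons Z as)
    then show ?case
      using Cons.IH[of "iota Z \<omega>"] af_adj[OF af_lie[OF Cons.prems(1)] *(1), of Z as bs] *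
      by (simp add: dform_simps algebra_simps)
  qed
qed (rule dform_smooth[OF assms])

text \<open>Contracting both sides with the first argument leaves the same statement for the
  contracted form, up to the commutator rule \<open>lie_lie\<close>.\<close>

lemma lie_dform:
  assumes "alt_form \<omega>" "Y \<in> VF" "VFs Zs"
  shows "lie Y (dform \<omega>) Zs = dform (lie Y \<omega>) Zs"
  using assms
proof (induction Zs arbitrary: \<omega>)
  case (Cons Z Zs)
  then have "lie Y (dform (iota Z \<omega>)) Zs = dform (lie Y (iota Z \<omega>)) Zs"
    by (intro Cons.IH) auto
  then show ?case
    using Cons.prems
    by (simp add: lie_simps dform_simps iota_dform iota_lie lie_diff dform_diff lie_lie
       )
qed (simp add: lie_simps dform_simps VF_app_zero[of Y])

text \<open>Contracting d d \<omega> with \<open>Z\<close> gives L_Z d \<omega> - d L_Z \<omega> + d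
  d iota_Z \<omega>; the first two terms cancel by \<open>lie_dform\<close>.\<close>

lemma dform_dform:
  assumes "alt_form \<omega>" "VFs Zs"
  shows "dform (dform \<omega>) Zs = 0"
  using assms
proof (induction Zs arbitrary: \<omega>)
  case (Cons Z Zs)
  then have "dform (dform (iota Z \<omega>)) Zs = 0"
    by (intro Cons.IH) auto
  then show ?case
    using Cons.prems
    by (simp add: dform_simps iota_dform dform_diff lie_dform)
qed (simp add: dform_simps)

lemma lie_vanish:
  assumes "\<And>Zs. VFs Zs \<Longrightarrow> length Zs = n \<Longrightarrow> \<omega> Zs = 0" "Y \<in> VF" "VFs Zs" "length Zs = n"
  shows "lie Y \<omega> Zs = 0"
  using assms
proof (induction Zs arbitrary: \<omega> n)
  case (Cons Z Zs)
  have "lie Y (iota Z \<omega>) Zs = 0"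
    using Cons.prems by (intro Cons.IH[where n = "length Zs"]) (auto simp: iota_app)
  then show ?case using Cons.prems by (simp add: lie_simps)
qed (simp add: lie_simps VF_app_zero[of Y])

text \<open>The values of \<open>dform \<omega>\<close> on \<open>Suc n\<close> arguments only
  depend on those of \<omega> on \<open>n\<close> arguments; this is the source of the degree shift
  in \<open>d_kform\<close>.\<close>

lemma dform_vanish:
  assumes "\<And>Zs. VFs Zs \<Longrightarrow> length Zs = n \<Longrightarrow> \<omega> Zs = 0" "VFs Zs" "length Zs = Suc n"
  shows "dform \<omega> Zs = 0"
  using assms
proof (induction Zs arbitrary: \<omega> n)
  case (Cons Z Zs)
  have "lie Z \<omega> Zs = 0"
    using Cons.prems by (intro lie_vanish[where n = n]) auto
  moreover have "dform (iota Z \<omega>) Zs = 0"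
  proof (cases Zs)
    case (Cons W Ws)
    then show ?thesis
      using \<open>\<And>Zs. VFs Zs \<Longrightarrow> length Zs = n \<Longrightarrow> \<omega> Zs = 0\<close> \<open>VFs (Z # Zs)\<close> \<open>length (Z # Zs) = Suc n\<close>
      by (intro Cons.IH[where n = "length Ws"]) (auto simp: iota_app)
  qed (simp add: dform_simps)
  ultimately show ?case by (simp add: dform_simps)
qed simp

section \<open>Agreement with the Koszul formula\<close>

lemma nths_Cons_omit:
  "nths (Z # Zs) (- {0}) = Zs" "nths (Z # Zs) (- {Suc i}) = Z # nths Zs (- {i})"
  "nths (Z # Zs) (- {0, Suc j}) = nths Zs (- {j})"
  "nths (Z # Zs) (- {Suc i, Suc j}) = Z # nths Zs (- {i, j})"
proof -
  have "{k. Suc k \<in> - {0}} = UNIV" "{k. Suc k \<in> - {Suc i}} = - {i}"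
    "{k. Suc k \<in> - {0, Suc j}} = - {j}" "{k. Suc k \<in> - {Suc i, Suc j}} = - {i, j}"
    by auto
  then show "nths (Z # Zs) (- {0}) = Zs" "nths (Z # Zs) (- {Suc i}) = Z # nths Zs (- {i})"
    "nths (Z # Zs) (- {0, Suc j}) = nths Zs (- {j})"
    "nths (Z # Zs) (- {Suc i, Suc j}) = Z # nths Zs (- {i, j})"
    by (simp_all add: nths_Cons nths_all)
qed

lemma VFs_nths: "VFs Zs \<Longrightarrow> VFs (nths Zs I)"
  using set_nths_subset[of Zs I] by blast

text \<open>The recursion puts each bracket in the place of the argument it replaces; moving it to
  the front past \<open>j\<close> arguments gives the sign.\<close>

lemma lie_eq_sum:
  assumes "alt_form \<omega>" "Y \<in> VF" "VFs Zs"
  shows "lie Y \<omega> Zs x = Y (\<omega> Zs) x -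
    (\<Sum>j<length Zs. (-1) ^ j * \<omega> (br Y (Zs ! j) # nths Zs (- {j})) x)"
  using assms
proof (induction Zs arbitrary: \<omega>)
  case (Cons Z Zs)
  have sw: "\<omega> (br Y (Zs ! j) # Z # nths Zs (- {j})) x = - \<omega> (Z # br Y (Zs ! j) # nths Zs (- {j})) x"
    if "j < length Zs" for j
  proof -
    have "Zs ! j \<in> VF" using that Cons.prems by auto
    then show ?thesis
      using af_swap[OF Cons.prems(1), of "br Y (Zs ! j)" Z "[]" "nths Zs (- {j})"] Cons.prems VFs_nths
      by (simp add: pointwise)
  qed
  have "lie Y (iota Z \<omega>) Zs x = Y (iota Z \<omega> Zs) x -
      (\<Sum>j<length Zs. (-1) ^ j * iota Z \<omega> (br Y (Zs ! j) # nths Zs (- {j})) x)"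
    using Cons.prems by (intro Cons.IH) auto
  moreover have "lie Y \<omega> (Z # Zs) x = lie Y (iota Z \<omega>) Zs x - \<omega> (br Y Z # Zs) x"
    by (simp only: lie_simps minus_apply)
  ultimately have "lie Y \<omega> (Z # Zs) x = Y (\<omega> (Z # Zs)) x -
      (\<Sum>j<length Zs. (-1) ^ j * \<omega> (Z # br Y (Zs ! j) # nths Zs (- {j})) x) - \<omega> (br Y Z # Zs) x"
    by (simp add: iota_app)
  then show ?case
    by (simp add: sum.lessThan_Suc_shift nths_Cons_omit sw sum_negf del: sum.lessThan_Suc)
qed (simp add: lie_simps)

lemma ext_d_eq_dform:
  assumes "alt_form \<omega>"
  shows "ext_d A \<omega> = (\<lambda>Ys. if VFs Ys then dform \<omega> Ys else 0)"
proof (intro ext)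
  fix Ys x
  have "(\<Sum>i<length Ys. (-1) ^ i * (Ys ! i) (\<omega> (nths Ys (- {i}))) x)
       + (\<Sum>j<length Ys. \<Sum>i<j.
            (-1) ^ (i + j) * \<omega> (br (Ys ! i) (Ys ! j) # nths Ys (- {i, j})) x) = dform \<omega> Ys x"
    if "VFs Ys"
    using assms that
  proof (induction Ys arbitrary: \<omega>)
    case (Cons Y Ys)
    \<comment> \<open>The terms of the formula that involve the index 0 make up
      \<open>lie Y \<omega> Ys\<close>. In the rest of the double sum both indices shift, so the
      power of -1 is unchanged, and moving the bracket past \<open>Y\<close> gives the minus sign of
      the recursion.\<close>
    have sw: "\<omega> (br (Ys ! i) (Ys ! j) # Y # nths Ys (- {i, j})) x =
        - \<omega> (Y # br (Ys ! i) (Ys ! j) # nths Ys (- {i, j})) x"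
      if "j < length Ys" "i < j" for i j
    proof -
      have "Ys ! j \<in> VF" "Ys ! i \<in> VF" using that Cons.prems by auto
      then show ?thesis
        using af_swap[OF Cons.prems(1), of "br (Ys ! i) (Ys ! j)" Y "[]" "nths Ys (- {i, j})"]
          Cons.prems VFs_nths by (simp add: pointwise)
    qed
    have "(\<Sum>i<length Ys. (-1) ^ i * (Ys ! i) (iota Y \<omega> (nths Ys (- {i}))) x)
       + (\<Sum>j<length Ys. \<Sum>i<j.
            (-1) ^ (i + j) * iota Y \<omega> (br (Ys ! i) (Ys ! j) # nths Ys (- {i, j})) x) =
      dform (iota Y \<omega>) Ys x"
      using Cons.prems by (intro Cons.IH) auto
    moreover have "dform \<omega> (Y # Ys) x = lie Y \<omega> Ys x - dform (iota Y \<omega>) Ys x"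
      by (simp only: dform_simps minus_apply)
    moreover have "lie Y \<omega> Ys x = Y (\<omega> Ys) x -
        (\<Sum>j<length Ys. (-1) ^ j * \<omega> (br Y (Ys ! j) # nths Ys (- {j})) x)"
      using Cons.prems by (intro lie_eq_sum) auto
    ultimately have "dform \<omega> (Y # Ys) x = Y (\<omega> Ys) x -
        (\<Sum>j<length Ys. (-1) ^ j * \<omega> (br Y (Ys ! j) # nths Ys (- {j})) x) -
        ((\<Sum>i<length Ys. (-1) ^ i * (Ys ! i) (\<omega> (Y # nths Ys (- {i}))) x)
       + (\<Sum>j<length Ys. \<Sum>i<j.
            (-1) ^ (i + j) * \<omega> (Y # br (Ys ! i) (Ys ! j) # nths Ys (- {i, j})) x))"
      by (simp add: iota_app)
    then show ?case
      by (simp add: sum.lessThan_Suc_shift nths_Cons_omit sw sum_negf sum.distrib sum_subtractf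
          del: sum.lessThan_Suc)
  qed (simp add: dform_simps pointwise)
  then show "ext_d A \<omega> Ys x = (if VFs Ys then dform \<omega> Ys else 0) x"
    by (simp add: ext_d_def pointwise)
qed

end

declare pointwise [simp]

section \<open>Frame tuples and wedge products\<close>

context positively_graded_group
begin

lemma form_out: "\<omega> \<in> forms A \<Longrightarrow> \<not> VFs Ys \<Longrightarrow> \<omega> Ys = 0"
  by (simp add: forms_iff)

lemma form_alt: "\<omega> \<in> forms A \<Longrightarrow> alt_form \<omega>"
  by (simp add: forms_iff)

lemma form_smooth: "\<omega> \<in> forms A \<Longrightarrow> \<omega> Ys \<in> SF"
  by (cases "VFs Ys") (simp_all add: form_out af_smooth[OF form_alt])

lemma form_update_add:
  assumes "\<omega> \<in> forms A" "VFs Ys" "i < length Ys" "Y \<in> VF" "Z \<in> VF"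
  shows "\<omega> (Ys[i := Y + Z]) x = \<omega> (Ys[i := Y]) x + \<omega> (Ys[i := Z]) x"
proof -
  have "\<omega> (Ys[i := Y + Z]) = \<omega> (Ys[i := Y]) + \<omega> (Ys[i := Z])"
    using assms unfolding forms_def by blast
  then show ?thesis by (metis plus_fun_apply)
qed

lemma form_repeat:
  assumes "\<omega> \<in> forms A" "VFs Ys" "i \<noteq> j" "i < length Ys" "j < length Ys" "Ys ! i = Ys ! j"
  shows "\<omega> Ys x = 0"
proof -
  have "\<omega> Ys = 0"
  proof (cases "i < j")
    case True
    then show ?thesis using assms unfolding forms_def by blast
  next
    case False
    then have "j < i" "Ys ! j = Ys ! i" using assms by auto
    then show ?thesis using assms unfolding forms_def by blast
  qed
  then show ?thesis by simp
qed

lemma form_not_distinct: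
  assumes "\<omega> \<in> forms A" "VFs Ys" "\<not> distinct Ys"
  shows "\<omega> Ys x = 0"
  using assms form_repeat by (metis distinct_conv_nth)

text \<open>Polarisation: the form vanishes when the sum of the two entries stands in both slots,
  and expanding leaves the two mixed terms.\<close>

lemma form_exchange:
  assumes "\<omega> \<in> forms A" "VFs Ys" "i \<noteq> j" "i < length Ys" "j < length Ys"
  shows "\<omega> (Ys[i := Ys ! j, j := Ys ! i]) x = - \<omega> Ys x"
proof -
  define F where "F P Q = \<omega> (Ys[i := P, j := Q]) x" for P Q
  have vf: "VFs (Ys[k := P])" if "P \<in> VF" for P k
    using that assms(2) set_update_subset_insert by fastforce
  have vfn: "Ys ! i \<in> VF" "Ys ! j \<in> VF" using assms by auto
  have l: "F (P + Q) R = F P R + F Q R" if "P \<in> VF" "Q \<in> VF" "R \<in> VF" for P Q R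
    unfolding F_def list_update_swap[OF assms(3)]
    using assms that vf by (intro form_update_add) auto
  have r: "F R (P + Q) = F R P + F R Q" if "P \<in> VF" "Q \<in> VF" "R \<in> VF" for P Q R
    unfolding F_def using assms that vf by (intro form_update_add) auto
  have d: "F P P = 0" if "P \<in> VF" for P
    unfolding F_def
  proof (rule form_repeat[OF assms(1) _ assms(3)])
    show "VFs (Ys[i := P, j := P])"
      using that assms(2) set_update_subset_insert by (metis (no_types, lifting) insert_subset order_trans vf)
  qed (use assms in auto)
  have "F (Ys ! i + Ys ! j) (Ys ! i + Ys ! j) = 0"
    using vfn by (intro d VF_add)
  then have "F (Ys ! j) (Ys ! i) = - F (Ys ! i) (Ys ! j)"
    unfolding l[OF vfn VF_add[OF vfn]] r[OF vfn vfn(1)] r[OF vfn vfn(2)] d[OF vfn(1)] d[OF vfn(2)]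
    by linarith
  then show ?thesis by (simp add: F_def)
qed

lemma form_permute:
  assumes "\<omega> \<in> forms A" "\<sigma> permutes {..<length Ys}" "VFs Ys"
  shows "\<omega> (permute_list \<sigma> Ys) x = of_int (sign \<sigma>) * \<omega> Ys x"
proof -
  define n where "n = length Ys"
  \<comment> \<open>The list is generalised because splitting off a transposition permutes it before
    the induction hypothesis is applied.\<close>
  have "\<forall>Ys. length Ys = n \<longrightarrow> VFs Ys \<longrightarrow> \<omega> (permute_list \<sigma> Ys) x = of_int (sign \<sigma>) * \<omega> Ys x"
    using assms(2)[folded n_def] finite_lessThan
  proof (induction \<sigma> rule: permutes_induct)
    case (swap a b p)
    show ?case
    proof (intro allI impI)
      fix Ys :: "'g vfield list" assume Ys: "length Ys = n" "VFs Ys"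
      define Zs where "Zs = permute_list (Transposition.transpose a b) Ys"
      have t: "Transposition.transpose a b permutes {..<length Ys}"
        using swap.hyps Ys by (intro permutes_swap_id) auto
      have Zs: "length Zs = n" "VFs Zs"
        using Ys set_permute_list[OF t] by (simp_all add: Zs_def)
      have "Zs = Ys[a := Ys ! b, b := Ys ! a]"
        using swap.hyps Ys
        by (intro nth_equalityI)
          (auto simp: Zs_def permute_list_nth[OF t] nth_list_update Transposition.transpose_def)
      then have "\<omega> Zs x = - \<omega> Ys x"
        using form_exchange[OF assms(1) Ys(2) swap.hyps(3)] swap.hyps Ys by simp
      moreover have "permute_list (Transposition.transpose a b \<circ> p) Ys = permute_list p Zs"
        unfolding Zs_def using swap.hyps Ys by (intro permute_list_compose) auto
      moreover have "sign (Transposition.transpose a b \<circ> p) = - sign p"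
        using swap.hyps by (simp add: sign_compose sign_swap_id permutation_swap_id
            permutes_imp_permutation[of "{..<n}"])
      ultimately show "\<omega> (permute_list (Transposition.transpose a b \<circ> p) Ys) x =
          of_int (sign (Transposition.transpose a b \<circ> p)) * \<omega> Ys x"
        using swap.IH Zs by simp
    qed
  qed auto
  then show ?thesis using assms(3) n_def by simp
qed

lemma forms_zero [simp, intro]: "0 \<in> forms A"
  by (simp add: forms_iff)

lemma forms_add [simp, intro]: "\<omega> \<in> forms A \<Longrightarrow> \<eta> \<in> forms A \<Longrightarrow> \<omega> + \<eta> \<in> forms A"
  by (simp add: forms_iff)

lemma forms_uminus [simp, intro]: "\<omega> \<in> forms A \<Longrightarrow> - \<omega> \<in> forms A"
  by (auto simp: forms_iff fun_eq_iff)

lemma forms_diff [simp, intro]: "\<omega> \<in> forms A \<Longrightarrow> \<eta> \<in> forms A \<Longrightarrow> \<omega> - \<eta> \<in> forms A"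
  using forms_add[OF _ forms_uminus, of \<omega> \<eta>] by simp

lemma forms_fun_mult [simp, intro]:
  "\<omega> \<in> forms A \<Longrightarrow> h \<in> SF \<Longrightarrow> fun_mult_form h \<omega> \<in> forms A"
  by (auto simp: forms_iff fun_eq_iff fun_mult_form_app)

lemma forms_sum [intro]: "(\<And>i. i \<in> I \<Longrightarrow> \<omega> i \<in> forms A) \<Longrightarrow> sum \<omega> I \<in> forms A"
  by (induction I rule: infinite_finite_induct) auto

section \<open>Wedge products of 1-forms\<close>

lemma SF_prod [intro]: "(\<And>i. i \<in> I \<Longrightarrow> f i \<in> SF) \<Longrightarrow> prod f I \<in> SF"
  by (induction I rule: infinite_finite_induct) auto

lemma prod_apply_fun: "prod f I x = (\<Prod>i\<in>I. f i x)" for f :: "'i \<Rightarrow> 'g \<Rightarrow> real"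
  by (induction I rule: infinite_finite_induct) auto

text \<open>In each term of a wedge product exactly one factor sees the slot \<open>k\<close>; the
  product \<open>R\<close> of the others is independent of the entry. This reduces linearity of the
  wedge product to that of its factors.\<close>

lemma wedge_term_split:
  fixes \<theta>s :: "'g form list"
  assumes "\<sigma> permutes {..<length \<theta>s}" "k < length Ys" "length Ys = length \<theta>s"
  obtains m R where "m < length \<theta>s"
    "\<And>P. (\<Prod>i<length \<theta>s. (\<theta>s ! i) [Ys[k := P] ! \<sigma> i] x) = (\<theta>s ! m) [P] x * R"
proof -
  obtain m where mk: "\<sigma> m = k"
    using permutes_surj[OF assms(1)] by (metis surjD)
  then have m: "m < length \<theta>s" "\<sigma> m = k"
    using assms permutes_in_image[OF assms(1), of m] by auto
  define R where "R = (\<Prod>i\<in>{..<length \<theta>s} - {m}. (\<theta>s ! i) [Ys ! \<sigma> i] x)"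
  have "(\<Prod>i<length \<theta>s. (\<theta>s ! i) [Ys[k := P] ! \<sigma> i] x) = (\<theta>s ! m) [P] x * R" for P
  proof -
    have "(\<Prod>i<length \<theta>s. (\<theta>s ! i) [Ys[k := P] ! \<sigma> i] x) =
        (\<theta>s ! m) [Ys[k := P] ! \<sigma> m] x * (\<Prod>i\<in>{..<length \<theta>s} - {m}. (\<theta>s ! i) [Ys[k := P] ! \<sigma> i] x)"
      using m by (intro prod.remove) auto
    moreover have "(\<Prod>i\<in>{..<length \<theta>s} - {m}. (\<theta>s ! i) [Ys[k := P] ! \<sigma> i] x) = R"
      unfolding R_def
    proof (rule prod.cong)
      fix i assume "i \<in> {..<length \<theta>s} - {m}"
      then have "\<sigma> i \<noteq> k" using m(2) permutes_inj[OF assms(1)] by (auto dest: injD)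
      then show "(\<theta>s ! i) [Ys[k := P] ! \<sigma> i] x = (\<theta>s ! i) [Ys ! \<sigma> i] x" by simp
    qed simp
    ultimately show ?thesis using m assms by simp
  qed
  then show ?thesis using that m by blast
qed

lemma wedge_forms:
  assumes \<theta>s: "\<And>\<theta>. \<theta> \<in> set \<theta>s \<Longrightarrow> \<theta> \<in> forms A"
  shows "wedge \<theta>s \<in> forms A"
proof -
  let ?n = "length \<theta>s"
  let ?T = "\<lambda>Ys \<sigma> x. of_int (sign \<sigma>) * (\<Prod>i<?n. (\<theta>s ! i) [Ys ! \<sigma> i] x)"
  have w: "wedge \<theta>s Ys x = (\<Sum>\<sigma> | \<sigma> permutes {..<?n}. ?T Ys \<sigma> x)" if "length Ys = ?n" for Ys x
    using that by (simp add: wedge_def)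
  have w0: "wedge \<theta>s Ys x = 0" if "length Ys \<noteq> ?n" for Ys x
    using that by (simp add: wedge_def)
  have \<theta>: "\<theta>s ! i \<in> forms A" if "i < ?n" for i
    using \<theta>s that by simp
  have out: "wedge \<theta>s Ys = 0" if "\<not> VFs Ys" for Ys
  proof (rule ext, cases "length Ys = ?n")
    fix x assume len: "length Ys = ?n"
    obtain Y where "Y \<in> set Ys" "Y \<notin> VF"
      using \<open>\<not> VFs Ys\<close> by blast
    then obtain j where j: "j < ?n" "Ys ! j \<notin> VF"
      using len by (metis in_set_conv_nth)
    have jl: "j < length Ys" using j len by simp
    have "?T Ys \<sigma> x = 0" if s: "\<sigma> permutes {..<?n}" for \<sigma>
    proof -
      obtain m R where mR: "m < ?n"
        "\<And>P. (\<Prod>i<?n. (\<theta>s ! i) [Ys[j := P] ! \<sigma> i] x) = (\<theta>s ! m) [P] x * R"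
        by (rule wedge_term_split[OF s jl len, where x = x]) (rule that)
      have "(\<theta>s ! m) [Ys ! j] = 0"
        using form_out[OF \<theta>[OF mR(1)], of "[Ys ! j]"] j by simp
      then show ?thesis using mR(2)[of "Ys ! j"] by simp
    qed
    then show "wedge \<theta>s Ys x = 0 x"
      unfolding w[OF len] zero_fun_apply by (intro sum.neutral) blast
  qed (simp add: w0)
  have smooth: "wedge \<theta>s Ys \<in> SF" for Ys
  proof (cases "length Ys = ?n")
    case True
    have "wedge \<theta>s Ys = (\<Sum>\<sigma> | \<sigma> permutes {..<?n}. (\<lambda>x. of_int (sign \<sigma>)) * (\<Prod>i<?n. (\<theta>s ! i) [Ys ! \<sigma> i]))"
    proof
      fix x
      show "wedge \<theta>s Ys x = (\<Sum>\<sigma> | \<sigma> permutes {..<?n}. (\<lambda>x. of_int (sign \<sigma>)) * (\<Prod>i<?n. (\<theta>s ! i) [Ys ! \<sigma> i])) x"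
        unfolding sum_apply_fun times_fun_apply prod_apply_fun w[OF True] ..
    qed
    also have "\<dots> \<in> SF"
      by (intro SF_sum SF_mult SF_const SF_prod form_smooth \<theta>) simp
    finally show ?thesis .
  next
    case False
    then have "wedge \<theta>s Ys = 0" by (simp add: w0 fun_eq_iff)
    then show ?thesis by simp
  qed
  have add: "wedge \<theta>s (Ys[k := Y + Z]) x = wedge \<theta>s (Ys[k := Y]) x + wedge \<theta>s (Ys[k := Z]) x"
    if "k < length Ys" "Y \<in> VF" "Z \<in> VF" for Ys k Y Z x
  proof (cases "length Ys = ?n")
    case True
    have "?T (Ys[k := Y + Z]) \<sigma> x = ?T (Ys[k := Y]) \<sigma> x + ?T (Ys[k := Z]) \<sigma> x"
      if s: "\<sigma> permutes {..<?n}" for \<sigma>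
    proof -
      obtain m R where mR: "m < ?n"
        "\<And>P. (\<Prod>i<?n. (\<theta>s ! i) [Ys[k := P] ! \<sigma> i] x) = (\<theta>s ! m) [P] x * R"
        by (rule wedge_term_split[OF s \<open>k < length Ys\<close> True, where x = x]) (rule that)
      have "(\<theta>s ! m) [Y + Z] x = (\<theta>s ! m) [Y] x + (\<theta>s ! m) [Z] x"
        using form_update_add[OF \<theta>[OF mR(1)], of "[Y]" 0 Y Z x]
          \<open>Y \<in> VF\<close> \<open>Z \<in> VF\<close> by simp
      then show ?thesis by (simp only: mR(2) distrib_left distrib_right)
    qed
    then show ?thesis
      using True by (simp add: w sum.distrib)
  qed (simp add: w0)
  have smult: "wedge \<theta>s (Ys[k := vf_smult h Y]) x = h x * wedge \<theta>s (Ys[k := Y]) x"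
    if "k < length Ys" "Y \<in> VF" "h \<in> SF" for Ys k Y h x
  proof (cases "length Ys = ?n")
    case True
    have "?T (Ys[k := vf_smult h Y]) \<sigma> x = h x * ?T (Ys[k := Y]) \<sigma> x"
      if s: "\<sigma> permutes {..<?n}" for \<sigma>
    proof -
      obtain m R where mR: "m < ?n"
        "\<And>P. (\<Prod>i<?n. (\<theta>s ! i) [Ys[k := P] ! \<sigma> i] x) = (\<theta>s ! m) [P] x * R"
        by (rule wedge_term_split[OF s \<open>k < length Ys\<close> True, where x = x]) (rule that)
      have "(\<theta>s ! m) [vf_smult h Y] = h * (\<theta>s ! m) [Y]"
        using af_smult[OF form_alt[OF \<theta>[OF mR(1)]], of Y h "[]" "[]"]
          \<open>Y \<in> VF\<close> \<open>h \<in> SF\<close> by simp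
      then have "(\<theta>s ! m) [vf_smult h Y] x = h x * (\<theta>s ! m) [Y] x"
        by (simp only: times_fun_apply)
      then show ?thesis by (simp only: mR(2) mult_ac)
    qed
    then show ?thesis
      using True by (simp add: w sum_distrib_left mult.left_commute)
  qed (simp add: w0)
  \<comment> \<open>Composing a permutation with the transposition of the two equal slots keeps the
    product and reverses the sign, so the sum equals its own negative.\<close>
  have alt: "wedge \<theta>s Ys x = 0" if "i < j" "j < length Ys" "Ys ! i = Ys ! j" for Ys i j x
  proof (cases "length Ys = ?n")
    case True
    let ?t = "Transposition.transpose i j"
    have t: "?t permutes {..<?n}"
      using that True by (intro permutes_swap_id) auto
    have tt: "?t \<circ> (?t \<circ> \<sigma>) = \<sigma>" for \<sigma> :: "nat \<Rightarrow> nat"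
      by (simp add: fun_eq_iff)
    have eq: "Ys ! ?t m = Ys ! m" for m
      using that(3) by (simp add: Transposition.transpose_def)
    have "(\<Sum>\<sigma> | \<sigma> permutes {..<?n}. ?T Ys \<sigma> x) = (\<Sum>\<sigma> | \<sigma> permutes {..<?n}. ?T Ys (?t \<circ> \<sigma>) x)"
      by (rule sum.reindex_bij_witness[of _ "\<lambda>\<sigma>. ?t \<circ> \<sigma>" "\<lambda>\<sigma>. ?t \<circ> \<sigma>"])
        (auto simp: permutes_compose[OF _ t] tt)
    also have "\<dots> = (\<Sum>\<sigma> | \<sigma> permutes {..<?n}. - ?T Ys \<sigma> x)"
    proof (rule sum.cong)
      fix \<sigma> assume "\<sigma> \<in> {\<sigma>. \<sigma> permutes {..<?n}}"
      then have "sign (?t \<circ> \<sigma>) = - sign \<sigma>"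
        using \<open>i < j\<close> by (simp add: sign_compose sign_swap_id permutation_swap_id
            permutes_imp_permutation[of "{..<?n}"])
      then show "?T Ys (?t \<circ> \<sigma>) x = - ?T Ys \<sigma> x" by (simp add: eq)
    qed simp
    finally show ?thesis by (simp add: w[OF True] sum_negf)
  qed (simp add: w0)
  show ?thesis
    unfolding forms_def
  proof (intro CollectI conjI allI impI ballI ext)
    fix Ys i Y h x
    assume "VFs Ys" "i < length Ys" "Y \<in> VF" "h \<in> SF"
    then show "wedge \<theta>s (Ys[i := vf_smult h Y]) x = (h * wedge \<theta>s (Ys[i := Y])) x"
      by (subst times_fun_apply) (intro smult)
  next
    fix Ys i Y Z x
    assume "VFs Ys" "i < length Ys" "Y \<in> VF" "Z \<in> VF"
    then show "wedge \<theta>s (Ys[i := Y + Z]) x = (wedge \<theta>s (Ys[i := Y]) + wedge \<theta>s (Ys[i := Z])) x"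
      by (subst plus_fun_apply) (intro add)
  next
    fix Ys :: "'g vfield list" and i j x assume "i < j" "j < length Ys" "Ys ! i = Ys ! j"
    then show "wedge \<theta>s Ys x = 0 x" by (subst zero_fun_apply) (intro alt)
  qed (simp_all add: out smooth)
qed

end

text \<open>\<open>Basis\<close>, in which the scalar product of forms is written, may mix the
  layers. Weights are counted in a second orthonormal basis \<open>B\<close>, whose elements each
  lie in one layer.\<close>

locale adapted_basis = positively_graded_group G A X V
  for G :: "('g::{t2_space,second_countable_topology}) monoid"
    and A :: "('g, 'v::euclidean_space) atlas"
    and X :: "'v \<Rightarrow> 'g vfield"
    and V :: "int \<Rightarrow> 'v set" +
  fixes B :: "'v set" and wt :: "'v \<Rightarrow> int"
  assumes finite_B: "finite B"
    and orthonormal: "\<And>b c. b \<in> B \<Longrightarrow> c \<in> B \<Longrightarrow> b \<bullet> c = (if b = c then 1 else 0)"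
    and span_B: "span B = UNIV"
    and homogeneous: "\<And>b. b \<in> B \<Longrightarrow> b \<in> V (wt b)"

text \<open>The union of orthonormal bases of the layers is orthonormal because the layers are
  mutually orthogonal, and orthogonality also makes it finite.\<close>

lemma (in positively_graded_group) adapted_basis_exists: "\<exists>B wt. adapted_basis G A X V B wt"
proof -
  have "\<exists>C. C \<subseteq> V w \<and> pairwise orthogonal C \<and> (\<forall>x\<in>C. norm x = 1) \<and> span C = V w" for w
    using orthonormal_basis_subspace[OF layer_subspace, of w] by metis
  then obtain C where C: "\<And>w. C w \<subseteq> V w" "\<And>w. pairwise orthogonal (C w)"
    "\<And>w x. x \<in> C w \<Longrightarrow> norm x = 1" "\<And>w. span (C w) = V w"
    by metis
  define B where "B = (\<Union>w. C w)"
  define wt where "wt b = (SOME w. b \<in> C w)" for b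
  have wt: "b \<in> C (wt b)" if "b \<in> B" for b
    unfolding wt_def using that by (auto simp: B_def intro: someI)
  have on: "b \<bullet> c = (if b = c then 1 else 0)" if "b \<in> B" "c \<in> B" for b c
  proof (cases "b = c")
    case True
    then show ?thesis using C(3)[OF wt[OF that(1)]] by (simp add: norm_eq_1)
  next
    case False
    show ?thesis
    proof (cases "wt b = wt c")
      case True
      then show ?thesis
        using False C(2) wt[OF that(1)] wt[OF that(2)] by (auto simp: pairwise_def orthogonal_def)
    next
      case False
      have "b \<in> V (wt b)" "c \<in> V (wt c)" using C(1) wt that by auto
      then show ?thesis using layers_orthogonal[OF False] \<open>b \<noteq> c\<close> by simp
    qed
  qed
  have "pairwise orthogonal B" using on by (simp add: pairwise_def orthogonal_def)
  then have "finite B" by (rule pairwise_orthogonal_imp_finite)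
  have "V w \<subseteq> span B" for w
    using span_mono[of "C w" B] C(4)[of w] by (auto simp: B_def)
  then have "span (\<Union>w. V w) \<subseteq> span B" by (intro span_minimal) auto
  then have "span B = UNIV" by (auto simp: layers_span)
  have "adapted_basis G A X V B wt"
    by unfold_locales (use \<open>finite B\<close> on \<open>span B = UNIV\<close> subsetD[OF C(1) wt] in auto)
  then show ?thesis by blast
qed

context adapted_basis
begin

lemma B_expand: "v = (\<Sum>b\<in>B. (v \<bullet> b) *\<^sub>R b)"
proof -
  define u where "u = v - (\<Sum>b\<in>B. (v \<bullet> b) *\<^sub>R b)"
  have u: "u \<bullet> c = 0" if "c \<in> B" for c
  proof -
    have "(\<Sum>b\<in>B. (v \<bullet> b) * (b \<bullet> c)) = (\<Sum>b\<in>B. if b = c then v \<bullet> b else 0)"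
      using that by (intro sum.cong) (auto simp: orthonormal)
    then show ?thesis
      using that by (simp add: u_def inner_diff_left inner_sum_left finite_B)
  qed
  have "subspace {w. u \<bullet> w = 0}" by (simp add: subspace_def inner_add_right)
  then have "span B \<subseteq> {w. u \<bullet> w = 0}" using u by (intro span_minimal) auto
  then have "u \<bullet> u = 0" using span_B by blast
  then show ?thesis by (simp add: u_def)
qed

lemma X_app_expand_B: "X v f x = (\<Sum>b\<in>B. (v \<bullet> b) * X b f x)"
proof -
  have "X (\<Sum>b\<in>B. (v \<bullet> b) *\<^sub>R b) f x = (\<Sum>b\<in>B. (v \<bullet> b) * X b f x)"
    by (simp add: linear_sum[OF X_linear] linear_scale[OF X_linear])
  then show ?thesis using B_expand[of v] by simp
qed

lemma X_expand_B: "X v = (\<Sum>b\<in>B. vf_smult (\<lambda>x. v \<bullet> b) (X b))"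
proof (intro ext)
  fix f x
  show "X v f x = (\<Sum>b\<in>B. vf_smult (\<lambda>x. v \<bullet> b) (X b)) f x"
    unfolding sum_apply_fun times_fun_apply by (rule X_app_expand_B)
qed

lemma VF_induct_B [consumes 1, case_names zero add frame]:
  assumes "Y \<in> VF" "P 0" "\<And>Y Z. Y \<in> VF \<Longrightarrow> Z \<in> VF \<Longrightarrow> P Y \<Longrightarrow> P Z \<Longrightarrow> P (Y + Z)"
    and "\<And>h b. h \<in> SF \<Longrightarrow> b \<in> B \<Longrightarrow> P (vf_smult h (X b))"
  shows "P Y"
proof -
  have Y: "Y = (\<Sum>b\<in>B. vf_smult (\<lambda>x. coord Y x \<bullet> b) (X b))"
  proof (intro ext)
    fix f x
    show "Y f x = (\<Sum>b\<in>B. vf_smult (\<lambda>x. coord Y x \<bullet> b) (X b)) f x"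
      unfolding sum_apply_fun times_fun_apply coord[OF assms(1), of f x] by (rule X_app_expand_B)
  qed
  have "P (\<Sum>b\<in>I. vf_smult (\<lambda>x. coord Y x \<bullet> b) (X b)) \<and>
      (\<Sum>b\<in>I. vf_smult (\<lambda>x. coord Y x \<bullet> b) (X b)) \<in> VF"
    if "finite I" "I \<subseteq> B" for I
    using that
  proof (induction I rule: finite_induct)
    case empty
    show ?case by (simp only: sum.empty assms(2) VF_zero simp_thms)
  next
    case (insert b I)
    have "vf_smult (\<lambda>x. coord Y x \<bullet> b) (X b) \<in> VF"
      by (intro VF_smult coord_smooth assms(1) X_VF)
    moreover have "P (vf_smult (\<lambda>x. coord Y x \<bullet> b) (X b))"
      using insert.prems by (intro assms(4) coord_smooth assms(1)) auto
    moreover have "P (\<Sum>b\<in>I. vf_smult (\<lambda>x. coord Y x \<bullet> b) (X b)) \<and>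
        (\<Sum>b\<in>I. vf_smult (\<lambda>x. coord Y x \<bullet> b) (X b)) \<in> VF"
      using insert.IH insert.prems by blast
    ultimately show ?case
      unfolding sum.insert[OF insert.hyps] by (blast intro: assms(3) VF_add)
  qed
  from this[OF finite_B subset_refl] show ?thesis using Y by simp
qed

lemma alt_form_zero_if_frame_zero:
  assumes "alt_form \<omega>" "\<And>cs. set cs \<subseteq> B \<Longrightarrow> \<omega> (map X cs) = 0" "VFs Ys"
  shows "\<omega> Ys = 0"
proof -
  have vf: "VFs (map X cs)" for cs by auto
  \<comment> \<open>The arguments are expanded in the frame from front to back; \<open>cs\<close>
    records the part already replaced.\<close>
  have "\<omega> (map X cs @ Ys) = 0" if "set cs \<subseteq> B" for cs
    using assms(3) that
  proof (induction Ys arbitrary: cs)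
    case (Cons Y Ys)
    have "Y \<in> VF" and Ys: "VFs Ys" using Cons.prems by auto
    then show ?case
    proof (induction Y rule: VF_induct_B)
      case zero
      show ?case by (rule af_zero[OF assms(1) vf Ys])
    next
      case (add Y Z)
      then show ?case using af_add[OF assms(1) add(1,2) vf Ys, of cs] by (simp del: pointwise)
    next
      case (frame h b)
      have "\<omega> (map X (cs @ [b]) @ Ys) = 0"
        using Cons frame by (intro Cons.IH) auto
      then have "\<omega> (map X cs @ X b # Ys) = 0" by simp
      then show ?case using af_smult[OF assms(1) X_VF frame(1) vf Ys, of cs b]
        by (simp del: pointwise)
    qed
  qed (use assms(2) in simp)
  from this[of "[]"] show ?thesis by simp
qed

lemma forms_eqI:
  assumes "\<omega> \<in> forms A" "\<eta> \<in> forms A"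
    "\<And>cs x. set cs \<subseteq> B \<Longrightarrow> distinct cs \<Longrightarrow> \<omega> (map X cs) x = \<eta> (map X cs) x"
  shows "\<omega> = \<eta>"
proof
  fix Ys
  have X_inj: "inj_on X S" for S
    using X_bij by (auto simp: bij_betw_def intro: inj_on_subset)
  have "\<omega> (map X cs) x = \<eta> (map X cs) x" if "set cs \<subseteq> B" for cs x
  proof (cases "distinct cs")
    case False
    then have "\<not> distinct (map X cs)" by (simp add: distinct_map)
    moreover have "VFs (map X cs)" by auto
    ultimately show ?thesis
      using form_not_distinct[OF assms(1)] form_not_distinct[OF assms(2)] by metis
  qed (use assms(3) that in auto)
  then have "(\<omega> - \<eta>) (map X cs) = 0" if "set cs \<subseteq> B" for cs
    using that by (simp add: fun_eq_iff)
  moreover have "alt_form (\<omega> - \<eta>)"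
    using assms by (intro af_minus form_alt)
  ultimately have "(\<omega> - \<eta>) Ys = 0" if "VFs Ys"
    using alt_form_zero_if_frame_zero that by blast
  then show "\<omega> Ys = \<eta> Ys"
    using form_out[OF assms(1)] form_out[OF assms(2)] by (cases "VFs Ys") auto
qed

end

section \<open>Weights\<close>

context adapted_basis
begin

text \<open>The coframe dual to the frame of \<open>B\<close>. It is left-invariant because
  push-forward only translates frame coordinates.\<close>

definition dual :: "'v \<Rightarrow> 'g form"
  where "dual b = (\<lambda>Ys. if VFs Ys \<and> length Ys = 1 then \<lambda>x. coord (hd Ys) x \<bullet> b else 0)"

lemma dual_single: "Y \<in> VF \<Longrightarrow> dual b [Y] = (\<lambda>x. coord Y x \<bullet> b)"
  by (simp add: dual_def)

lemma dual_other: "length Ys \<noteq> 1 \<Longrightarrow> dual b Ys = 0"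
  by (auto simp: dual_def)

lemma dual_form: "dual b \<in> forms A"
proof -
  have "alt_form (dual b)"
  proof (rule alt_formI)
    fix Ys show "dual b Ys \<in> SF" if "VFs Ys"
    proof (cases "length Ys = 1")
      case True
      then obtain Y where "Ys = [Y]" by (auto simp: length_Suc_conv)
      then show ?thesis using that coord_smooth by (simp add: dual_single)
    qed (simp add: dual_other)
  next
    fix as bs Y Z assume *: "Y \<in> VF" "Z \<in> VF" "VFs as" "VFs bs"
    show "dual b (as @ (Y + Z) # bs) = dual b (as @ Y # bs) + dual b (as @ Z # bs)"
    proof (cases "as = [] \<and> bs = []")
      case True
      then show ?thesis
        using * dual_single[OF VF_add[OF *(1,2)]]
        by (simp add: dual_single coord_add fun_eq_iff inner_add_left del: pointwise(1)) simp
    next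
      case False
      have z: "dual b (as @ P # bs) = 0" for P
        by (rule dual_other) (use False in auto)
      show ?thesis unfolding z by simp
    qed
  next
    fix as bs Y h assume *: "Y \<in> VF" "h \<in> SF" "VFs as" "VFs bs"
    show "dual b (as @ vf_smult h Y # bs) = h * dual b (as @ Y # bs)"
    proof (cases "as = [] \<and> bs = []")
      case True
      have "coord (vf_smult h Y) x \<bullet> b = h x * (coord Y x \<bullet> b)" for x
        by (simp only: coord_smult[OF *(1,2)] inner_scaleR_left)
      then show ?thesis
        using True dual_single[OF VF_smult[OF *(2,1)], of b] dual_single[OF *(1), of b]
        by (simp only: append_Nil times_fun_def)
    next
      case False
      have z: "dual b (as @ P # bs) = 0" for P
        by (rule dual_other) (use False in auto)
      show ?thesis unfolding z by simp
    qed
  next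
    fix as bs Y
    show "dual b (as @ Y # Y # bs) = 0" by (rule dual_other) simp
  qed
  then show ?thesis by (auto simp: forms_iff dual_def)
qed

lemma dual_left_inv: "dual b \<in> left_inv_kforms G A 1"
proof -
  interpret group G by (rule group_G)
  have "dual b (map (push_left G g) Ys) (g \<otimes>\<^bsub>G\<^esub> x) = dual b Ys x" if "VFs Ys" for g Ys x
  proof (cases "length Ys = 1")
    case True
    then obtain Y where Ys: "Ys = [Y]" by (auto simp: length_Suc_conv)
    then have Y: "Y \<in> VF" using that by simp
    have "inv\<^bsub>G\<^esub> g \<otimes>\<^bsub>G\<^esub> (g \<otimes>\<^bsub>G\<^esub> x) = x"
      by (simp add: group_G m_assoc[symmetric])
    then show ?thesis
      by (simp add: Ys dual_single[OF Y] dual_single[OF push_left_VF(1)[OF Y]] push_left_VF(2)[OF Y])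
  qed (simp add: dual_other)
  then show ?thesis
    using dual_form by (simp add: left_inv_kforms_def kforms_def dual_other)
qed

lemma dual_weight: "b \<in> B \<Longrightarrow> dual b \<in> weight_1forms (wt b)"
  unfolding weight_1forms_def
  using dual_left_inv layers_orthogonal homogeneous
  by (auto simp: dual_single fun_eq_iff)

definition lwt :: "'v list \<Rightarrow> int"
  where "lwt bs = sum_list (map wt bs)"

text \<open>These are ordered tuples: each set of basis vectors occurs in all its orderings, which
  is the reason for the factorial in \<open>form_of\<close>.\<close>

definition frames :: "'v list set"
  where "frames = {bs. distinct bs \<and> set bs \<subseteq> B}"

lemma finite_frames: "finite frames"
proof (rule finite_subset)
  show "frames \<subseteq> {bs. set bs \<subseteq> B \<and> length bs \<le> card B}"
    using finite_B by (auto simp: frames_def distinct_card[symmetric] intro: card_mono)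
  show "finite {bs. set bs \<subseteq> B \<and> length bs \<le> card B}"
    by (rule finite_lists_length_le[OF finite_B])
qed

lemma wedge_dual_frame:
  assumes "set bs \<subseteq> B" "set cs \<subseteq> B" "length cs = length bs"
  shows "wedge (map dual bs) (map X cs) x =
    (\<Sum>\<sigma> | \<sigma> permutes {..<length cs}. of_int (sign \<sigma>) * (if bs = permute_list \<sigma> cs then 1 else 0))"
proof -
  have "(\<Prod>i<length bs. (map dual bs ! i) [map X cs ! \<sigma> i] x) = (if bs = permute_list \<sigma> cs then 1 else 0)"
    if s: "\<sigma> permutes {..<length cs}" for \<sigma>
  proof -
    have si: "\<sigma> i < length cs" if "i < length bs" for i
      using permutes_in_image[OF s, of i] that assms(3) by simp
    have "(\<Prod>i<length bs. (map dual bs ! i) [map X cs ! \<sigma> i] x) =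
        (\<Prod>i<length bs. if bs ! i = permute_list \<sigma> cs ! i then 1 else 0)"
    proof (rule prod.cong)
      fix i assume i: "i \<in> {..<length bs}"
      have "cs ! \<sigma> i \<in> B" "bs ! i \<in> B" using si i assms by auto
      then show "(map dual bs ! i) [map X cs ! \<sigma> i] x =
          (if bs ! i = permute_list \<sigma> cs ! i then 1 else 0)"
        using i si assms(3) permute_list_nth[OF s, of i]
        by (simp add: dual_single[OF X_VF] orthonormal eq_commute)
    qed simp
    also have "\<dots> = (if \<forall>i<length bs. bs ! i = permute_list \<sigma> cs ! i then 1 else 0)"
      by (auto intro!: prod.neutral)
    also have "(\<forall>i<length bs. bs ! i = permute_list \<sigma> cs ! i) \<longleftrightarrow> bs = permute_list \<sigma> cs"
      using assms(3) by (auto simp: list_eq_iff_nth_eq)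
    finally show ?thesis .
  qed
  then show ?thesis
    using assms(3) by (simp add: wedge_def)
qed

text \<open>The form with frame coefficients \<open>a\<close>, provided that \<open>a\<close>
  changes by the sign under permutations (\<open>form_of_frame\<close>).\<close>

definition form_of :: "('v list \<Rightarrow> 'g \<Rightarrow> real) \<Rightarrow> 'g form"
  where "form_of a = (\<Sum>bs\<in>frames. fun_mult_form (\<lambda>x. a bs x / fact (length bs)) (wedge (map dual bs)))"

lemma SF_divide: "f \<in> SF \<Longrightarrow> (\<lambda>x. f x / c) \<in> SF"
  using SF_mult[OF _ SF_const[of "1 / c"], of f] by (simp add: times_fun_def)

lemma form_of_form:
  assumes "\<And>bs. bs \<in> frames \<Longrightarrow> a bs \<in> SF"
  shows "form_of a \<in> forms A"
  unfolding form_of_def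
  by (intro forms_sum forms_fun_mult wedge_forms SF_divide assms) (auto simp: dual_form)

lemma form_of_app:
  "form_of a Ys x = (\<Sum>bs\<in>frames. a bs x / fact (length bs) * wedge (map dual bs) Ys x)"
  by (simp add: form_of_def sum_apply_fun fun_mult_form_app)

lemma form_of_frame:
  assumes a: "\<And>\<sigma>. \<sigma> permutes {..<length cs} \<Longrightarrow> a (permute_list \<sigma> cs) x = of_int (sign \<sigma>) * a cs x"
    and cs: "cs \<in> frames"
  shows "form_of a (map X cs) x = a cs x"
proof -
  let ?P = "{\<sigma>. \<sigma> permutes {..<length cs}}"
  have cB: "set cs \<subseteq> B" using cs by (simp add: frames_def)
  have fin: "finite ?P" by (rule finite_permutations) simp
  have perm: "permute_list \<sigma> cs \<in> frames" if "\<sigma> \<in> ?P" for \<sigma>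
    using that cs by (simp add: frames_def)
  have "form_of a (map X cs) x = (\<Sum>bs\<in>frames. \<Sum>\<sigma>\<in>?P.
      if bs = permute_list \<sigma> cs then a bs x / fact (length bs) * of_int (sign \<sigma>) else 0)"
    unfolding form_of_app
  proof (rule sum.cong)
    fix bs assume bs: "bs \<in> frames"
    show "a bs x / fact (length bs) * wedge (map dual bs) (map X cs) x = (\<Sum>\<sigma>\<in>?P.
      if bs = permute_list \<sigma> cs then a bs x / fact (length bs) * of_int (sign \<sigma>) else 0)"
    proof (cases "length cs = length bs")
      case True
      have "set bs \<subseteq> B" using bs by (simp add: frames_def)
      then show ?thesis
        unfolding wedge_dual_frame[OF \<open>set bs \<subseteq> B\<close> cB True] sum_distrib_left
        by (intro sum.cong) auto
    next
      case False
      then have "bs \<noteq> permute_list \<sigma> cs" for \<sigma> by auto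
      then show ?thesis using False by (simp add: wedge_def)
    qed
  qed simp
  also have "\<dots> = (\<Sum>\<sigma>\<in>?P. \<Sum>bs\<in>frames.
      if bs = permute_list \<sigma> cs then a bs x / fact (length bs) * of_int (sign \<sigma>) else 0)"
    by (rule sum.swap)
  \<comment> \<open>For each permutation a single tuple survives. Its sign occurs twice, from the
    wedge product and from the alternation of \<open>a\<close>, so that
    \<open>fact (length cs)\<close> equal terms remain.\<close>
  also have "\<dots> = (\<Sum>\<sigma>\<in>?P. a cs x / fact (length cs))"
  proof (rule sum.cong)
    fix \<sigma> assume s: "\<sigma> \<in> ?P"
    have ss: "of_int (sign \<sigma>) * of_int (sign \<sigma>) = (1 :: real)"
      by (simp add: sign_def)
    have "(\<Sum>bs\<in>frames. if bs = permute_list \<sigma> cs then a bs x / fact (length bs) * of_int (sign \<sigma>) else 0)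
        = a (permute_list \<sigma> cs) x / fact (length cs) * of_int (sign \<sigma>)"
      using perm[OF s] finite_frames by simp
    also have "\<dots> = a cs x / fact (length cs) * (of_int (sign \<sigma>) * of_int (sign \<sigma>))"
      using a[of \<sigma>] s by simp
    finally show "(\<Sum>bs\<in>frames. if bs = permute_list \<sigma> cs then a bs x / fact (length bs) * of_int (sign \<sigma>) else 0)
        = a cs x / fact (length cs)" unfolding ss by simp
  qed simp
  also have "\<dots> = a cs x"
    using card_permutations[of "{..<length cs}" "length cs"] by simp
  finally show ?thesis .
qed

lemma form_permute_frame:
  assumes "\<omega> \<in> forms A" "\<sigma> permutes {..<length cs}"
  shows "\<omega> (map X (permute_list \<sigma> cs)) x = of_int (sign \<sigma>) * \<omega> (map X cs) x"
proof -
  have "VFs (map X cs)" by auto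
  then show ?thesis
    using form_permute[OF assms(1), of \<sigma> "map X cs" x] assms(2)
    by (simp add: permute_list_map[OF assms(2)])
qed

lemma lwt_permute: "\<sigma> permutes {..<length cs} \<Longrightarrow> lwt (permute_list \<sigma> cs) = lwt cs"
  unfolding lwt_def by (metis mset_map mset_permute_list sum_mset_sum_list)

text \<open>An explicit model of the weight projection; \<open>weight_comp_eq\<close> identifies the
  two on forms.\<close>

definition comp :: "int \<Rightarrow> 'g form \<Rightarrow> 'g form"
  where "comp q \<omega> = form_of (\<lambda>bs. if lwt bs = q then \<omega> (map X bs) else 0)"

lemma comp_form: "\<omega> \<in> forms A \<Longrightarrow> comp q \<omega> \<in> forms A"
  unfolding comp_def by (rule form_of_form) (simp add: form_smooth)

lemma comp_frame:
  assumes "\<omega> \<in> forms A" "cs \<in> frames"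
  shows "comp q \<omega> (map X cs) x = (if lwt cs = q then \<omega> (map X cs) x else 0)"
proof -
  have "comp q \<omega> (map X cs) x = (if lwt cs = q then \<omega> (map X cs) else 0) x"
    unfolding comp_def
    by (rule form_of_frame[OF _ assms(2)]) (simp add: lwt_permute form_permute_frame[OF assms(1)])
  then show ?thesis by simp
qed

lemma forms_frames_eqI:
  assumes "\<omega> \<in> forms A" "\<eta> \<in> forms A" "\<And>cs x. cs \<in> frames \<Longrightarrow> \<omega> (map X cs) x = \<eta> (map X cs) x"
  shows "\<omega> = \<eta>"
  using assms by (intro forms_eqI) (auto simp: frames_def)

lemma weight_forms_form: "\<omega> \<in> weight_forms p \<Longrightarrow> \<omega> \<in> forms A"
proof (induction rule: weight_forms.induct)
  case (add \<omega> h \<theta>s ws)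
  have "\<theta> \<in> forms A" if "\<theta> \<in> set \<theta>s" for \<theta>
    using that add(3)
    by (auto simp: list_all2_conv_all_nth in_set_conv_nth weight_1forms_def left_inv_kforms_def kforms_def)
  then show ?case using add by (intro forms_add forms_fun_mult wedge_forms) auto
qed (rule forms_zero)

text \<open>A nonzero term of a wedge product pairs every factor with a basis vector of the weight
  of that factor, so the weights of the tuple add up to \<open>p\<close>.\<close>

lemma weight_forms_frame:
  assumes "\<omega> \<in> weight_forms p" "cs \<in> frames" "lwt cs \<noteq> p"
  shows "\<omega> (map X cs) x = 0"
  using assms(1)
proof (induction rule: weight_forms.induct)
  case (add \<omega> h \<theta>s ws)
  have "wedge \<theta>s (map X cs) x = 0"
  proof (cases "length cs = length \<theta>s")
    case True
    have "(\<Prod>i<length \<theta>s. (\<theta>s ! i) [map X cs ! \<sigma> i] x) = 0" if s: "\<sigma> permutes {..<length cs}" for \<sigma>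
    proof (rule ccontr)
      assume nz: "(\<Prod>i<length \<theta>s. (\<theta>s ! i) [map X cs ! \<sigma> i] x) \<noteq> 0"
      have len: "length ws = length \<theta>s" using add(3) by (simp add: list_all2_lengthD)
      have "wt (cs ! \<sigma> i) = ws ! i" if "i < length \<theta>s" for i
      proof (rule ccontr)
        assume ne: "wt (cs ! \<sigma> i) \<noteq> ws ! i"
        have "\<sigma> i < length cs"
          using permutes_in_image[OF s, of i] that True by simp
        then have "cs ! \<sigma> i \<in> V (wt (cs ! \<sigma> i))"
          using assms(2) by (intro homogeneous) (auto simp: frames_def)
        moreover have "\<theta>s ! i \<in> weight_1forms (ws ! i)"
          using add(3) that by (simp add: list_all2_conv_all_nth)
        ultimately have "(\<theta>s ! i) [X (cs ! \<sigma> i)] = 0"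
          using ne by (auto simp: weight_1forms_def)
        then have "(\<theta>s ! i) [map X cs ! \<sigma> i] x = 0"
          using \<open>\<sigma> i < length cs\<close> by simp
        then show False using nz that by auto
      qed
      then have "map wt (permute_list \<sigma> cs) = ws"
        using True len permute_list_nth[OF s] by (intro nth_equalityI) auto
      then have "lwt (permute_list \<sigma> cs) = p" using add(4) by (simp add: lwt_def)
      then show False using assms(3) lwt_permute[OF s] by simp
    qed
    then have "(\<Sum>\<sigma> | \<sigma> permutes {..<length \<theta>s}.
        of_int (sign \<sigma>) * (\<Prod>i<length \<theta>s. (\<theta>s ! i) [map X cs ! \<sigma> i] x)) = 0"
      using True by (intro sum.neutral) auto
    then show ?thesis using True by (simp add: wedge_def)
  qed (simp add: wedge_def)
  then show ?case using add by (simp add: fun_mult_form_app)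
qed simp

text \<open>Turns the inductively generated span into a condition on frame coefficients. For the
  converse, the expansion in wedge products of the coframe has only terms of weight
  \<open>p\<close>.\<close>

lemma weight_forms_iff:
  "\<omega> \<in> weight_forms p \<longleftrightarrow>
    \<omega> \<in> forms A \<and> (\<forall>cs\<in>frames. lwt cs \<noteq> p \<longrightarrow> (\<forall>x. \<omega> (map X cs) x = 0))"
proof
  assume r: "\<omega> \<in> forms A \<and> (\<forall>cs\<in>frames. lwt cs \<noteq> p \<longrightarrow> (\<forall>x. \<omega> (map X cs) x = 0))"
  let ?t = "\<lambda>bs. fun_mult_form (\<lambda>x. \<omega> (map X bs) x / fact (length bs)) (wedge (map dual bs))"
  have "form_of (\<lambda>bs. \<omega> (map X bs)) = \<omega>"
    using r by (intro forms_frames_eqI form_of_form form_of_frame form_permute_frame)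
      (auto intro: form_smooth)
  then have w: "\<omega> = (\<Sum>bs\<in>frames. ?t bs)"
    by (simp add: form_of_def)
  have "(\<Sum>bs\<in>I. ?t bs) \<in> weight_forms p" if "finite I" "I \<subseteq> frames" for I
    using that
  proof (induction I rule: finite_induct)
    case empty
    show ?case unfolding sum.empty by (rule weight_forms.zero)
  next
    case (insert bs I)
    have IH: "(\<Sum>bs\<in>I. ?t bs) \<in> weight_forms p" using insert by blast
    show ?case
    proof (cases "lwt bs = p")
      case True
      have "list_all2 (\<lambda>\<theta> w. \<theta> \<in> weight_1forms w) (map dual bs) (map wt bs)"
        using insert.prems
        by (auto simp: list_all2_conv_all_nth frames_def intro!: dual_weight intro: subsetD[OF _ nth_mem])
      moreover have "(\<lambda>x. \<omega> (map X bs) x / fact (length bs)) \<in> SF"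
        using r by (intro SF_divide form_smooth) auto
      ultimately have "(\<Sum>bs\<in>I. ?t bs) + ?t bs \<in> weight_forms p"
        using True by (intro weight_forms.add[OF IH]) (auto simp: lwt_def)
      then show ?thesis
        unfolding sum.insert[OF insert.hyps] by (simp only: add.commute)
    next
      case False
      then have "?t bs = 0"
        using r insert.prems by (simp add: fun_mult_form_app fun_eq_iff)
      then show ?thesis
        using IH unfolding sum.insert[OF insert.hyps] by (simp only: add_0)
    qed
  qed
  from this[OF finite_frames subset_refl] show "\<omega> \<in> weight_forms p"
    by (subst w)
qed (auto simp: weight_forms_form weight_forms_frame)

lemma comp_weight: "\<omega> \<in> forms A \<Longrightarrow> comp q \<omega> \<in> weight_forms q"
  by (simp add: weight_forms_iff comp_form comp_frame)

lemma comp_support: "\<omega> \<in> forms A \<Longrightarrow> comp q \<omega> \<noteq> 0 \<Longrightarrow> q \<in> lwt ` frames"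
  by (rule ccontr) (auto intro!: forms_frames_eqI[of "comp q \<omega>" 0] simp: comp_form comp_frame)

text \<open>At a frame tuple all summands vanish except the one whose weight is that of the tuple.
  This gives both existence and uniqueness of the decomposition selected by
  \<open>THE\<close>.\<close>

lemma weight_decomp_eq:
  assumes w: "\<omega> \<in> forms A"
  shows "weight_decomp \<omega> = (\<lambda>q. comp q \<omega>)"
  unfolding weight_decomp_def
proof (rule the_equality)
  have fin: "finite {q. comp q \<omega> \<noteq> 0}"
    by (rule finite_subset[of _ "lwt ` frames"]) (use comp_support[OF w] finite_frames in auto)
  moreover have "\<omega> = (\<Sum>q | comp q \<omega> \<noteq> 0. comp q \<omega>)"
  proof (rule forms_frames_eqI[OF w])
    show "(\<Sum>q | comp q \<omega> \<noteq> 0. comp q \<omega>) \<in> forms A"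
      by (intro forms_sum comp_form w)
    fix cs x assume cs: "cs \<in> frames"
    have "(\<Sum>q | comp q \<omega> \<noteq> 0. comp q \<omega> (map X cs) x) =
        (\<Sum>q | comp q \<omega> \<noteq> 0. if q = lwt cs then \<omega> (map X cs) x else 0)"
      by (intro sum.cong) (auto simp: comp_frame[OF w cs])
    also have "\<dots> = \<omega> (map X cs) x"
      using comp_frame[OF w cs, of "lwt cs" x] fin by (auto simp: sum.delta')
    finally show "\<omega> (map X cs) x = (\<Sum>q | comp q \<omega> \<noteq> 0. comp q \<omega>) (map X cs) x"
      by (simp add: sum_apply_fun)
  qed
  ultimately show "(\<forall>q. comp q \<omega> \<in> weight_forms q) \<and> finite {q. comp q \<omega> \<noteq> 0} \<and>
      \<omega> = (\<Sum>q | comp q \<omega> \<noteq> 0. comp q \<omega>)"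
    using comp_weight[OF w] by blast
next
  fix c assume c: "(\<forall>q. c q \<in> weight_forms q) \<and> finite {q. c q \<noteq> 0} \<and> \<omega> = (\<Sum>q | c q \<noteq> 0. c q)"
  show "c = (\<lambda>q. comp q \<omega>)"
  proof
    fix q
    show "c q = comp q \<omega>"
    proof (rule forms_frames_eqI)
      show "c q \<in> forms A" using c weight_forms_form by blast
      show "comp q \<omega> \<in> forms A" by (rule comp_form[OF w])
      fix cs x assume cs: "cs \<in> frames"
      have z: "c r (map X cs) x = 0" if "r \<noteq> lwt cs" for r
        using c weight_forms_frame[OF _ cs] that by metis
      have "\<omega> (map X cs) x = (\<Sum>r | c r \<noteq> 0. c r) (map X cs) x"
        using c by metis
      also have "\<dots> = (\<Sum>r | c r \<noteq> 0. if r = lwt cs then c (lwt cs) (map X cs) x else 0)"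
        unfolding sum_apply_fun by (intro sum.cong) (auto simp: z)
      also have "\<dots> = c (lwt cs) (map X cs) x"
        using c by (auto simp: sum.delta')
      finally show "c q (map X cs) x = comp q \<omega> (map X cs) x"
        using z[of q] by (auto simp: comp_frame[OF w cs])
    qed
  qed
qed

lemma weight_comp_eq: "\<omega> \<in> forms A \<Longrightarrow> weight_comp q \<omega> = comp q \<omega>"
  by (simp add: weight_comp_def weight_decomp_eq)

end

section \<open>The exterior derivative and its part of weight zero\<close>

context adapted_basis
begin

text \<open>Bridges the two notions of form: \<open>dform\<close> is unconstrained outside lists of
  vector fields, whereas elements of \<open>forms A\<close> vanish there.\<close>

lemma restrict_form:
  assumes "alt_form \<omega>"
  shows "(\<lambda>Ys. if VFs Ys then \<omega> Ys else 0) \<in> forms A"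
  unfolding forms_iff
proof (intro conjI alt_formI)
  fix as bs Y Z assume *: "Y \<in> VF" "Z \<in> VF" "VFs as" "VFs bs"
  then have "VFs (as @ P # bs)" if "P \<in> VF" for P using that by simp
  then show "(if VFs (as @ (Y + Z) # bs) then \<omega> (as @ (Y + Z) # bs) else 0) =
      (if VFs (as @ Y # bs) then \<omega> (as @ Y # bs) else 0) +
      (if VFs (as @ Z # bs) then \<omega> (as @ Z # bs) else 0)"
    using * af_add[OF assms *] VF_add[OF *(1,2)] by (simp only: if_True)
next
  fix as bs Y h assume *: "Y \<in> VF" "h \<in> SF" "VFs as" "VFs bs"
  then have "VFs (as @ P # bs)" if "P \<in> VF" for P using that by simp
  then show "(if VFs (as @ vf_smult h Y # bs) then \<omega> (as @ vf_smult h Y # bs) else 0) =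
      h * (if VFs (as @ Y # bs) then \<omega> (as @ Y # bs) else 0)"
    using * af_smult[OF assms *] VF_smult[OF *(2,1)] by (simp only: if_True)
next
  fix as bs Y assume *: "Y \<in> VF" "VFs as" "VFs bs"
  then have "VFs (as @ Y # Y # bs)" by simp
  then show "(if VFs (as @ Y # Y # bs) then \<omega> (as @ Y # Y # bs) else 0) = 0"
    using af_adj[OF assms *] by (simp only: if_True)
qed (use af_smooth[OF assms] in auto)

lemma d_form: "\<omega> \<in> forms A \<Longrightarrow> ext_d A \<omega> \<in> forms A"
  unfolding ext_d_eq_dform[OF form_alt] by (intro restrict_form af_dform form_alt)

lemma d_app: "\<omega> \<in> forms A \<Longrightarrow> VFs Ys \<Longrightarrow> ext_d A \<omega> Ys = dform \<omega> Ys"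
  by (simp add: ext_d_eq_dform form_alt)

lemma forms_VFs_eqI:
  assumes "\<omega> \<in> forms A" "\<eta> \<in> forms A" "\<And>Ys. VFs Ys \<Longrightarrow> \<omega> Ys = \<eta> Ys"
  shows "\<omega> = \<eta>"
proof
  fix Ys
  show "\<omega> Ys = \<eta> Ys"
    using assms(3) form_out[OF assms(1)] form_out[OF assms(2)] by (cases "VFs Ys") auto
qed

lemma d_add:
  assumes "\<omega> \<in> forms A" "\<eta> \<in> forms A"
  shows "ext_d A (\<omega> + \<eta>) = ext_d A \<omega> + ext_d A \<eta>"
proof (rule forms_VFs_eqI)
  fix Ys :: "'g vfield list" assume Ys: "VFs Ys"
  show "ext_d A (\<omega> + \<eta>) Ys = (ext_d A \<omega> + ext_d A \<eta>) Ys"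
    unfolding plus_fun_apply[of "ext_d A \<omega>"] d_app[OF forms_add[OF assms] Ys]
      d_app[OF assms(1) Ys] d_app[OF assms(2) Ys]
    using assms by (intro dform_add form_alt Ys)
qed (use assms in \<open>auto intro: d_form\<close>)

lemma d_uminus:
  assumes "\<omega> \<in> forms A"
  shows "ext_d A (- \<omega>) = - ext_d A \<omega>"
proof (rule forms_VFs_eqI)
  fix Ys :: "'g vfield list" assume Ys: "VFs Ys"
  show "ext_d A (- \<omega>) Ys = (- ext_d A \<omega>) Ys"
    unfolding uminus_apply[of "ext_d A \<omega>"] d_app[OF forms_uminus[OF assms] Ys] d_app[OF assms Ys]
    using assms by (intro dform_uminus form_alt Ys)
qed (use assms in \<open>auto intro: d_form\<close>)

lemma d_diff:
  assumes "\<omega> \<in> forms A" "\<eta> \<in> forms A"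
  shows "ext_d A (\<omega> - \<eta>) = ext_d A \<omega> - ext_d A \<eta>"
  using d_add[OF assms(1) forms_uminus[OF assms(2)]] d_uminus[OF assms(2)] by simp

lemma d_zero: "ext_d A 0 = 0"
  using d_diff[OF forms_zero forms_zero] by simp

lemma d_d:
  assumes "\<omega> \<in> forms A"
  shows "ext_d A (ext_d A \<omega>) = 0"
proof (rule forms_VFs_eqI)
  fix Ys :: "'g vfield list" assume Ys: "VFs Ys"
  have "ext_d A (ext_d A \<omega>) Ys = dform (ext_d A \<omega>) Ys"
    using assms Ys by (intro d_app d_form)
  also have "\<dots> = dform (dform \<omega>) Ys"
    using assms Ys by (intro dform_cong d_app)
  also have "\<dots> = 0"
    using assms Ys by (intro dform_dform form_alt)
  finally show "ext_d A (ext_d A \<omega>) Ys = (0 :: 'g form) Ys" by simp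
qed (use assms in \<open>auto intro: d_form\<close>)

lemma kformsD: "\<omega> \<in> kforms A k \<Longrightarrow> \<omega> \<in> forms A"
    "\<omega> \<in> kforms A k \<Longrightarrow> length Ys \<noteq> k \<Longrightarrow> \<omega> Ys = 0"
  by (auto simp: kforms_def)

lemma d_kform:
  assumes "\<omega> \<in> kforms A k"
  shows "ext_d A \<omega> \<in> kforms A (Suc k)"
  unfolding kforms_def
proof (intro CollectI conjI allI impI)
  show "ext_d A \<omega> \<in> forms A" using assms kformsD d_form by blast
  fix Ys :: "'g vfield list" assume len: "length Ys \<noteq> Suc k"
  show "ext_d A \<omega> Ys = 0"
  proof (cases "VFs Ys")
    case True
    have "dform \<omega> Ys = 0"
    proof (cases Ys)
      case (Cons Z Zs)
      show ?thesis
        by (rule dform_vanish[where n = "length Zs"]) (use assms len True Cons kformsD(2) in auto)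
    qed (simp add: dform_simps)
    then show ?thesis using d_app[OF kformsD(1)[OF assms] True] by simp
  next
    case False
    then show ?thesis using form_out[OF d_form[OF kformsD(1)[OF assms]]] by blast
  qed
qed

text \<open>The Chevalley-Eilenberg part of the Koszul formula, which \<open>d0_frame\<close>
  identifies with \<open>d0\<close>.\<close>

definition bracket_part :: "'g form \<Rightarrow> 'v list \<Rightarrow> 'g \<Rightarrow> real"
  where "bracket_part \<omega> bs x = (\<Sum>j<length bs. \<Sum>i<j.
    (-1) ^ (i + j) * \<omega> (br (X (bs ! i)) (X (bs ! j)) # map X (nths bs (- {i, j}))) x)"

lemma d_frame:
  "ext_d A \<omega> (map X bs) x =
    (\<Sum>i<length bs. (-1) ^ i * X (bs ! i) (\<omega> (map X (nths bs (- {i})))) x) + bracket_part \<omega> bs x"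
proof -
  have "VFs (map X bs)" by auto
  then show ?thesis
    unfolding ext_d_def bracket_part_def by (auto simp: nths_map intro!: sum.cong)
qed

lemma lwt_Cons: "lwt (b # bs) = wt b + lwt bs"
  by (simp add: lwt_def)

lemma lwt_omit: "i < length bs \<Longrightarrow> lwt bs = wt (bs ! i) + lwt (nths bs (- {i}))"
proof (induction bs arbitrary: i)
  case (Cons b bs)
  then show ?case by (cases i) (simp_all add: lwt_Cons nths_Cons_omit)
qed simp

lemma lwt_omit2: "i < j \<Longrightarrow> j < length bs \<Longrightarrow>
    lwt bs = wt (bs ! i) + wt (bs ! j) + lwt (nths bs (- {i, j}))"
proof (induction bs arbitrary: i j)
  case (Cons b bs)
  obtain j' where j: "j = Suc j'" using Cons.prems by (cases j) auto
  show ?case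
  proof (cases i)
    case 0
    then show ?thesis using Cons.prems lwt_omit[of j' bs] by (simp add: j lwt_Cons nths_Cons_omit)
  next
    case (Suc i')
    then show ?thesis using Cons.prems Cons.IH[of i' j'] by (simp add: j lwt_Cons nths_Cons_omit)
  qed
qed simp

lemma wt_pos: "b \<in> B \<Longrightarrow> wt b > 0"
  using homogeneous[of b] layer_nonpos[of "wt b"] orthonormal[of b b] by force

lemma frames_omit: "bs \<in> frames \<Longrightarrow> nths bs I \<in> frames"
  using set_nths_subset[of bs I] by (auto simp: frames_def)

lemma form_X_expand:
  assumes "\<omega> \<in> forms A"
  shows "\<omega> (X u # map X bs) x = (\<Sum>b\<in>B. (u \<bullet> b) * \<omega> (map X (b # bs)) x)"
proof -
  have vf: "VFs (map X bs)" by auto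
  have af: "alt_form \<omega>" using assms by (rule form_alt)
  have "(\<Sum>b\<in>I. vf_smult (\<lambda>x. u \<bullet> b) (X b)) \<in> VF \<and>
      \<omega> ((\<Sum>b\<in>I. vf_smult (\<lambda>x. u \<bullet> b) (X b)) # map X bs) x = (\<Sum>b\<in>I. (u \<bullet> b) * \<omega> (X b # map X bs) x)"
    if "finite I" for I
    using that
  proof (induction I rule: finite_induct)
    case empty
    have "\<omega> (0 # map X bs) = 0" using af_zero[OF af, of "[]" "map X bs"] vf by simp
    then show ?case unfolding sum.empty by (metis VF_zero zero_fun_apply)
  next
    case (insert b I)
    define S where "S = (\<Sum>b\<in>I. vf_smult (\<lambda>x. u \<bullet> b) (X b))"
    have S: "S \<in> VF" "\<omega> (S # map X bs) x = (\<Sum>b\<in>I. (u \<bullet> b) * \<omega> (X b # map X bs) x)"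
      using insert.IH by (auto simp only: S_def)
    have b: "vf_smult (\<lambda>x. u \<bullet> b) (X b) \<in> VF" by (intro VF_smult SF_const X_VF)
    have 1: "\<omega> ((vf_smult (\<lambda>x. u \<bullet> b) (X b) + S) # map X bs) =
        \<omega> (vf_smult (\<lambda>x. u \<bullet> b) (X b) # map X bs) + \<omega> (S # map X bs)"
      using af_add[OF af b S(1), of "[]" "map X bs"] vf by (simp only: append_Nil list.set empty_subsetI)
    have 2: "\<omega> (vf_smult (\<lambda>x. u \<bullet> b) (X b) # map X bs) = (\<lambda>x. u \<bullet> b) * \<omega> (X b # map X bs)"
      using af_smult[OF af X_VF[of b] SF_const[of "u \<bullet> b"], of "[]" "map X bs"] vf
      by (simp only: append_Nil list.set empty_subsetI)
    have 3: "\<omega> ((vf_smult (\<lambda>x. u \<bullet> b) (X b) + S) # map X bs) x =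
        \<omega> (vf_smult (\<lambda>x. u \<bullet> b) (X b) # map X bs) x + \<omega> (S # map X bs) x"
      by (subst 1) (rule plus_fun_apply)
    have 4: "\<omega> (vf_smult (\<lambda>x. u \<bullet> b) (X b) # map X bs) x = (u \<bullet> b) * \<omega> (X b # map X bs) x"
      by (subst 2) (rule times_fun_apply)
    show ?case
      unfolding sum.insert[OF insert.hyps] S_def[symmetric] 3 4 S(2)
      using VF_add[OF b S(1)] by blast
  qed
  from this[OF finite_B] show ?thesis using X_expand_B[of u] by simp
qed

lemma form_frames_zero:
  assumes "\<omega> \<in> forms A" "\<And>cs. cs \<in> frames \<Longrightarrow> lwt cs = q \<Longrightarrow> \<omega> (map X cs) x = 0"
    and "set bs \<subseteq> B" "lwt bs = q"
  shows "\<omega> (map X bs) x = 0"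
proof (cases "distinct bs")
  case False
  then have "\<not> distinct (map X bs)" by (simp add: distinct_map)
  moreover have "VFs (map X bs)" by auto
  ultimately show ?thesis using form_not_distinct[OF assms(1)] by blast
qed (use assms in \<open>auto simp: frames_def\<close>)

text \<open>The \<open>c\<close> are structure constants of the Lie algebra. That they depend
  neither on the form nor on the point yields \<open>const_form_d0\<close>; that the grading kills
  those which change the weight yields \<open>bracket_part_zero\<close>.\<close>

lemma bracket_part_expand:
  assumes "set bs \<subseteq> B"
  obtains c where "\<And>\<omega> x. \<omega> \<in> forms A \<Longrightarrow> bracket_part \<omega> bs x =
    (\<Sum>j<length bs. \<Sum>i<j. (-1) ^ (i + j) * (\<Sum>b\<in>B. c i j b * \<omega> (map X (b # nths bs (- {i, j}))) x))"
    "\<And>i j b. i < j \<Longrightarrow> j < length bs \<Longrightarrow> b \<in> B \<Longrightarrow> lwt (b # nths bs (- {i, j})) \<noteq> lwt bs \<Longrightarrow> c i j b = 0"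
proof -
  have "\<exists>u. br (X (bs ! i)) (X (bs ! j)) = X u \<and> u \<in> V (wt (bs ! i) + wt (bs ! j))"
    if "i < j" "j < length bs" for i j
  proof -
    have "bs ! i \<in> B" "bs ! j \<in> B" using that assms by auto
    then show ?thesis using layers_bracket[OF homogeneous homogeneous] by auto
  qed
  then obtain u where u: "\<And>i j. i < j \<Longrightarrow> j < length bs \<Longrightarrow> br (X (bs ! i)) (X (bs ! j)) = X (u i j)"
    "\<And>i j. i < j \<Longrightarrow> j < length bs \<Longrightarrow> u i j \<in> V (wt (bs ! i) + wt (bs ! j))"
    by metis
  show ?thesis
  proof (rule that)
    fix \<omega> x assume w: "\<omega> \<in> forms A"
    show "bracket_part \<omega> bs x = (\<Sum>j<length bs. \<Sum>i<j. (-1) ^ (i + j) *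
        (\<Sum>b\<in>B. (u i j \<bullet> b) * \<omega> (map X (b # nths bs (- {i, j}))) x))"
      unfolding bracket_part_def
      by (intro sum.cong refl) (simp only: u(1) lessThan_iff form_X_expand[OF w])
  next
    fix i j b assume *: "i < j" "j < length bs" "b \<in> B" "lwt (b # nths bs (- {i, j})) \<noteq> lwt bs"
    then have "wt (bs ! i) + wt (bs ! j) \<noteq> wt b"
      using lwt_omit2[OF *(1,2)] by (auto simp: lwt_Cons)
    then show "u i j \<bullet> b = 0"
      by (rule layers_orthogonal[OF _ u(2)[OF *(1,2)] homogeneous[OF *(3)]])
  qed
qed

lemma bracket_part_zero:
  assumes w: "\<omega> \<in> forms A" and bs: "set bs \<subseteq> B"
    and z: "\<And>cs. cs \<in> frames \<Longrightarrow> lwt cs = lwt bs \<Longrightarrow> \<omega> (map X cs) x = 0"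
  shows "bracket_part \<omega> bs x = 0"
proof -
  obtain c where c: "\<And>\<omega> x. \<omega> \<in> forms A \<Longrightarrow> bracket_part \<omega> bs x =
    (\<Sum>j<length bs. \<Sum>i<j. (-1) ^ (i + j) * (\<Sum>b\<in>B. c i j b * \<omega> (map X (b # nths bs (- {i, j}))) x))"
    "\<And>i j b. i < j \<Longrightarrow> j < length bs \<Longrightarrow> b \<in> B \<Longrightarrow> lwt (b # nths bs (- {i, j})) \<noteq> lwt bs \<Longrightarrow> c i j b = 0"
    by (rule bracket_part_expand[OF bs]) (rule that)
  have "c i j b * \<omega> (map X (b # nths bs (- {i, j}))) x = 0" if "i < j" "j < length bs" "b \<in> B" for i j b
  proof (cases "lwt (b # nths bs (- {i, j})) = lwt bs")
    case True
    have "set (b # nths bs (- {i, j})) \<subseteq> B"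
      using bs that(3) set_nths_subset[of bs] by auto
    then have "\<omega> (map X (b # nths bs (- {i, j}))) x = 0"
      using form_frames_zero[OF w z] True by blast
    then show ?thesis by simp
  next
    case False
    then show ?thesis using c(2)[OF that] by simp
  qed
  then show ?thesis
    unfolding c(1)[OF w] by (auto intro!: sum.neutral)
qed

lemma bracket_part_add: "bracket_part (\<omega> + \<eta>) bs x = bracket_part \<omega> bs x + bracket_part \<eta> bs x"
  by (simp add: bracket_part_def sum.distrib distrib_left)

lemma bracket_part_diff: "bracket_part (\<omega> - \<eta>) bs x = bracket_part \<omega> bs x - bracket_part \<eta> bs x"
  by (simp add: bracket_part_def sum_subtractf right_diff_distrib)

lemma bracket_part_fun_mult: "bracket_part (fun_mult_form h \<omega>) bs x = h x * bracket_part \<omega> bs x"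
  by (simp add: bracket_part_def fun_mult_form_app sum_distrib_left mult.left_commute)

lemma bracket_part_cong:
  assumes "\<omega> \<in> forms A" "\<eta> \<in> forms A" "set bs \<subseteq> B"
    "\<And>cs. cs \<in> frames \<Longrightarrow> lwt cs = lwt bs \<Longrightarrow> \<omega> (map X cs) x = \<eta> (map X cs) x"
  shows "bracket_part \<omega> bs x = bracket_part \<eta> bs x"
  using bracket_part_zero[OF forms_diff[OF assms(1,2)] assms(3)] assms(4)
  by (simp add: bracket_part_diff)

text \<open>Basis vectors have positive weight, so omitting an entry gives a tuple of lower weight,
  on which the form vanishes identically. Hence the derivative terms of the Koszul formula
  disappear.\<close>

lemma d_frame_low:
  assumes "\<omega> \<in> forms A" "bs \<in> frames" "\<And>cs x. cs \<in> frames \<Longrightarrow> lwt cs < lwt bs \<Longrightarrow> \<omega> (map X cs) x = 0"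
  shows "ext_d A \<omega> (map X bs) x = bracket_part \<omega> bs x"
proof -
  have "X (bs ! i) (\<omega> (map X (nths bs (- {i})))) x = 0" if "i < length bs" for i
  proof -
    have "bs ! i \<in> B" using assms(2) that by (auto simp: frames_def)
    then have "lwt (nths bs (- {i})) < lwt bs"
      using lwt_omit[OF that] wt_pos[of "bs ! i"] by simp
    then have "\<omega> (map X (nths bs (- {i}))) = 0"
      using assms(3)[OF frames_omit[OF assms(2)]] by (simp add: fun_eq_iff)
    then show ?thesis by simp
  qed
  then show ?thesis by (simp add: d_frame)
qed

lemma d0_form: "\<omega> \<in> forms A \<Longrightarrow> d0 \<omega> \<in> forms A"
  unfolding d_part_def by (intro forms_sum) (simp add: weight_comp_eq comp_form d_form)

text \<open>At \<open>bs\<close> only the component of weight \<open>lwt bs\<close> contributes to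
  \<open>d0\<close>, and this component has no coefficients of lower weight, so that
  \<open>d_frame_low\<close> applies.\<close>

lemma d0_frame:
  assumes w: "\<omega> \<in> forms A" and bs: "bs \<in> frames"
  shows "d0 \<omega> (map X bs) x = bracket_part \<omega> bs x"
proof -
  let ?q = "lwt bs"
  have fin: "finite {q. comp q \<omega> \<noteq> 0}"
    by (rule finite_subset[of _ "lwt ` frames"]) (use comp_support[OF w] finite_frames in auto)
  have "d0 \<omega> (map X bs) x =
      (\<Sum>q | comp q \<omega> \<noteq> 0. comp q (ext_d A (comp q \<omega>)) (map X bs) x)"
    unfolding d_part_def weight_comp_eq[OF w]
    by (simp add: sum_apply_fun weight_comp_eq comp_form d_form w)
  also have "\<dots> = (\<Sum>q | comp q \<omega> \<noteq> 0. if q = ?q then ext_d A (comp ?q \<omega>) (map X bs) x else 0)"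
    by (intro sum.cong) (auto simp: comp_frame[OF d_form[OF comp_form[OF w]] bs])
  \<comment> \<open>The index \<open>lwt bs\<close> may be missing from the sum; then the component
    is 0, and so is its exterior derivative.\<close>
  also have "\<dots> = ext_d A (comp ?q \<omega>) (map X bs) x"
    using fin by (cases "comp ?q \<omega> = 0") (simp_all add: d_zero)
  also have "\<dots> = bracket_part (comp ?q \<omega>) bs x"
    by (rule d_frame_low[OF comp_form[OF w] bs]) (simp add: comp_frame[OF w])
  also have "\<dots> = bracket_part \<omega> bs x"
    using bs by (intro bracket_part_cong comp_form w) (auto simp: comp_frame[OF w] frames_def)
  finally show ?thesis .
qed

lemma d0_add: "\<omega> \<in> forms A \<Longrightarrow> \<eta> \<in> forms A \<Longrightarrow> d0 (\<omega> + \<eta>) = d0 \<omega> + d0 \<eta>"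
  by (rule forms_frames_eqI) (simp_all add: d0_form d0_frame bracket_part_add)

lemma d0_diff: "\<omega> \<in> forms A \<Longrightarrow> \<eta> \<in> forms A \<Longrightarrow> d0 (\<omega> - \<eta>) = d0 \<omega> - d0 \<eta>"
  by (rule forms_frames_eqI) (simp_all add: d0_form d0_frame bracket_part_diff)

lemma d0_fun_mult: "\<omega> \<in> forms A \<Longrightarrow> h \<in> SF \<Longrightarrow> d0 (fun_mult_form h \<omega>) = fun_mult_form h (d0 \<omega>)"
  by (rule forms_frames_eqI) (simp_all add: d0_form d0_frame bracket_part_fun_mult fun_mult_form_app)

section \<open>Weights and degrees under the derivatives\<close>

lemma d0_comp:
  assumes w: "\<omega> \<in> forms A"
  shows "d0 (comp q \<omega>) = comp q (d0 \<omega>)"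
proof (rule forms_frames_eqI)
  fix cs x assume cs: "cs \<in> frames"
  then have cB: "set cs \<subseteq> B" by (simp add: frames_def)
  show "d0 (comp q \<omega>) (map X cs) x = comp q (d0 \<omega>) (map X cs) x"
  proof (cases "lwt cs = q")
    case True
    have "bracket_part (comp q \<omega>) cs x = bracket_part \<omega> cs x"
      using True by (intro bracket_part_cong comp_form w cB) (simp add: comp_frame[OF w])
    then show ?thesis
      using True by (simp add: d0_frame comp_form w cs comp_frame[OF d0_form[OF w] cs])
  next
    case False
    have "bracket_part (comp q \<omega>) cs x = 0"
      using False by (intro bracket_part_zero comp_form w cB) (simp add: comp_frame[OF w])
    then show ?thesis
      using False by (simp add: d0_frame comp_form w cs comp_frame[OF d0_form[OF w] cs])
  qed
qed (simp_all add: d0_form comp_form w)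

lemma comp_eq_0_iff:
  assumes "\<omega> \<in> forms A"
  shows "comp q \<omega> = 0 \<longleftrightarrow> (\<forall>cs\<in>frames. lwt cs = q \<longrightarrow> (\<forall>x. \<omega> (map X cs) x = 0))"
proof
  assume "comp q \<omega> = 0"
  then show "\<forall>cs\<in>frames. lwt cs = q \<longrightarrow> (\<forall>x. \<omega> (map X cs) x = 0)"
    using comp_frame[OF assms] by (metis zero_fun_apply)
next
  assume "\<forall>cs\<in>frames. lwt cs = q \<longrightarrow> (\<forall>x. \<omega> (map X cs) x = 0)"
  then show "comp q \<omega> = 0"
    by (intro forms_frames_eqI) (auto simp: comp_form assms comp_frame)
qed

text \<open>At a tuple of weight at most \<open>q\<close>, derivative terms read coefficients of
  weight below \<open>q\<close>, which are zero. The bound on \<open>r\<close> is inclusive because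
  the case \<open>r = q\<close> describes the lowest component of the derivative.\<close>

lemma comp_d_low:
  assumes w: "\<omega> \<in> forms A" and low: "\<And>r. r < q \<Longrightarrow> comp r \<omega> = 0" and "r \<le> q"
  shows "comp r (ext_d A \<omega>) = d0 (comp r \<omega>)"
proof (rule forms_frames_eqI)
  fix cs x assume cs: "cs \<in> frames"
  show "comp r (ext_d A \<omega>) (map X cs) x = d0 (comp r \<omega>) (map X cs) x"
  proof (cases "lwt cs = r")
    case True
    have "ext_d A \<omega> (map X cs) x = bracket_part \<omega> cs x"
    proof (rule d_frame_low[OF w cs])
      fix bs x assume "bs \<in> frames" "lwt bs < lwt cs"
      then show "\<omega> (map X bs) x = 0"
        using low[of "lwt bs"] True \<open>r \<le> q\<close> by (simp add: comp_eq_0_iff[OF w])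
    qed
    then show ?thesis
      using True by (simp add: d0_comp w d0_form d0_frame cs comp_frame d_form)
  next
    case False
    then show ?thesis by (simp add: d0_comp w d0_form comp_frame cs d_form)
  qed
qed (simp_all add: d0_form comp_form w d_form)

lemma comp_diff: "\<omega> \<in> forms A \<Longrightarrow> \<eta> \<in> forms A \<Longrightarrow> comp q (\<omega> - \<eta>) = comp q \<omega> - comp q \<eta>"
  by (rule forms_frames_eqI) (auto simp: comp_form comp_frame)

lemma comp_zero: "comp q 0 = 0"
  by (rule forms_frames_eqI) (auto simp: comp_form comp_frame)

lemma forms_comp_eqI:
  assumes "\<omega> \<in> forms A" "\<eta> \<in> forms A" "\<And>q. comp q \<omega> = comp q \<eta>"
  shows "\<omega> = \<eta>"
  using assms(1,2)
proof (rule forms_frames_eqI)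
  fix cs x assume cs: "cs \<in> frames"
  show "\<omega> (map X cs) x = \<eta> (map X cs) x"
    using comp_frame[OF assms(1) cs, of "lwt cs" x] comp_frame[OF assms(2) cs, of "lwt cs" x]
      assms(3)[of "lwt cs"] by simp
qed

text \<open>Membership in \<open>kforms A k\<close> becomes the fixed-point equation of a
  projection, so that degrees can be treated like weights, through commutation with
  \<open>d0\<close>.\<close>

definition deg :: "nat \<Rightarrow> 'g form \<Rightarrow> 'g form"
  where "deg k \<omega> = (\<lambda>Ys. if length Ys = k then \<omega> Ys else 0)"

lemma deg_form:
  assumes "\<omega> \<in> forms A"
  shows "deg k \<omega> \<in> forms A"
proof -
  have af: "alt_form \<omega>" by (rule form_alt[OF assms])
  have "alt_form (deg k \<omega>)"
  proof (rule alt_formI)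
    fix as bs Y Z assume *: "Y \<in> VF" "Z \<in> VF" "VFs as" "VFs bs"
    show "deg k \<omega> (as @ (Y + Z) # bs) = deg k \<omega> (as @ Y # bs) + deg k \<omega> (as @ Z # bs)"
      using af_add[OF af *] by (cases "length as + length bs + 1 = k") (auto simp: deg_def simp del: pointwise)
  next
    fix as bs Y h assume *: "Y \<in> VF" "h \<in> SF" "VFs as" "VFs bs"
    show "deg k \<omega> (as @ vf_smult h Y # bs) = h * deg k \<omega> (as @ Y # bs)"
      using af_smult[OF af *] by (cases "length as + length bs + 1 = k") (auto simp: deg_def simp del: pointwise)
  qed (use af_smooth[OF af] af_adj[OF af] in \<open>auto simp: deg_def\<close>)
  then show ?thesis using form_out[OF assms] by (auto simp: forms_iff deg_def)
qed

lemma deg_frame: "deg k \<omega> (map X cs) x = (if length cs = k then \<omega> (map X cs) x else 0)"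
  by (simp add: deg_def)

lemma kforms_iff_deg: "\<omega> \<in> kforms A k \<longleftrightarrow> \<omega> \<in> forms A \<and> deg k \<omega> = \<omega>"
  by (auto simp: kforms_def deg_def fun_eq_iff)

lemma d0_deg:
  assumes w: "\<omega> \<in> forms A"
  shows "d0 (deg k \<omega>) = deg (Suc k) (d0 \<omega>)"
proof (rule forms_frames_eqI)
  fix cs x assume cs: "cs \<in> frames"
  \<comment> \<open>Two entries are omitted and one bracket is prepended, so the form is evaluated
    on one argument fewer than \<open>cs\<close> has.\<close>
  have len: "length (nths cs (- {i, j})) = length cs - 2" if "i < j" "j < length cs" for i j
  proof -
    have "{k. k < length cs \<and> k \<in> - {i, j}} = {..<length cs} - {i, j}" by auto
    then show ?thesis using that by (simp add: length_nths card_Diff_subset)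
  qed
  have "bracket_part (deg k \<omega>) cs x = (if length cs = Suc k then bracket_part \<omega> cs x else 0)"
  proof -
    have "deg k \<omega> (br (X (cs ! i)) (X (cs ! j)) # map X (nths cs (- {i, j}))) x =
        (if length cs = Suc k then \<omega> (br (X (cs ! i)) (X (cs ! j)) # map X (nths cs (- {i, j}))) x else 0)"
      if "i < j" "j < length cs" for i j
      using len[OF that] that by (auto simp: deg_def)
    then show ?thesis unfolding bracket_part_def by (auto intro!: sum.neutral)
  qed
  then show "d0 (deg k \<omega>) (map X cs) x = deg (Suc k) (d0 \<omega>) (map X cs) x"
    by (simp add: d0_frame deg_form w cs deg_frame)
qed (simp_all add: d0_form deg_form w)

lemma d0_kform: "\<omega> \<in> kforms A k \<Longrightarrow> d0 \<omega> \<in> kforms A (Suc k)"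
  using d0_deg[of \<omega> k] by (simp add: kforms_iff_deg d0_form)

lemma comp_deg: "\<omega> \<in> forms A \<Longrightarrow> deg k (comp q \<omega>) = comp q (deg k \<omega>)"
  by (rule forms_frames_eqI) (auto simp: comp_form deg_form comp_frame deg_frame)

lemma comp_kform: "\<omega> \<in> kforms A k \<Longrightarrow> comp q \<omega> \<in> kforms A k"
  by (simp add: kforms_iff_deg comp_form comp_deg)

end

section \<open>The scalar product of forms\<close>

context adapted_basis
begin

text \<open>Change of orthonormal basis in a single argument, for the passage from
  \<open>Basis\<close> to \<open>B\<close>.\<close>

lemma parseval:
  fixes f g :: "'v \<Rightarrow> real"
  assumes f: "linear f" and g: "linear g"
  shows "(\<Sum>e\<in>Basis. f e * g e) = (\<Sum>b\<in>B. f b * g b)"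
proof -
  have fe: "f e = (\<Sum>b\<in>B. (e \<bullet> b) * f b)" for e
  proof -
    have "f (\<Sum>b\<in>B. (e \<bullet> b) *\<^sub>R b) = (\<Sum>b\<in>B. (e \<bullet> b) * f b)"
      by (simp add: linear_sum[OF f] linear_scale[OF f])
    then show ?thesis using B_expand[of e] by simp
  qed
  have ge: "g b = (\<Sum>e\<in>Basis. (b \<bullet> e) * g e)" for b
  proof -
    have "g (\<Sum>e\<in>Basis. (b \<bullet> e) *\<^sub>R e) = (\<Sum>e\<in>Basis. (b \<bullet> e) * g e)"
      by (simp add: linear_sum[OF g] linear_scale[OF g])
    then show ?thesis by (simp add: euclidean_representation)
  qed
  have "(\<Sum>e\<in>Basis. f e * g e) = (\<Sum>e\<in>Basis. \<Sum>b\<in>B. f b * ((b \<bullet> e) * g e))"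
    by (subst fe) (simp add: sum_distrib_left sum_distrib_right inner_commute mult_ac)
  also have "\<dots> = (\<Sum>b\<in>B. f b * (\<Sum>e\<in>Basis. (b \<bullet> e) * g e))"
    by (subst sum.swap) (simp add: sum_distrib_left)
  finally show ?thesis by (simp add: ge[symmetric])
qed

text \<open>Repetitions are allowed, unlike in \<open>frames\<close>, so that a sum over tuples
  splits off its first slot.\<close>

definition tuples :: "'v set \<Rightarrow> nat \<Rightarrow> 'v list set"
  where "tuples C n = {es. set es \<subseteq> C \<and> length es = n}"

definition tuple_inner :: "'v set \<Rightarrow> nat \<Rightarrow> 'g form \<Rightarrow> 'g form \<Rightarrow> 'g \<Rightarrow> real"
  where "tuple_inner C n \<alpha> \<beta> x = (\<Sum>es\<in>tuples C n. \<alpha> (map X es) x * \<beta> (map X es) x)"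

lemma sum_tuples_Suc:
  "(\<Sum>es\<in>tuples C (Suc n). F es) = (\<Sum>e\<in>C. \<Sum>es\<in>tuples C n. F (e # es))" for F :: "'v list \<Rightarrow> real"
proof -
  have "tuples C (Suc n) = (\<lambda>(e, es). e # es) ` (C \<times> tuples C n)"
    by (auto simp: tuples_def length_Suc_conv image_iff)
  then have "(\<Sum>es\<in>tuples C (Suc n). F es) = (\<Sum>(e, es)\<in>C \<times> tuples C n. F (e # es))"
    by (simp add: sum.reindex inj_on_def case_prod_unfold)
  then show ?thesis by (simp add: sum.cartesian_product)
qed

lemma linear_first_slot:
  assumes "alt_form \<alpha>"
  shows "linear (\<lambda>v. \<alpha> (X v # map X es) x)"
proof (rule linearI)
  have vf: "VFs (map X es)" by auto
  fix u v and c :: real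
  have "\<alpha> (X (u + v) # map X es) = \<alpha> (X u # map X es) + \<alpha> (X v # map X es)"
    unfolding X_add using af_add[OF assms X_VF X_VF _ vf, of "[]" u v]
    by (simp only: append_Nil list.set empty_subsetI)
  then show "\<alpha> (X (u + v) # map X es) x = \<alpha> (X u # map X es) x + \<alpha> (X v # map X es) x"
    by (metis plus_fun_apply)
  have "\<alpha> (X (c *\<^sub>R v) # map X es) = (\<lambda>x. c) * \<alpha> (X v # map X es)"
    unfolding X_scale using af_smult[OF assms X_VF SF_const _ vf, of "[]" c v]
    by (simp only: append_Nil list.set empty_subsetI)
  then show "\<alpha> (X (c *\<^sub>R v) # map X es) x = c *\<^sub>R \<alpha> (X v # map X es) x"
    by (metis times_fun_apply real_scaleR_def)
qed

text \<open>For a fixed first entry the induction hypothesis for the contracted forms changes the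
  other slots; \<open>parseval\<close> then changes the first.\<close>

lemma tuple_inner_basis:
  assumes "alt_form \<alpha>" "alt_form \<beta>"
  shows "tuple_inner Basis n \<alpha> \<beta> x = tuple_inner B n \<alpha> \<beta> x"
  using assms
proof (induction n arbitrary: \<alpha> \<beta>)
  case 0
  have "tuples C 0 = {[]}" for C by (auto simp: tuples_def)
  then show ?case by (simp add: tuple_inner_def)
next
  case (Suc n)
  have IH: "(\<Sum>es\<in>tuples Basis n. \<alpha> (X e # map X es) x * \<beta> (X e # map X es) x) =
      (\<Sum>es\<in>tuples B n. \<alpha> (X e # map X es) x * \<beta> (X e # map X es) x)" for e
    using Suc.IH[OF af_iota[OF Suc.prems(1) X_VF[of e]] af_iota[OF Suc.prems(2) X_VF[of e]]]
    unfolding tuple_inner_def iota_app .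
  have "tuple_inner Basis (Suc n) \<alpha> \<beta> x =
      (\<Sum>e\<in>Basis. \<Sum>es\<in>tuples B n. \<alpha> (X e # map X es) x * \<beta> (X e # map X es) x)"
    unfolding tuple_inner_def sum_tuples_Suc list.map IH ..
  also have "\<dots> = (\<Sum>es\<in>tuples B n. \<Sum>e\<in>Basis. \<alpha> (X e # map X es) x * \<beta> (X e # map X es) x)"
    by (rule sum.swap)
  also have "\<dots> = (\<Sum>es\<in>tuples B n. \<Sum>b\<in>B. \<alpha> (X b # map X es) x * \<beta> (X b # map X es) x)"
    by (intro sum.cong refl parseval linear_first_slot Suc.prems)
  also have "\<dots> = (\<Sum>b\<in>B. \<Sum>es\<in>tuples B n. \<alpha> (X b # map X es) x * \<beta> (X b # map X es) x)"
    by (rule sum.swap)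
  finally show ?case unfolding tuple_inner_def sum_tuples_Suc list.map .
qed

text \<open>An alternating form vanishes on tuples with a repeated entry, so adding these tuples
  does not change the sum.\<close>

lemma sum_distinct_tuples:
  assumes "\<alpha> \<in> forms A" "finite C" "card C \<le> M"
  shows "(\<Sum>es | distinct es \<and> set es \<subseteq> C. \<alpha> (map X es) x * \<beta> (map X es) x / fact (length es)) =
    (\<Sum>n\<le>M. tuple_inner C n \<alpha> \<beta> x / fact n)"
proof -
  let ?t = "\<lambda>es. \<alpha> (map X es) x * \<beta> (map X es) x / fact (length es)"
  have fin: "finite (tuples C n)" for n
    unfolding tuples_def by (rule finite_lists_length_eq[OF assms(2)])
  have "(\<Sum>n\<le>M. tuple_inner C n \<alpha> \<beta> x / fact n) = (\<Sum>n\<le>M. \<Sum>es\<in>tuples C n. ?t es)"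
    unfolding tuple_inner_def sum_divide_distrib by (intro sum.cong) (auto simp: tuples_def)
  also have "\<dots> = (\<Sum>es\<in>(\<Union>n\<in>{..M}. tuples C n). ?t es)"
    by (intro sum.UNION_disjoint[symmetric]) (auto simp: fin, auto simp: tuples_def)
  also have "\<dots> = (\<Sum>es | distinct es \<and> set es \<subseteq> C. ?t es)"
  proof (rule sum.mono_neutral_right)
    show "finite (\<Union>n\<in>{..M}. tuples C n)" using fin by auto
    show "{es. distinct es \<and> set es \<subseteq> C} \<subseteq> (\<Union>n\<in>{..M}. tuples C n)"
    proof
      fix es assume "es \<in> {es. distinct es \<and> set es \<subseteq> C}"
      then have "length es \<le> M" "set es \<subseteq> C"
        using card_mono[OF assms(2), of "set es"] assms(3) by (auto simp: distinct_card)
      then show "es \<in> (\<Union>n\<in>{..M}. tuples C n)" by (auto simp: tuples_def)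
    qed
    show "\<forall>es\<in>(\<Union>n\<in>{..M}. tuples C n) - {es. distinct es \<and> set es \<subseteq> C}. ?t es = 0"
    proof
      fix es assume "es \<in> (\<Union>n\<in>{..M}. tuples C n) - {es. distinct es \<and> set es \<subseteq> C}"
      then have "\<not> distinct (map X es)" by (auto simp: tuples_def distinct_map)
      moreover have "VFs (map X es)" by auto
      ultimately show "?t es = 0" using form_not_distinct[OF assms(1)] by simp
    qed
  qed
  finally show ?thesis by simp
qed

lemma inner_frames:
  assumes "\<alpha> \<in> forms A" "\<beta> \<in> forms A"
  shows "form_inner \<alpha> \<beta> x =
    (\<Sum>bs\<in>frames. \<alpha> (map X bs) x * \<beta> (map X bs) x / fact (length bs))"
proof -
  \<comment> \<open>A common bound for both bases makes the two sums run over the same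
    degrees.\<close>
  let ?M = "max (card B) (card (Basis :: 'v set))"
  have "form_inner \<alpha> \<beta> x = (\<Sum>n\<le>?M. tuple_inner Basis n \<alpha> \<beta> x / fact n)"
    unfolding form_inner_def by (rule sum_distinct_tuples[OF assms(1)]) auto
  also have "\<dots> = (\<Sum>n\<le>?M. tuple_inner B n \<alpha> \<beta> x / fact n)"
    using assms by (simp add: tuple_inner_basis form_alt)
  also have "\<dots> = (\<Sum>bs\<in>frames. \<alpha> (map X bs) x * \<beta> (map X bs) x / fact (length bs))"
    unfolding frames_def by (rule sum_distinct_tuples[OF assms(1) finite_B, symmetric]) simp
  finally show ?thesis .
qed

lemma inner_commute_forms: "form_inner \<alpha> \<beta> x = form_inner \<beta> \<alpha> x"
  by (simp add: form_inner_def mult.commute)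

lemma inner_add: "form_inner (\<alpha> + \<alpha>') \<beta> x = form_inner \<alpha> \<beta> x + form_inner \<alpha>' \<beta> x"
  by (simp add: form_inner_def sum.distrib distrib_right add_divide_distrib)

lemma inner_diff: "form_inner (\<alpha> - \<alpha>') \<beta> x = form_inner \<alpha> \<beta> x - form_inner \<alpha>' \<beta> x"
  by (simp add: form_inner_def sum_subtractf left_diff_distrib diff_divide_distrib)

lemma inner_zero: "form_inner 0 \<beta> x = 0"
  by (simp add: form_inner_def)

lemma inner_fun_mult: "form_inner (fun_mult_form h \<alpha>) \<beta> x = h x * form_inner \<alpha> \<beta> x"
  by (simp add: form_inner_def fun_mult_form_app sum_distrib_left mult.assoc)

lemma inner_lincomb:
  assumes "\<And>Ys. \<alpha> Ys x = (\<Sum>i\<in>I. c i * \<epsilon> i Ys x)"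
  shows "form_inner \<alpha> \<beta> x = (\<Sum>i\<in>I. c i * form_inner (\<epsilon> i) \<beta> x)"
  unfolding form_inner_def assms
  by (simp add: sum_distrib_left sum_distrib_right sum_divide_distrib mult.assoc)
    (rule sum.swap)

lemma inner_SF:
  assumes "\<alpha> \<in> forms A" "\<beta> \<in> forms A"
  shows "form_inner \<alpha> \<beta> \<in> SF"
proof -
  have "form_inner \<alpha> \<beta> = (\<Sum>bs\<in>frames. (\<lambda>x. 1 / fact (length bs)) * (\<alpha> (map X bs) * \<beta> (map X bs)))"
  proof
    fix x
    show "form_inner \<alpha> \<beta> x = (\<Sum>bs\<in>frames. (\<lambda>x. 1 / fact (length bs)) * (\<alpha> (map X bs) * \<beta> (map X bs))) x"
      unfolding inner_frames[OF assms] sum_apply_fun times_fun_apply by simp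
  qed
  also have "\<dots> \<in> SF"
    using assms by (intro SF_sum SF_mult SF_const form_smooth)
  finally show ?thesis .
qed

lemma inner_nonneg: "\<alpha> \<in> forms A \<Longrightarrow> form_inner \<alpha> \<alpha> x \<ge> 0"
  by (simp add: inner_frames sum_nonneg)

lemma inner_definite:
  assumes "\<alpha> \<in> forms A" "\<And>x. form_inner \<alpha> \<alpha> x = 0"
  shows "\<alpha> = 0"
proof (rule forms_frames_eqI[OF assms(1) forms_zero])
  fix cs x assume cs: "cs \<in> frames"
  have "(\<Sum>bs\<in>frames. \<alpha> (map X bs) x * \<alpha> (map X bs) x / fact (length bs)) = 0"
    using assms(2)[of x] inner_frames[OF assms(1,1)] by simp
  then have "\<alpha> (map X cs) x * \<alpha> (map X cs) x / fact (length cs) = 0"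
    using cs finite_frames by (subst (asm) sum_nonneg_eq_0_iff) auto
  then show "\<alpha> (map X cs) x = (0 :: 'g form) (map X cs) x" by simp
qed

lemma inner_nondegenerate:
  assumes "\<alpha> \<in> forms A" "\<beta> \<in> forms A"
    "\<And>\<gamma> x. \<gamma> \<in> forms A \<Longrightarrow> form_inner \<gamma> \<alpha> x = form_inner \<gamma> \<beta> x"
  shows "\<alpha> = \<beta>"
proof -
  have "form_inner (\<alpha> - \<beta>) (\<alpha> - \<beta>) x = 0" for x
    using assms(3)[OF forms_diff[OF assms(1,2)], of x] inner_diff[of \<alpha> \<beta> "\<alpha> - \<beta>" x]
      inner_commute_forms[of \<alpha> "\<alpha> - \<beta>" x] inner_commute_forms[of \<beta> "\<alpha> - \<beta>" x]
    by linarith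
  then have "\<alpha> - \<beta> = 0" by (intro inner_definite forms_diff assms(1,2))
  then show ?thesis by simp
qed

text \<open>Weight projections are diagonal in the frame of the adapted basis, hence
  self-adjoint.\<close>

lemma inner_comp:
  assumes "\<alpha> \<in> forms A" "\<beta> \<in> forms A"
  shows "form_inner (comp q \<alpha>) \<beta> x = form_inner \<alpha> (comp q \<beta>) x"
  unfolding inner_frames[OF comp_form[OF assms(1)] assms(2)] inner_frames[OF assms(1) comp_form[OF assms(2)]]
  by (intro sum.cong) (auto simp: comp_frame assms)

lemma inner_deg: "form_inner (deg k \<alpha>) \<beta> x = form_inner \<alpha> (deg k \<beta>) x"
  unfolding form_inner_def by (intro sum.cong) (auto simp: deg_frame)

section \<open>Orthonormal frames of forms with constant coefficients\<close>

text \<open>Scalar products of two such forms are constants (\<open>const_form_inner\<close>), which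
  is what normalisation in \<open>gram_schmidt\<close> relies on.\<close>

definition const_form :: "'g form \<Rightarrow> bool"
  where "const_form \<alpha> \<longleftrightarrow> (\<forall>cs\<in>frames. \<forall>x y. \<alpha> (map X cs) x = \<alpha> (map X cs) y)"

lemma const_form_frame:
  assumes "\<alpha> \<in> forms A" "const_form \<alpha>" "set cs \<subseteq> B"
  shows "\<alpha> (map X cs) x = \<alpha> (map X cs) y"
proof (cases "distinct cs")
  case False
  then have "\<not> distinct (map X cs)" by (simp add: distinct_map)
  moreover have "VFs (map X cs)" by auto
  ultimately show ?thesis using form_not_distinct[OF assms(1)] by metis
next
  case True
  then show ?thesis using assms by (auto simp: const_form_def frames_def)
qed

lemma const_form_inner:
  assumes "\<alpha> \<in> forms A" "\<beta> \<in> forms A" "const_form \<alpha>" "const_form \<beta>"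
  shows "form_inner \<alpha> \<beta> x = form_inner \<alpha> \<beta> y"
  unfolding inner_frames[OF assms(1,2)]
proof (rule sum.cong)
  fix bs assume "bs \<in> frames"
  then have "\<alpha> (map X bs) x = \<alpha> (map X bs) y" "\<beta> (map X bs) x = \<beta> (map X bs) y"
    using assms unfolding const_form_def by blast+
  then show "\<alpha> (map X bs) x * \<beta> (map X bs) x / fact (length bs) =
      \<alpha> (map X bs) y * \<beta> (map X bs) y / fact (length bs)" by simp
qed simp

lemma const_form_lincomb:
  assumes "\<And>Ys x. \<alpha> Ys x = (\<Sum>i\<in>I. c i x * \<epsilon> i Ys x)"
    and "\<And>i. i \<in> I \<Longrightarrow> const_form (\<epsilon> i)" "\<And>i x y. i \<in> I \<Longrightarrow> c i x = c i y"
  shows "const_form \<alpha>"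
  unfolding const_form_def assms(1)
proof (intro ballI allI sum.cong refl)
  fix cs x y i assume "cs \<in> frames" "i \<in> I"
  then have "c i x = c i y" "\<epsilon> i (map X cs) x = \<epsilon> i (map X cs) y"
    using assms(2,3) by (auto simp: const_form_def)
  then show "c i x * \<epsilon> i (map X cs) x = c i y * \<epsilon> i (map X cs) y" by simp
qed

lemma const_form_d0:
  assumes "\<alpha> \<in> forms A" "const_form \<alpha>"
  shows "const_form (d0 \<alpha>)"
  unfolding const_form_def
proof (intro ballI allI)
  fix cs x y assume cs: "cs \<in> frames"
  then have cB: "set cs \<subseteq> B" by (simp add: frames_def)
  obtain c where c: "\<And>\<omega> x. \<omega> \<in> forms A \<Longrightarrow> bracket_part \<omega> cs x =
    (\<Sum>j<length cs. \<Sum>i<j. (-1) ^ (i + j) * (\<Sum>b\<in>B. c i j b * \<omega> (map X (b # nths cs (- {i, j}))) x))"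
    by (rule bracket_part_expand[OF cB]) (rule that)
  have "\<alpha> (map X (b # nths cs (- {i, j}))) x = \<alpha> (map X (b # nths cs (- {i, j}))) y"
    if "b \<in> B" for b i j
    by (rule const_form_frame[OF assms]) (use that cB set_nths_subset[of cs] in auto)
  then show "d0 \<alpha> (map X cs) x = d0 \<alpha> (map X cs) y"
    unfolding d0_frame[OF assms(1) cs] c[OF assms(1)] by (intro sum.cong refl) auto
qed

lemma wedge_dual_form: "wedge (map dual bs) \<in> forms A"
  by (rule wedge_forms) (auto simp: dual_form)

lemma const_form_wedge_dual:
  assumes "set bs \<subseteq> B"
  shows "const_form (wedge (map dual bs))"
  unfolding const_form_def
proof (intro ballI allI)
  fix cs x y assume "cs \<in> frames"
  then have "set cs \<subseteq> B" by (simp add: frames_def)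
  then show "wedge (map dual bs) (map X cs) x = wedge (map dual bs) (map X cs) y"
    using wedge_dual_frame[OF assms] by (cases "length cs = length bs") (simp_all add: wedge_def)
qed

section \<open>Gram-Schmidt in modules over the smooth functions\<close>

definition orthonormal_set :: "'g form set \<Rightarrow> bool"
  where "orthonormal_set E \<longleftrightarrow> finite E \<and> (\<forall>\<epsilon>\<in>E. \<epsilon> \<in> forms A \<and> const_form \<epsilon>) \<and>
    (\<forall>\<epsilon>\<in>E. \<forall>\<eta>\<in>E. \<forall>x. form_inner \<epsilon> \<eta> x = (if \<epsilon> = \<eta> then 1 else 0))"

text \<open>The coefficients are functions, so a finite set of constant forms can expand all
  elements of a module over the smooth functions.\<close>

definition expands :: "'g form set \<Rightarrow> 'g form \<Rightarrow> bool"
  where "expands E \<omega> \<longleftrightarrow> (\<forall>Ys x. \<omega> Ys x = (\<Sum>\<epsilon>\<in>E. form_inner \<omega> \<epsilon> x * \<epsilon> Ys x))"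

definition submodule :: "'g form set \<Rightarrow> bool"
  where "submodule W \<longleftrightarrow> W \<subseteq> forms A \<and> 0 \<in> W \<and> (\<forall>\<omega>\<in>W. \<forall>\<eta>\<in>W. \<omega> + \<eta> \<in> W) \<and>
    (\<forall>\<omega>\<in>W. \<forall>h\<in>SF. fun_mult_form h \<omega> \<in> W)"

lemma submodule_lincomb:
  assumes W: "submodule W" and "\<And>i. i \<in> I \<Longrightarrow> \<epsilon> i \<in> W" "\<And>i. i \<in> I \<Longrightarrow> c i \<in> SF"
  shows "(\<Sum>i\<in>I. fun_mult_form (c i) (\<epsilon> i)) \<in> W"
  using assms(2,3)
proof (induction I rule: infinite_finite_induct)
  case (infinite I)
  then show ?case unfolding sum.infinite[OF infinite(1)] using W by (simp only: submodule_def)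
next
  case empty
  then show ?case unfolding sum.empty using W by (simp only: submodule_def)
next
  case (insert i I)
  then have "fun_mult_form (c i) (\<epsilon> i) \<in> W" "(\<Sum>i\<in>I. fun_mult_form (c i) (\<epsilon> i)) \<in> W"
    using W unfolding submodule_def by blast+
  then show ?case
    unfolding sum.insert[OF insert.hyps] using W unfolding submodule_def by blast
qed

lemma lincomb_app: "(\<Sum>i\<in>I. fun_mult_form (c i) (\<epsilon> i)) Ys x = (\<Sum>i\<in>I. c i x * \<epsilon> i Ys x)"
  by (simp add: sum_apply_fun fun_mult_form_app)

lemma submodule_diff:
  assumes W: "submodule W" and "\<omega> \<in> W" "\<eta> \<in> W"
  shows "\<omega> - \<eta> \<in> W"
proof -
  have "fun_mult_form (\<lambda>x. - 1) \<eta> \<in> W"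
    using assms SF_const[of "- 1"] unfolding submodule_def by blast
  then have "\<omega> + fun_mult_form (\<lambda>x. - 1) \<eta> \<in> W"
    using assms unfolding submodule_def by blast
  moreover have "\<omega> + fun_mult_form (\<lambda>x. - 1) \<eta> = \<omega> - \<eta>"
    by (simp add: fun_eq_iff fun_mult_form_app)
  ultimately show ?thesis by simp
qed

lemma expands_add: "expands E \<omega> \<Longrightarrow> expands E \<eta> \<Longrightarrow> expands E (\<omega> + \<eta>)"
  unfolding expands_def inner_add distrib_right sum.distrib by (simp add: plus_fun_apply)

lemma expands_fun_mult: "expands E \<omega> \<Longrightarrow> expands E (fun_mult_form h \<omega>)"
  unfolding expands_def inner_fun_mult mult.assoc sum_distrib_left[symmetric]
  by (simp add: fun_mult_form_app)

lemma expands_zero: "expands E 0"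
  by (simp add: expands_def inner_zero)

lemma expands_inner:
  assumes "expands E \<omega>"
  shows "form_inner \<omega> \<beta> x = (\<Sum>\<epsilon>\<in>E. form_inner \<omega> \<epsilon> x * form_inner \<epsilon> \<beta> x)"
  by (rule inner_lincomb) (use assms in \<open>simp add: expands_def\<close>)

text \<open>The coefficients \<open>form_inner g \<epsilon>\<close> are smooth, which keeps the new
  vector in \<open>W\<close>, and constant, which keeps it a constant form.\<close>

lemma gram_schmidt:
  assumes W: "submodule W" and "finite Gs" "\<And>g. g \<in> Gs \<Longrightarrow> g \<in> W \<and> const_form g"
  shows "\<exists>E. orthonormal_set E \<and> E \<subseteq> W \<and> (\<forall>g\<in>Gs. expands E g)"
  using assms(2,3)
proof (induction Gs rule: finite_induct)
  case empty
  show ?case by (rule exI[of _ "{}"]) (simp add: orthonormal_set_def)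
next
  case (insert g Gs)
  then obtain E where E: "orthonormal_set E" "E \<subseteq> W" "\<And>h. h \<in> Gs \<Longrightarrow> expands E h"
    by blast
  have finE: "finite E" and on: "\<And>\<epsilon> \<eta> x. \<epsilon> \<in> E \<Longrightarrow> \<eta> \<in> E \<Longrightarrow> form_inner \<epsilon> \<eta> x = (if \<epsilon> = \<eta> then 1 else 0)"
    and Ef: "\<And>\<epsilon>. \<epsilon> \<in> E \<Longrightarrow> \<epsilon> \<in> forms A" "\<And>\<epsilon>. \<epsilon> \<in> E \<Longrightarrow> const_form \<epsilon>"
    using E(1) by (auto simp: orthonormal_set_def)
  have g: "g \<in> W" "const_form g" using insert.prems by auto
  then have gf: "g \<in> forms A" using W by (auto simp: submodule_def)
  define S where "S = (\<Sum>\<epsilon>\<in>E. fun_mult_form (form_inner g \<epsilon>) \<epsilon>)"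
  define u where "u = g - S"
  have S: "S Ys x = (\<Sum>\<epsilon>\<in>E. form_inner g \<epsilon> x * \<epsilon> Ys x)" for Ys x
    unfolding S_def by (rule lincomb_app)
  have SW: "S \<in> W"
    unfolding S_def using E(2) gf Ef by (intro submodule_lincomb[OF W] inner_SF) auto
  have Sf: "S \<in> forms A" using SW W by (auto simp: submodule_def)
  have cS: "const_form S"
    by (rule const_form_lincomb[OF S]) (use Ef gf g const_form_inner in auto)
  have uW: "u \<in> W" unfolding u_def by (rule submodule_diff[OF W g(1) SW])
  have uf: "u \<in> forms A" using uW W by (auto simp: submodule_def)
  have cu: "const_form u"
    using g(2) cS unfolding const_form_def u_def minus_apply by metis
  have Si: "form_inner S \<beta> x = (\<Sum>\<epsilon>\<in>E. form_inner g \<epsilon> x * form_inner \<epsilon> \<beta> x)" for \<beta> x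
    by (rule inner_lincomb) (rule S)
  have orth: "form_inner u \<eta> x = 0" if "\<eta> \<in> E" for \<eta> x
  proof -
    have "form_inner S \<eta> x = (\<Sum>\<epsilon>\<in>E. if \<epsilon> = \<eta> then form_inner g \<epsilon> x else 0)"
      unfolding Si using that by (intro sum.cong) (auto simp: on)
    then show ?thesis
      unfolding u_def inner_diff using finE that by simp
  qed
  show ?case
  proof (cases "u = 0")
    case True
    then have "g = S" unfolding u_def by simp
    then have "expands E g" using S by (simp add: expands_def)
    then show ?thesis using E by blast
  next
    case False
    then obtain x0 where "form_inner u u x0 \<noteq> 0" using inner_definite[OF uf] by blast
    \<comment> \<open>The point \<open>x0\<close> only witnesses that the norm is nonzero; its value
      is the same at every point, since \<open>u\<close> has constant coefficients.\<close>
    define r where "r = form_inner u u x0"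
    have r: "r > 0" "form_inner u u x = r" for x
      using \<open>form_inner u u x0 \<noteq> 0\<close> inner_nonneg[OF uf, of x0] const_form_inner[OF uf uf cu cu]
      by (auto simp: r_def)
    define c where "c = 1 / sqrt r"
    have c: "c * c * r = 1" using r(1) by (simp add: c_def field_simps)
    define e where "e = fun_mult_form (\<lambda>x. c) u"
    have e_app: "e Ys x = c * u Ys x" for Ys x by (simp add: e_def fun_mult_form_app)
    have eW: "e \<in> W" using uW W unfolding e_def submodule_def by blast
    have ef: "e \<in> forms A" using eW W by (auto simp: submodule_def)
    have ce: "const_form e" using cu unfolding const_form_def e_app by metis
    have ei: "form_inner e \<beta> x = c * form_inner u \<beta> x" for \<beta> x
      by (simp add: e_def inner_fun_mult)
    have ee: "form_inner e e x = 1" for x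
      using c r(2)[of x] by (simp add: ei inner_commute_forms[of u e] mult.assoc)
    have eE: "form_inner e \<eta> x = 0" "form_inner \<eta> e x = 0" if "\<eta> \<in> E" for \<eta> x
      using orth[OF that] ei inner_commute_forms by (metis mult_zero_right)+
    have eN: "e \<notin> E" using ee eE(1) by (metis zero_neq_one)
    \<comment> \<open>Forms already expanded by \<open>E\<close> are orthogonal to \<open>e\<close>,
      so the new term of their expansion is 0.\<close>
    have exp: "expands (insert e E) \<omega>" if "expands E \<omega>" for \<omega>
    proof -
      have "form_inner \<omega> e x = 0" for x
        by (rule trans[OF expands_inner[OF that]]) (intro sum.neutral ballI, simp add: eE)
      then show ?thesis using that finE eN by (simp add: expands_def)
    qed
    have "expands (insert e E) g"
      unfolding expands_def
    proof (intro allI)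
      fix Ys x
      have gu: "g = u + S" unfolding u_def by simp
      have "form_inner S u x = 0"
        unfolding Si by (intro sum.neutral) (simp add: inner_commute_forms[of _ u] orth)
      then have "form_inner g u x = r"
        by (subst gu) (simp only: inner_add r(2) add_0_right)
      then have "form_inner g e x = c * r"
        by (simp add: inner_commute_forms[of g e] ei inner_commute_forms[of u g])
      then have "form_inner g e x * e Ys x = c * c * r * u Ys x" by (simp add: e_app)
      then have "form_inner g e x * e Ys x = u Ys x" using c by simp
      moreover have "g Ys x = u Ys x + S Ys x" unfolding u_def by simp
      ultimately show "g Ys x = (\<Sum>\<epsilon>\<in>insert e E. form_inner g \<epsilon> x * \<epsilon> Ys x)"
        using finE eN S by simp
    qed
    moreover have "orthonormal_set (insert e E)"
      unfolding orthonormal_set_def using finE ef ce Ef ee eE on eN by auto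
    ultimately show ?thesis using E exp eW by (intro exI[of _ "insert e E"]) auto
  qed
qed

definition smooth_linear :: "('g form \<Rightarrow> 'g form) \<Rightarrow> bool"
  where "smooth_linear F \<longleftrightarrow> (\<forall>\<omega>\<in>forms A. F \<omega> \<in> forms A) \<and>
    (\<forall>\<omega>\<in>forms A. \<forall>\<eta>\<in>forms A. F (\<omega> + \<eta>) = F \<omega> + F \<eta>) \<and>
    (\<forall>\<omega>\<in>forms A. \<forall>h\<in>SF. F (fun_mult_form h \<omega>) = fun_mult_form h (F \<omega>))"

lemma smooth_linear_zero:
  assumes "smooth_linear F"
  shows "F 0 = 0"
proof -
  have "F (0 + 0) = F 0 + F 0" using assms forms_zero unfolding smooth_linear_def by blast
  then show ?thesis by simp
qed

lemma smooth_linear_lincomb: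
  assumes F: "smooth_linear F" and "\<And>i. i \<in> I \<Longrightarrow> \<epsilon> i \<in> forms A" "\<And>i. i \<in> I \<Longrightarrow> c i \<in> SF"
  shows "F (\<Sum>i\<in>I. fun_mult_form (c i) (\<epsilon> i)) = (\<Sum>i\<in>I. fun_mult_form (c i) (F (\<epsilon> i)))"
  using assms(2,3)
proof (induction I rule: infinite_finite_induct)
  case (infinite I)
  show ?case unfolding sum.infinite[OF infinite(1)] by (rule smooth_linear_zero[OF F])
next
  case empty
  show ?case unfolding sum.empty by (rule smooth_linear_zero[OF F])
next
  case (insert i I)
  have a: "fun_mult_form (c i) (\<epsilon> i) \<in> forms A" "(\<Sum>i\<in>I. fun_mult_form (c i) (\<epsilon> i)) \<in> forms A"
    using insert.prems by (auto intro!: forms_sum)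
  have IH: "F (\<Sum>i\<in>I. fun_mult_form (c i) (\<epsilon> i)) = (\<Sum>i\<in>I. fun_mult_form (c i) (F (\<epsilon> i)))"
    using insert by blast
  have 1: "F (fun_mult_form (c i) (\<epsilon> i) + (\<Sum>i\<in>I. fun_mult_form (c i) (\<epsilon> i))) =
      F (fun_mult_form (c i) (\<epsilon> i)) + F (\<Sum>i\<in>I. fun_mult_form (c i) (\<epsilon> i))"
    using F a unfolding smooth_linear_def by blast
  have 2: "F (fun_mult_form (c i) (\<epsilon> i)) = fun_mult_form (c i) (F (\<epsilon> i))"
    using F insert.prems unfolding smooth_linear_def by blast
  show ?case unfolding sum.insert[OF insert.hyps] 1 2 IH ..
qed

lemma form_eq_lincomb:
  assumes "\<omega> \<in> forms A"
  shows "\<omega> = (\<Sum>bs\<in>frames. fun_mult_form (\<lambda>x. \<omega> (map X bs) x / fact (length bs)) (wedge (map dual bs)))"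
proof -
  have "form_of (\<lambda>bs. \<omega> (map X bs)) = \<omega>"
    using assms by (intro forms_frames_eqI form_of_form form_of_frame form_permute_frame)
      (auto intro: form_smooth)
  then show ?thesis by (simp add: form_of_def)
qed

lemma smooth_linear_range:
  assumes F: "smooth_linear F"
  shows "submodule (F ` forms A)"
  unfolding submodule_def
proof (intro conjI ballI)
  show "F ` forms A \<subseteq> forms A" using F by (auto simp: smooth_linear_def)
  show "0 \<in> F ` forms A" using smooth_linear_zero[OF F] forms_zero by (metis imageI)
next
  fix \<omega> \<eta> assume "\<omega> \<in> F ` forms A" "\<eta> \<in> F ` forms A"
  then obtain \<omega>' \<eta>' where *: "\<omega>' \<in> forms A" "\<eta>' \<in> forms A" "\<omega> = F \<omega>'" "\<eta> = F \<eta>'" by auto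
  then have "F (\<omega>' + \<eta>') = \<omega> + \<eta>" using F unfolding smooth_linear_def by blast
  then show "\<omega> + \<eta> \<in> F ` forms A" using forms_add[OF *(1,2)] by (metis imageI)
next
  fix \<omega> h assume "\<omega> \<in> F ` forms A" and h: "h \<in> SF"
  then obtain \<omega>' where *: "\<omega>' \<in> forms A" "\<omega> = F \<omega>'" by auto
  then have "F (fun_mult_form h \<omega>') = fun_mult_form h \<omega>" using F h unfolding smooth_linear_def by blast
  then show "fun_mult_form h \<omega> \<in> F ` forms A" using forms_fun_mult[OF *(1) h] by (metis imageI)
qed

text \<open>The wedge products of the coframe are constant and generate all forms over the smooth
  functions; their images under \<open>F\<close> do the same for the range.\<close>

lemma orthonormal_frame_of_range:
  assumes F: "smooth_linear F" and C: "\<And>\<omega>. \<omega> \<in> forms A \<Longrightarrow> const_form \<omega> \<Longrightarrow> const_form (F \<omega>)"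
  shows "\<exists>E. orthonormal_set E \<and> E \<subseteq> F ` forms A \<and> (\<forall>\<omega>\<in>forms A. expands E (F \<omega>))"
proof -
  let ?Gs = "(\<lambda>bs. F (wedge (map dual bs))) ` frames"
  have "\<exists>E. orthonormal_set E \<and> E \<subseteq> F ` forms A \<and> (\<forall>g\<in>?Gs. expands E g)"
  proof (rule gram_schmidt[OF smooth_linear_range[OF F]])
    show "finite ?Gs" using finite_frames by simp
    fix g assume "g \<in> ?Gs"
    then obtain bs where bs: "set bs \<subseteq> B" "g = F (wedge (map dual bs))"
      by (auto simp: frames_def)
    then show "g \<in> F ` forms A \<and> const_form g"
      using C[OF wedge_dual_form const_form_wedge_dual[OF bs(1)]] wedge_dual_form by blast
  qed
  then obtain E where E: "orthonormal_set E" "E \<subseteq> F ` forms A"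
    and exp: "\<And>bs. bs \<in> frames \<Longrightarrow> expands E (F (wedge (map dual bs)))" by auto
  have "expands E (F \<omega>)" if w: "\<omega> \<in> forms A" for \<omega>
  proof -
    let ?c = "\<lambda>bs x. \<omega> (map X bs) x / fact (length bs)"
    have "F \<omega> = (\<Sum>bs\<in>frames. fun_mult_form (?c bs) (F (wedge (map dual bs))))"
      using smooth_linear_lincomb[OF F, of frames "\<lambda>bs. wedge (map dual bs)" ?c]
        form_eq_lincomb[OF w] wedge_dual_form SF_divide[OF form_smooth[OF w]] by simp
    moreover have "expands E (\<Sum>bs\<in>I. fun_mult_form (?c bs) (F (wedge (map dual bs))))"
      if "finite I" "I \<subseteq> frames" for I
      using that
    proof (induction I rule: finite_induct)
      case empty
      show ?case unfolding sum.empty by (rule expands_zero)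
    next
      case (insert bs I)
      show ?case
        unfolding sum.insert[OF insert.hyps]
        by (intro expands_add expands_fun_mult exp) (use insert in auto)
    qed
    ultimately show ?thesis using finite_frames by simp
  qed
  then show ?thesis using E by blast
qed

end

section \<open>The adjoint and the partial inverse of the weight-zero part\<close>

context adapted_basis
begin

lemma smooth_linear_d0: "smooth_linear d0"
  by (simp add: smooth_linear_def d0_form d0_add d0_fun_mult)

lemma inner_right:
  "form_inner \<gamma> (\<alpha> + \<beta>) x = form_inner \<gamma> \<alpha> x + form_inner \<gamma> \<beta> x"
  "form_inner \<gamma> (\<alpha> - \<beta>) x = form_inner \<gamma> \<alpha> x - form_inner \<gamma> \<beta> x"
  "form_inner \<gamma> (fun_mult_form h \<alpha>) x = h x * form_inner \<gamma> \<alpha> x"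
  "form_inner \<gamma> 0 x = 0"
  by (simp_all only: inner_commute_forms[of \<gamma>] inner_add inner_diff inner_fun_mult inner_zero)

text \<open>In an orthonormal frame \<open>E\<close> of all forms the adjoint is given by its
  matrix. Preservation of constant forms is recorded so that projections onto the range of the
  adjoint can be formed too.\<close>

lemma adjoint_exists:
  "\<exists>D. (\<forall>\<beta>\<in>forms A. D \<beta> \<in> forms A) \<and> (\<forall>\<beta>\<in>forms A. const_form \<beta> \<longrightarrow> const_form (D \<beta>)) \<and>
    (\<forall>\<alpha>\<in>forms A. \<forall>\<beta>\<in>forms A. \<forall>x. form_inner (d0 \<alpha>) \<beta> x = form_inner \<alpha> (D \<beta>) x)"
proof -
  have "smooth_linear (\<lambda>\<omega>. \<omega>)" by (simp add: smooth_linear_def)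
  then obtain E where E: "orthonormal_set E" "\<And>\<omega>. \<omega> \<in> forms A \<Longrightarrow> expands E \<omega>"
    using orthonormal_frame_of_range[of "\<lambda>\<omega>. \<omega>"] by auto
  have Ef: "\<And>\<epsilon>. \<epsilon> \<in> E \<Longrightarrow> \<epsilon> \<in> forms A" "\<And>\<epsilon>. \<epsilon> \<in> E \<Longrightarrow> const_form \<epsilon>"
    using E(1) by (auto simp: orthonormal_set_def)
  define D where "D \<beta> = (\<Sum>\<epsilon>\<in>E. fun_mult_form (form_inner (d0 \<epsilon>) \<beta>) \<epsilon>)" for \<beta>
  have D: "D \<beta> Ys x = (\<Sum>\<epsilon>\<in>E. form_inner (d0 \<epsilon>) \<beta> x * \<epsilon> Ys x)" for \<beta> Ys x
    unfolding D_def by (rule lincomb_app)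
  have D1: "D \<beta> \<in> forms A" if "\<beta> \<in> forms A" for \<beta>
    unfolding D_def by (intro forms_sum forms_fun_mult inner_SF d0_form Ef that)
  have D2: "const_form (D \<beta>)" if "\<beta> \<in> forms A" "const_form \<beta>" for \<beta>
    by (rule const_form_lincomb[OF D]) (use that Ef const_form_inner d0_form const_form_d0 in auto)
  have D3: "form_inner (d0 \<alpha>) \<beta> x = form_inner \<alpha> (D \<beta>) x"
    if a: "\<alpha> \<in> forms A" and "\<beta> \<in> forms A" for \<alpha> \<beta> x
  proof -
    have "\<alpha> = (\<Sum>\<epsilon>\<in>E. fun_mult_form (form_inner \<alpha> \<epsilon>) \<epsilon>)"
      using E(2)[OF a] by (intro ext) (simp only: lincomb_app expands_def)
    then have "d0 \<alpha> = d0 (\<Sum>\<epsilon>\<in>E. fun_mult_form (form_inner \<alpha> \<epsilon>) \<epsilon>)" by (rule arg_cong)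
    also have "\<dots> = (\<Sum>\<epsilon>\<in>E. fun_mult_form (form_inner \<alpha> \<epsilon>) (d0 \<epsilon>))"
      by (intro smooth_linear_lincomb[OF smooth_linear_d0] inner_SF Ef a)
    finally have e: "d0 \<alpha> = (\<Sum>\<epsilon>\<in>E. fun_mult_form (form_inner \<alpha> \<epsilon>) (d0 \<epsilon>))" .
    have "d0 \<alpha> Ys x = (\<Sum>\<epsilon>\<in>E. form_inner \<alpha> \<epsilon> x * d0 \<epsilon> Ys x)" for Ys
      by (rule trans[OF fun_cong[OF fun_cong[OF e]] lincomb_app])
    then have "form_inner (d0 \<alpha>) \<beta> x = (\<Sum>\<epsilon>\<in>E. form_inner \<alpha> \<epsilon> x * form_inner (d0 \<epsilon>) \<beta> x)"
      by (rule inner_lincomb)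
    also have "\<dots> = (\<Sum>\<epsilon>\<in>E. form_inner (d0 \<epsilon>) \<beta> x * form_inner \<epsilon> \<alpha> x)"
      by (intro sum.cong refl) (simp only: inner_commute_forms[of \<alpha>] mult.commute)
    also have "\<dots> = form_inner (D \<beta>) \<alpha> x"
      by (rule inner_lincomb[OF D, symmetric])
    finally show ?thesis by (simp only: inner_commute_forms)
  qed
  show ?thesis
    by (intro exI[of _ D] conjI ballI impI allI) (rule D1 D2 D3; assumption)+
qed

lemma delta0:
  shows delta0_form: "\<beta> \<in> forms A \<Longrightarrow> delta0 \<beta> \<in> forms A"
    and const_form_delta0: "\<beta> \<in> forms A \<Longrightarrow> const_form \<beta> \<Longrightarrow> const_form (delta0 \<beta>)"
    and delta0_adjoint: "\<alpha> \<in> forms A \<Longrightarrow> \<beta> \<in> forms A \<Longrightarrow>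
      form_inner (d0 \<alpha>) \<beta> x = form_inner \<alpha> (delta0 \<beta>) x"
proof -
  obtain D where D: "\<And>\<beta>. \<beta> \<in> forms A \<Longrightarrow> D \<beta> \<in> forms A"
    "\<And>\<beta>. \<beta> \<in> forms A \<Longrightarrow> const_form \<beta> \<Longrightarrow> const_form (D \<beta>)"
    "\<And>\<alpha> \<beta> x. \<alpha> \<in> forms A \<Longrightarrow> \<beta> \<in> forms A \<Longrightarrow> form_inner (d0 \<alpha>) \<beta> x = form_inner \<alpha> (D \<beta>) x"
    using adjoint_exists by (elim exE conjE) (rule that; blast)
  have eq: "delta0 \<beta> = D \<beta>" if b: "\<beta> \<in> forms A" for \<beta>
    unfolding delta0_def
  proof (rule the_equality)
    show "D \<beta> \<in> forms A \<and> (\<forall>\<alpha>\<in>forms A. form_inner (d0 \<alpha>) \<beta> = form_inner \<alpha> (D \<beta>))"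
      using D b by (auto intro!: ext)
    fix \<gamma> assume g: "\<gamma> \<in> forms A \<and> (\<forall>\<alpha>\<in>forms A. form_inner (d0 \<alpha>) \<beta> = form_inner \<alpha> \<gamma>)"
    show "\<gamma> = D \<beta>"
    proof (rule inner_nondegenerate)
      fix \<alpha> x assume "\<alpha> \<in> forms A"
      then have "form_inner (d0 \<alpha>) \<beta> = form_inner \<alpha> \<gamma>" using g by blast
      from fun_cong[OF this, of x] show "form_inner \<alpha> \<gamma> x = form_inner \<alpha> (D \<beta>) x"
        using D(3)[OF \<open>\<alpha> \<in> forms A\<close> b, of x] by linarith
    qed (use g D b in auto)
  qed
  show "\<beta> \<in> forms A \<Longrightarrow> delta0 \<beta> \<in> forms A"
    "\<beta> \<in> forms A \<Longrightarrow> const_form \<beta> \<Longrightarrow> const_form (delta0 \<beta>)"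
    "\<alpha> \<in> forms A \<Longrightarrow> \<beta> \<in> forms A \<Longrightarrow> form_inner (d0 \<alpha>) \<beta> x = form_inner \<alpha> (delta0 \<beta>) x"
    using D eq by auto
qed

lemma delta0_eqI:
  assumes "\<beta> \<in> forms A" "\<gamma> \<in> forms A"
    "\<And>\<alpha> x. \<alpha> \<in> forms A \<Longrightarrow> form_inner (d0 \<alpha>) \<beta> x = form_inner \<alpha> \<gamma> x"
  shows "delta0 \<beta> = \<gamma>"
  using assms by (intro inner_nondegenerate delta0_form) (simp_all add: delta0_adjoint[symmetric])

lemma delta0_add: "\<alpha> \<in> forms A \<Longrightarrow> \<beta> \<in> forms A \<Longrightarrow> delta0 (\<alpha> + \<beta>) = delta0 \<alpha> + delta0 \<beta>"
  by (rule delta0_eqI) (auto simp only: inner_right delta0_adjoint intro!: forms_add delta0_form)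

lemma delta0_fun_mult:
  "\<alpha> \<in> forms A \<Longrightarrow> h \<in> SF \<Longrightarrow> delta0 (fun_mult_form h \<alpha>) = fun_mult_form h (delta0 \<alpha>)"
  by (rule delta0_eqI) (auto simp only: inner_right delta0_adjoint intro!: forms_fun_mult delta0_form)

lemma smooth_linear_delta0: "smooth_linear delta0"
  by (simp add: smooth_linear_def delta0_form delta0_add delta0_fun_mult)

lemma d0_zero: "d0 0 = 0"
  by (rule smooth_linear_zero[OF smooth_linear_d0])

text \<open>The projection is the part of \<beta> along an orthonormal frame of the range. It is
  applied to \<open>d0\<close> for \<open>proj_im_d0\<close> and to \<open>delta0\<close> in
  \<open>d0_range\<close>.\<close>

lemma orthogonal_projection:
  assumes F: "smooth_linear F" and C: "\<And>\<omega>. \<omega> \<in> forms A \<Longrightarrow> const_form \<omega> \<Longrightarrow> const_form (F \<omega>)"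
    and b: "\<beta> \<in> forms A"
  obtains \<pi> where "\<pi> \<in> F ` forms A" "\<And>\<eta> x. \<eta> \<in> F ` forms A \<Longrightarrow> form_inner (\<beta> - \<pi>) \<eta> x = 0"
proof -
  obtain E where E: "orthonormal_set E" "E \<subseteq> F ` forms A" "\<And>\<omega>. \<omega> \<in> forms A \<Longrightarrow> expands E (F \<omega>)"
    using orthonormal_frame_of_range[OF F C] by blast
  have Ef: "\<And>\<epsilon>. \<epsilon> \<in> E \<Longrightarrow> \<epsilon> \<in> forms A" "finite E"
    and on: "\<And>\<epsilon> \<eta> x. \<epsilon> \<in> E \<Longrightarrow> \<eta> \<in> E \<Longrightarrow> form_inner \<epsilon> \<eta> x = (if \<epsilon> = \<eta> then 1 else 0)"
    using E(1) by (auto simp: orthonormal_set_def)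
  define \<pi> where "\<pi> = (\<Sum>\<epsilon>\<in>E. fun_mult_form (form_inner \<beta> \<epsilon>) \<epsilon>)"
  have "\<pi> \<in> F ` forms A"
    unfolding \<pi>_def using E(2) Ef b by (intro submodule_lincomb[OF smooth_linear_range[OF F]] inner_SF) auto
  moreover have "form_inner (\<beta> - \<pi>) \<eta> x = 0" if "\<eta> \<in> F ` forms A" for \<eta> x
  proof -
    have o: "form_inner (\<beta> - \<pi>) \<epsilon> x = 0" if "\<epsilon> \<in> E" for \<epsilon>
    proof -
      have "form_inner \<pi> \<epsilon> x = (\<Sum>\<eta>\<in>E. form_inner \<beta> \<eta> x * form_inner \<eta> \<epsilon> x)"
        by (rule inner_lincomb) (simp only: \<pi>_def lincomb_app)
      also have "\<dots> = (\<Sum>\<eta>\<in>E. if \<eta> = \<epsilon> then form_inner \<beta> \<eta> x else 0)"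
        using that by (intro sum.cong) (auto simp: on)
      finally show ?thesis using Ef(2) that by (simp add: inner_diff)
    qed
    have "expands E \<eta>" using E(3) that by blast
    then have "form_inner \<eta> (\<beta> - \<pi>) x = (\<Sum>\<epsilon>\<in>E. form_inner \<eta> \<epsilon> x * form_inner \<epsilon> (\<beta> - \<pi>) x)"
      by (rule expands_inner)
    also have "\<dots> = 0"
      by (intro sum.neutral) (simp add: o inner_commute_forms[of _ "\<beta> - \<pi>"])
    finally show ?thesis by (simp only: inner_commute_forms)
  qed
  ultimately show ?thesis by (rule that)
qed

text \<open>Two candidates differ by an element of the range of \<open>d0\<close> that is orthogonal
  to this range, hence to itself.\<close>

lemma proj_im_d0_eqI:
  assumes b: "\<beta> \<in> forms A" and p: "\<pi> \<in> d0 ` forms A"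
    "\<And>\<eta> x. \<eta> \<in> forms A \<Longrightarrow> form_inner (\<beta> - \<pi>) (d0 \<eta>) x = 0"
  shows "proj_im_d0 \<beta> = \<pi>"
  unfolding proj_im_d0_def
proof (rule the_equality)
  show "\<pi> \<in> d0 ` forms A \<and> (\<forall>\<eta>\<in>d0 ` forms A. form_inner (\<beta> - \<pi>) \<eta> = 0)"
    using p by (auto simp: fun_eq_iff)
  fix \<pi>' assume p': "\<pi>' \<in> d0 ` forms A \<and> (\<forall>\<eta>\<in>d0 ` forms A. form_inner (\<beta> - \<pi>') \<eta> = 0)"
  have W: "submodule (d0 ` forms A)" by (rule smooth_linear_range[OF smooth_linear_d0])
  have m: "\<pi>' - \<pi> \<in> d0 ` forms A" using submodule_diff[OF W] p p' by blast
  have "form_inner (\<pi>' - \<pi>) (\<pi>' - \<pi>) x = 0" for x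
  proof -
    obtain \<eta> where e: "\<eta> \<in> forms A" "\<pi>' - \<pi> = d0 \<eta>" using m by (rule imageE)
    have "form_inner (\<beta> - \<pi>) (\<pi>' - \<pi>) x = 0" unfolding e(2) by (rule p(2)[OF e(1)])
    moreover have "form_inner (\<beta> - \<pi>') (\<pi>' - \<pi>) x = 0"
      by (rule trans[OF fun_cong[OF bspec[OF conjunct2[OF p'] m]] zero_fun_apply])
    ultimately show ?thesis unfolding inner_diff by linarith
  qed
  moreover have "\<pi>' - \<pi> \<in> forms A" using m W unfolding submodule_def by blast
  ultimately have "\<pi>' - \<pi> = 0" by (intro inner_definite)
  then show "\<pi>' = \<pi>" by simp
qed

lemma proj_im_d0:
  assumes b: "\<beta> \<in> forms A"
  shows proj_im_d0_range: "proj_im_d0 \<beta> \<in> d0 ` forms A"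
    and proj_im_d0_orth: "\<eta> \<in> forms A \<Longrightarrow> form_inner (\<beta> - proj_im_d0 \<beta>) (d0 \<eta>) x = 0"
proof -
  obtain \<pi> where p: "\<pi> \<in> d0 ` forms A" "\<And>\<eta> x. \<eta> \<in> d0 ` forms A \<Longrightarrow> form_inner (\<beta> - \<pi>) \<eta> x = 0"
    by (rule orthogonal_projection[OF smooth_linear_d0 const_form_d0 b])
      (assumption+, rule that)
  have "proj_im_d0 \<beta> = \<pi>" using p by (intro proj_im_d0_eqI[OF b]) auto
  then show "proj_im_d0 \<beta> \<in> d0 ` forms A"
    "\<eta> \<in> forms A \<Longrightarrow> form_inner (\<beta> - proj_im_d0 \<beta>) (d0 \<eta>) x = 0"
    using p by auto
qed

text \<open>An element of the range of \<open>delta0\<close> that \<open>d0\<close> kills is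
  orthogonal to itself.\<close>

lemma d0_inj_on: "inj_on d0 (delta0 ` forms A)"
proof (rule inj_onI)
  fix \<omega> \<eta> assume "\<omega> \<in> delta0 ` forms A" "\<eta> \<in> delta0 ` forms A" and eq: "d0 \<omega> = d0 \<eta>"
  then obtain \<gamma> where g: "\<gamma> \<in> forms A" "\<omega> - \<eta> = delta0 \<gamma>"
    using submodule_diff[OF smooth_linear_range[OF smooth_linear_delta0]] by blast
  have f: "\<omega> \<in> forms A" "\<eta> \<in> forms A"
    using \<open>\<omega> \<in> delta0 ` forms A\<close> \<open>\<eta> \<in> delta0 ` forms A\<close> delta0_form by auto
  have z: "d0 (\<omega> - \<eta>) = 0" using eq by (simp add: d0_diff f)
  have "form_inner (\<omega> - \<eta>) (delta0 \<gamma>) x = form_inner (d0 (\<omega> - \<eta>)) \<gamma> x" for x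
    by (rule delta0_adjoint[OF forms_diff[OF f] g(1), symmetric])
  then have "form_inner (\<omega> - \<eta>) (\<omega> - \<eta>) x = 0" for x
    unfolding g(2)[symmetric] z inner_zero .
  then have "\<omega> - \<eta> = 0" by (rule inner_definite[OF forms_diff[OF f]])
  then show "\<omega> = \<eta>" by simp
qed

text \<open>The part of \<alpha> orthogonal to the range of \<open>delta0\<close> is killed by
  \<open>d0\<close>, since its image is orthogonal to every form. So the part inside that range has
  the same image as \<alpha>.\<close>

lemma d0_range: "d0 ` forms A \<subseteq> d0 ` (delta0 ` forms A)"
proof
  fix \<beta> assume "\<beta> \<in> d0 ` forms A"
  then obtain \<alpha> where a: "\<alpha> \<in> forms A" "\<beta> = d0 \<alpha>" by auto
  obtain \<pi> where p: "\<pi> \<in> delta0 ` forms A"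
    "\<And>\<eta> x. \<eta> \<in> delta0 ` forms A \<Longrightarrow> form_inner (\<alpha> - \<pi>) \<eta> x = 0"
    by (rule orthogonal_projection[OF smooth_linear_delta0 const_form_delta0 a(1)])
      (assumption+, rule that)
  have pf: "\<pi> \<in> forms A" using p(1) delta0_form by auto
  have df: "d0 (\<alpha> - \<pi>) \<in> forms A" by (intro d0_form forms_diff a(1) pf)
  have o: "form_inner (d0 (\<alpha> - \<pi>)) \<gamma> x = 0" if "\<gamma> \<in> forms A" for \<gamma> x
    by (rule trans[OF delta0_adjoint[OF forms_diff[OF a(1) pf] that] p(2)[OF imageI[OF that]]])
  have "d0 (\<alpha> - \<pi>) = 0" by (rule inner_definite[OF df o[OF df]])
  then have "\<beta> = d0 \<pi>" by (simp add: d0_diff a pf)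
  then show "\<beta> \<in> d0 ` (delta0 ` forms A)" using p(1) by blast
qed

section \<open>The partial inverse and its compatibility with weights and degrees\<close>

lemma d0_inv:
  assumes "\<beta> \<in> forms A"
  shows d0_inv_range: "d0_inv \<beta> \<in> delta0 ` forms A" and d0_d0_inv: "d0 (d0_inv \<beta>) = proj_im_d0 \<beta>"
proof -
  have "proj_im_d0 \<beta> \<in> d0 ` (delta0 ` forms A)"
    using proj_im_d0_range[OF assms] d0_range by blast
  then show "d0_inv \<beta> \<in> delta0 ` forms A" "d0 (d0_inv \<beta>) = proj_im_d0 \<beta>"
    unfolding d0_inv_def
    by (rule the_inv_into_into[OF d0_inj_on _ subset_refl], rule f_the_inv_into_f[OF d0_inj_on])
qed

lemma d0_inv_eqI:
  assumes "\<beta> \<in> forms A" "\<gamma> \<in> delta0 ` forms A" "d0 \<gamma> = proj_im_d0 \<beta>"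
  shows "d0_inv \<beta> = \<gamma>"
  unfolding d0_inv_def assms(3)[symmetric] by (rule the_inv_into_f_f[OF d0_inj_on assms(2)])

lemma d0_inv_form:
  assumes "\<beta> \<in> forms A"
  shows "d0_inv \<beta> \<in> forms A"
proof -
  obtain \<gamma> where g: "d0_inv \<beta> = delta0 \<gamma>" "\<gamma> \<in> forms A"
    using d0_inv_range[OF assms] by (rule imageE)
  show ?thesis unfolding g(1) by (rule delta0_form[OF g(2)])
qed

lemma d0_inv_diff:
  assumes "\<alpha> \<in> forms A" "\<beta> \<in> forms A"
  shows "d0_inv (\<alpha> - \<beta>) = d0_inv \<alpha> - d0_inv \<beta>"
proof (rule d0_inv_eqI[OF forms_diff[OF assms]])
  show "d0_inv \<alpha> - d0_inv \<beta> \<in> delta0 ` forms A"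
    using d0_inv_range assms by (intro submodule_diff[OF smooth_linear_range[OF smooth_linear_delta0]])
  have "proj_im_d0 (\<alpha> - \<beta>) = proj_im_d0 \<alpha> - proj_im_d0 \<beta>"
  proof (rule proj_im_d0_eqI[OF forms_diff[OF assms]])
    show "proj_im_d0 \<alpha> - proj_im_d0 \<beta> \<in> d0 ` forms A"
      using proj_im_d0_range assms by (intro submodule_diff[OF smooth_linear_range[OF smooth_linear_d0]])
    fix \<eta> x assume e: "\<eta> \<in> forms A"
    show "form_inner (\<alpha> - \<beta> - (proj_im_d0 \<alpha> - proj_im_d0 \<beta>)) (d0 \<eta>) x = 0"
      using proj_im_d0_orth[OF assms(1) e, of x] proj_im_d0_orth[OF assms(2) e, of x]
      unfolding inner_diff by linarith
  qed
  then show "d0 (d0_inv \<alpha> - d0_inv \<beta>) = proj_im_d0 (\<alpha> - \<beta>)"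
    using assms by (simp add: d0_diff d0_inv_form d0_d0_inv)
qed

lemma d0_inv_zero: "d0_inv 0 = 0"
  using d0_inv_diff[OF forms_zero forms_zero] by simp

lemma d0_inv_orthogonal:
  assumes "\<beta> \<in> forms A" "\<And>\<eta> x. \<eta> \<in> forms A \<Longrightarrow> form_inner \<beta> (d0 \<eta>) x = 0"
  shows "d0_inv \<beta> = 0"
proof (rule d0_inv_eqI[OF assms(1)])
  show "0 \<in> delta0 ` forms A"
    using smooth_linear_range[OF smooth_linear_delta0] unfolding submodule_def by blast
  have "proj_im_d0 \<beta> = 0"
  proof (rule proj_im_d0_eqI[OF assms(1)])
    show "0 \<in> d0 ` forms A"
      using smooth_linear_range[OF smooth_linear_d0] unfolding submodule_def by blast
    show "form_inner (\<beta> - 0) (d0 \<eta>) x = 0" if "\<eta> \<in> forms A" for \<eta> x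
      unfolding diff_0_right using assms(2)[OF that] .
  qed
  then show "d0 0 = proj_im_d0 \<beta>" by (simp only: d0_zero)
qed

text \<open>Treats weights and degrees at once. There are two projections because \<open>d0\<close>
  raises the degree: for weights \<open>P\<close> and \<open>Q\<close> are both
  \<open>comp q\<close>, for degrees they are \<open>deg k\<close> and
  \<open>deg (Suc k)\<close>.\<close>

lemma
  assumes PQ: "\<And>\<omega>. \<omega> \<in> forms A \<Longrightarrow> P \<omega> \<in> forms A" "\<And>\<omega>. \<omega> \<in> forms A \<Longrightarrow> Q \<omega> \<in> forms A"
    and Q_diff: "\<And>\<omega> \<eta>. \<omega> \<in> forms A \<Longrightarrow> \<eta> \<in> forms A \<Longrightarrow> Q (\<omega> - \<eta>) = Q \<omega> - Q \<eta>"
    and d0_PQ: "\<And>\<omega>. \<omega> \<in> forms A \<Longrightarrow> d0 (P \<omega>) = Q (d0 \<omega>)"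
    and P_adj: "\<And>\<alpha> \<beta> x. \<alpha> \<in> forms A \<Longrightarrow> \<beta> \<in> forms A \<Longrightarrow> form_inner (P \<alpha>) \<beta> x = form_inner \<alpha> (P \<beta>) x"
    and Q_adj: "\<And>\<alpha> \<beta> x. \<alpha> \<in> forms A \<Longrightarrow> \<beta> \<in> forms A \<Longrightarrow> form_inner (Q \<alpha>) \<beta> x = form_inner \<alpha> (Q \<beta>) x"
    and b: "\<beta> \<in> forms A"
  shows delta0_commute: "delta0 (Q \<beta>) = P (delta0 \<beta>)"
    and d0_inv_commute: "d0_inv (Q \<beta>) = P (d0_inv \<beta>)"
proof -
  have delta: "delta0 (Q \<beta>) = P (delta0 \<beta>)" if b: "\<beta> \<in> forms A" for \<beta>
  proof (rule delta0_eqI)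
    fix \<alpha> x assume a: "\<alpha> \<in> forms A"
    have "form_inner (d0 \<alpha>) (Q \<beta>) x = form_inner (Q (d0 \<alpha>)) \<beta> x"
      using a b by (intro Q_adj[symmetric] d0_form)
    also have "\<dots> = form_inner (d0 (P \<alpha>)) \<beta> x" by (simp only: d0_PQ[OF a])
    also have "\<dots> = form_inner (P \<alpha>) (delta0 \<beta>) x" by (rule delta0_adjoint[OF PQ(1)[OF a] b])
    also have "\<dots> = form_inner \<alpha> (P (delta0 \<beta>)) x" by (rule P_adj[OF a delta0_form[OF b]])
    finally show "form_inner (d0 \<alpha>) (Q \<beta>) x = form_inner \<alpha> (P (delta0 \<beta>)) x" .
  qed (use PQ b delta0_form in auto)
  then show "delta0 (Q \<beta>) = P (delta0 \<beta>)" using b by blast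
  obtain \<gamma> where g: "\<gamma> \<in> forms A" "d0_inv \<beta> = delta0 \<gamma>" using d0_inv_range[OF b] by auto
  obtain \<eta> where e: "\<eta> \<in> forms A" "proj_im_d0 \<beta> = d0 \<eta>" using proj_im_d0_range[OF b] by auto
  have pf: "proj_im_d0 \<beta> \<in> forms A" using e d0_form by simp
  show "d0_inv (Q \<beta>) = P (d0_inv \<beta>)"
  proof (rule d0_inv_eqI[OF PQ(2)[OF b]])
    show "P (d0_inv \<beta>) \<in> delta0 ` forms A"
      unfolding g(2) delta[OF g(1), symmetric] using PQ(2)[OF g(1)] by (rule imageI)
    have "proj_im_d0 (Q \<beta>) = Q (proj_im_d0 \<beta>)"
    proof (rule proj_im_d0_eqI[OF PQ(2)[OF b]])
      show "Q (proj_im_d0 \<beta>) \<in> d0 ` forms A"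
        unfolding e(2) d0_PQ[OF e(1), symmetric] using PQ(1)[OF e(1)] by (rule imageI)
      fix \<zeta> x assume z: "\<zeta> \<in> forms A"
      have "form_inner (Q \<beta> - Q (proj_im_d0 \<beta>)) (d0 \<zeta>) x = form_inner (Q (\<beta> - proj_im_d0 \<beta>)) (d0 \<zeta>) x"
        by (simp only: Q_diff[OF b pf])
      also have "\<dots> = form_inner (\<beta> - proj_im_d0 \<beta>) (Q (d0 \<zeta>)) x"
        by (rule Q_adj[OF forms_diff[OF b pf] d0_form[OF z]])
      also have "\<dots> = form_inner (\<beta> - proj_im_d0 \<beta>) (d0 (P \<zeta>)) x"
        by (simp only: d0_PQ[OF z])
      also have "\<dots> = 0" by (rule proj_im_d0_orth[OF b PQ(1)[OF z]])
      finally show "form_inner (Q \<beta> - Q (proj_im_d0 \<beta>)) (d0 \<zeta>) x = 0" .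
    qed
    then show "d0 (P (d0_inv \<beta>)) = proj_im_d0 (Q \<beta>)"
      by (simp only: d0_PQ[OF d0_inv_form[OF b]] d0_d0_inv[OF b])
  qed
qed

lemma d0_inv_comp: "\<beta> \<in> forms A \<Longrightarrow> d0_inv (comp q \<beta>) = comp q (d0_inv \<beta>)"
  by (rule d0_inv_commute[where P = "comp q" and Q = "comp q"])
    (simp_all only: comp_form comp_diff d0_comp inner_comp)

lemma delta0_comp: "\<beta> \<in> forms A \<Longrightarrow> delta0 (comp q \<beta>) = comp q (delta0 \<beta>)"
  by (rule delta0_commute[where P = "comp q" and Q = "comp q"])
    (simp_all only: comp_form comp_diff d0_comp inner_comp)

lemma deg_diff: "deg k (\<omega> - \<eta>) = deg k \<omega> - deg k \<eta>"
  by (auto simp: deg_def fun_eq_iff)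

lemma d0_inv_kform:
  assumes "\<beta> \<in> kforms A (Suc k)"
  shows "d0_inv \<beta> \<in> kforms A k"
proof -
  have b: "\<beta> \<in> forms A" "deg (Suc k) \<beta> = \<beta>" using assms by (auto simp: kforms_iff_deg)
  have "d0_inv (deg (Suc k) \<beta>) = deg k (d0_inv \<beta>)"
    by (rule d0_inv_commute[where P = "deg k" and Q = "deg (Suc k)"])
      (simp_all only: deg_form deg_diff d0_deg inner_deg b)
  then show ?thesis using b by (simp add: kforms_iff_deg d0_inv_form)
qed

section \<open>Inverting \<open>Id - b\<close>\<close>

lemma kforms_closed:
  "0 \<in> kforms A k" "\<omega> \<in> kforms A k \<Longrightarrow> \<eta> \<in> kforms A k \<Longrightarrow> \<omega> + \<eta> \<in> kforms A k"
  "\<omega> \<in> kforms A k \<Longrightarrow> \<eta> \<in> kforms A k \<Longrightarrow> \<omega> - \<eta> \<in> kforms A k"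
  "\<omega> \<in> kforms A k \<Longrightarrow> - \<omega> \<in> kforms A k"
  by (auto simp: kforms_def fun_eq_iff)

lemma b_form: "\<omega> \<in> forms A \<Longrightarrow> b_op \<omega> \<in> forms A"
  unfolding b_op_def by (intro forms_uminus d0_inv_form forms_diff d_form d0_form)

lemma b_kform: "\<omega> \<in> kforms A k \<Longrightarrow> b_op \<omega> \<in> kforms A k"
  unfolding b_op_def by (intro kforms_closed(4) d0_inv_kform kforms_closed(3) d_kform d0_kform)

lemma b_diff:
  assumes "\<omega> \<in> forms A" "\<eta> \<in> forms A"
  shows "b_op (\<omega> - \<eta>) = b_op \<omega> - b_op \<eta>"
proof -
  have "ext_d A (\<omega> - \<eta>) - d0 (\<omega> - \<eta>) = (ext_d A \<omega> - d0 \<omega>) - (ext_d A \<eta> - d0 \<eta>)"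
    unfolding d_diff[OF assms] d0_diff[OF assms] by (simp add: algebra_simps)
  moreover have "d0_inv ((ext_d A \<omega> - d0 \<omega>) - (ext_d A \<eta> - d0 \<eta>)) =
      d0_inv (ext_d A \<omega> - d0 \<omega>) - d0_inv (ext_d A \<eta> - d0 \<eta>)"
    using assms by (intro d0_inv_diff forms_diff d_form d0_form)
  ultimately show ?thesis unfolding b_op_def by simp
qed

text \<open>By \<open>comp_d_low\<close>, the difference of \<open>d\<close> and \<open>d0\<close>
  has no component of weight up to and including \<open>q\<close>, and \<open>d0_inv\<close>
  commutes with weights. The inclusive bound is the gain of one weight that drives the inductions
  below.\<close>

lemma comp_b_low:
  assumes w: "\<omega> \<in> forms A" and low: "\<And>r. r < q \<Longrightarrow> comp r \<omega> = 0" and r: "r \<le> q"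
  shows "comp r (b_op \<omega>) = 0"
proof -
  have f: "ext_d A \<omega> - d0 \<omega> \<in> forms A" by (intro forms_diff d_form d0_form w)
  have "comp r (ext_d A \<omega> - d0 \<omega>) = comp r (ext_d A \<omega>) - comp r (d0 \<omega>)"
    by (rule comp_diff[OF d_form[OF w] d0_form[OF w]])
  also have "comp r (ext_d A \<omega>) = comp r (d0 \<omega>)"
    unfolding d0_comp[OF w, symmetric] by (rule comp_d_low[where q = q]) (use w low r in auto)
  also have "comp r (d0 \<omega>) - comp r (d0 \<omega>) = 0" by (rule diff_self)
  finally have e: "comp r (ext_d A \<omega> - d0 \<omega>) = 0" .
  have "comp r (d0_inv (ext_d A \<omega> - d0 \<omega>)) = d0_inv (comp r (ext_d A \<omega> - d0 \<omega>))"
    by (rule d0_inv_comp[OF f, symmetric])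
  also have "\<dots> = 0" by (subst e) (rule d0_inv_zero)
  finally have "comp r (0 - d0_inv (ext_d A \<omega> - d0 \<omega>)) = 0"
    unfolding comp_diff[OF forms_zero d0_inv_form[OF f]] comp_zero by simp
  then show ?thesis unfolding b_op_def by (simp only: diff_0)
qed

lemma comp_negative:
  assumes "\<omega> \<in> forms A" "q < 0"
  shows "comp q \<omega> = 0"
proof (rule ccontr)
  assume "comp q \<omega> \<noteq> 0"
  then obtain bs where "bs \<in> frames" "q = lwt bs" using comp_support[OF assms(1)] by auto
  moreover have "lwt bs \<ge> 0" if "set bs \<subseteq> B" for bs
    using that by (induction bs) (auto simp: lwt_def dest!: wt_pos)
  ultimately show False using assms(2) by (force simp: frames_def)
qed

lemma forms_low_zero:
  assumes "\<omega> \<in> forms A" "\<And>n r. r < int n \<Longrightarrow> comp r \<omega> = 0"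
  shows "\<omega> = 0"
proof (rule forms_comp_eqI[OF assms(1) forms_zero])
  fix q
  have "q < int (nat (q + 1))" by auto
  then show "comp q \<omega> = comp q 0" using assms(2) comp_zero by metis
qed

text \<open>If a fixed form has no components of weight below \<open>n\<close>, then its image under
  \<open>b\<close>, which is the form itself, has none of weight \<open>n\<close> either.\<close>

lemma b_fixed_zero:
  assumes w: "\<omega> \<in> forms A" and "b_op \<omega> = \<omega>"
  shows "\<omega> = 0"
proof (rule forms_low_zero[OF w])
  fix n r
  show "r < int n \<Longrightarrow> comp r \<omega> = 0"
  proof (induction n arbitrary: r)
    case 0
    then show ?case using comp_negative[OF w] by simp
  next
    case (Suc n)
    have "comp r (b_op \<omega>) = 0"
      by (rule comp_b_low[OF w Suc.IH]) (use Suc.prems in auto)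
    then show ?case using assms(2) by simp
  qed
qed

text \<open>The Neumann series, written as the iteration of \<omega> \<mapsto> \<beta> + b \<omega>.
  Differences of successive iterates have no components of weight below \<open>n\<close>, so the
  iteration becomes stationary. All iterates have the degree of \<beta>, whence the last
  clause.\<close>

lemma Id_minus_b_surj:
  assumes b: "\<beta> \<in> forms A"
  shows "\<exists>\<omega>\<in>forms A. \<omega> - b_op \<omega> = \<beta> \<and> (\<forall>k. \<beta> \<in> kforms A k \<longrightarrow> \<omega> \<in> kforms A k)"
proof -
  define F where "F n = ((\<lambda>\<omega>. \<beta> + b_op \<omega>) ^^ n) 0" for n :: nat
  have F0: "F 0 = 0" and FS: "F (Suc n) = \<beta> + b_op (F n)" for n
    by (simp_all only: F_def funpow.simps o_apply id_apply)
  have Ff: "F n \<in> forms A" for n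
    by (induction n) (simp_all only: F0 FS forms_zero forms_add b b_form)
  have Fk: "F n \<in> kforms A k" if "\<beta> \<in> kforms A k" for n k
    by (induction n) (simp_all only: F0 FS kforms_closed that b_kform)
  have step: "comp r (F (Suc n) - F n) = 0" if "r < int n" for n r
    using that
  proof (induction n arbitrary: r)
    case 0
    show ?case by (rule comp_negative[OF forms_diff[OF Ff Ff]]) (use 0 in simp)
  next
    case (Suc n)
    have "F (Suc (Suc n)) - F (Suc n) = b_op (F (Suc n)) - b_op (F n)"
      unfolding FS[of "Suc n"] FS[of n, symmetric] by (subst (2) FS) (simp only: add_diff_cancel_left)
    also have "\<dots> = b_op (F (Suc n) - F n)" by (rule b_diff[OF Ff Ff, symmetric])
    finally have e: "F (Suc (Suc n)) - F (Suc n) = b_op (F (Suc n) - F n)" .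
    show ?case
      unfolding e by (rule comp_b_low[OF forms_diff[OF Ff Ff] Suc.IH]) (use Suc.prems in auto)
  qed
  \<comment> \<open>Only finitely many weights occur among frame tuples; after \<open>M\<close>
    steps the differences have no room left.\<close>
  obtain M where M: "\<And>bs. bs \<in> frames \<Longrightarrow> lwt bs < int M"
  proof -
    have "finite (lwt ` frames)" using finite_frames by simp
    then obtain m where "\<forall>q\<in>lwt ` frames. q \<le> m" using bdd_above_finite unfolding bdd_above_def by blast
    then have "lwt bs < int (nat (m + 1))" if "bs \<in> frames" for bs using that by fastforce
    then show ?thesis using that by blast
  qed
  have "F (Suc M) - F M = 0"
  proof (rule forms_comp_eqI[OF forms_diff[OF Ff Ff] forms_zero])
    fix q
    show "comp q (F (Suc M) - F M) = comp q 0"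
    proof (cases "q < int M")
      case True
      then show ?thesis by (simp only: step comp_zero)
    next
      case False
      then have "q \<notin> lwt ` frames" using M by auto
      then show ?thesis using comp_support[OF forms_diff[OF Ff Ff]] comp_zero by metis
    qed
  qed
  then have "\<beta> + b_op (F M) = F M" by (simp only: FS right_minus_eq)
  then have "F M - b_op (F M) = \<beta>" by (metis add_diff_cancel_right')
  then show ?thesis using Ff Fk by blast
qed

lemma Id_minus_b_inv_eqI:
  assumes "\<omega> \<in> forms A" "\<omega> - b_op \<omega> = \<beta>"
  shows "Id_minus_b_inv \<beta> = \<omega>"
proof -
  have "inj_on (\<lambda>\<omega>. \<omega> - b_op \<omega>) (forms A)"
  proof (rule inj_onI)
    fix \<omega> \<eta> assume *: "\<omega> \<in> forms A" "\<eta> \<in> forms A" "\<omega> - b_op \<omega> = \<eta> - b_op \<eta>"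
    have "b_op (\<omega> - \<eta>) = (\<omega> - \<eta>) - ((\<omega> - b_op \<omega>) - (\<eta> - b_op \<eta>))"
      unfolding b_diff[OF *(1,2)] by (simp add: algebra_simps)
    then have "b_op (\<omega> - \<eta>) = \<omega> - \<eta>" unfolding *(3) by simp
    then have "\<omega> - \<eta> = 0" using * by (intro b_fixed_zero forms_diff)
    then show "\<omega> = \<eta>" by simp
  qed
  from the_inv_into_f_f[OF this assms(1)] show ?thesis
    unfolding Id_minus_b_inv_def assms(2) .
qed

section \<open>Rumin forms\<close>

lemma Pi_E_eq:
  assumes a: "\<alpha> \<in> forms A" "d0 \<alpha> = 0" "delta0 \<alpha> = 0"
    and g: "g \<in> forms A" "g - b_op g = \<alpha>"
  shows "Pi_E \<alpha> = g"
proof -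
  have "form_inner \<alpha> (d0 \<eta>) x = 0" if "\<eta> \<in> forms A" for \<eta> x
    unfolding inner_commute_forms[of \<alpha>] delta0_adjoint[OF that a(1)] a(3) by (rule inner_right)
  then have T: "d0_inv \<alpha> = 0" by (rule d0_inv_orthogonal[OF a(1)])
  have I0: "Id_minus_b_inv 0 = 0"
    by (rule Id_minus_b_inv_eqI[OF forms_zero]) (use b_diff[OF forms_zero forms_zero] in simp)
  have bT: "d0_inv (ext_d A \<alpha>) = - b_op \<alpha>"
    unfolding b_op_def a(2) by (simp only: diff_0_right minus_minus)
  \<comment> \<open>The right-hand side is what \<open>Id_minus_b_inv\<close> is applied to in the
    first summand of \<open>Pi_op\<close>, so this summand is \<alpha> - g.\<close>
  have "\<alpha> - g - b_op (\<alpha> - g) = - b_op \<alpha>"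
    unfolding b_diff[OF a(1) g(1)] using g(2) by (simp add: algebra_simps)
  then have "Id_minus_b_inv (- b_op \<alpha>) = \<alpha> - g"
    using a g by (intro Id_minus_b_inv_eqI) auto
  then have "Pi_op \<alpha> = \<alpha> - g"
    unfolding Pi_op_def T I0 bT d_zero by (simp only: add_0_right)
  then show ?thesis unfolding Pi_E_def by (simp only: diff_diff_eq2 add_diff_cancel_left')
qed

lemma d0_inv_d_Pi_E:
  assumes a: "\<alpha> \<in> forms A" "d0 \<alpha> = 0" and g: "g \<in> forms A" "g - b_op g = \<alpha>"
  shows "d0_inv (ext_d A g) = 0"
proof -
  have fg: "ext_d A g - d0 g \<in> forms A" "d0 g \<in> forms A" "ext_d A g \<in> forms A"
    using g(1) by (auto intro: d_form d0_form)
  have "d0_inv (d0 g) = b_op g"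
  proof (rule d0_inv_eqI[OF fg(2)])
    have "0 - d0_inv (ext_d A g - d0 g) \<in> delta0 ` forms A"
      using d0_inv_range[OF fg(1)] smooth_linear_range[OF smooth_linear_delta0]
      by (intro submodule_diff[OF smooth_linear_range[OF smooth_linear_delta0]]) (auto simp only: submodule_def)
    then show "b_op g \<in> delta0 ` forms A" unfolding b_op_def by (simp only: diff_0)
    have "d0 g - d0 (b_op g) = d0 (g - b_op g)"
      by (rule d0_diff[OF g(1) b_form[OF g(1)], symmetric])
    also have "\<dots> = 0" unfolding g(2) by (rule a(2))
    finally have "d0 (b_op g) = d0 g" by simp
    moreover have "proj_im_d0 (d0 g) = d0 g"
    proof (rule proj_im_d0_eqI[OF fg(2)])
      show "d0 g \<in> d0 ` forms A" using g(1) by (rule imageI)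
      show "form_inner (d0 g - d0 g) (d0 \<eta>) x = 0" for \<eta> x
        unfolding diff_self by (rule inner_zero)
    qed
    ultimately show "d0 (b_op g) = proj_im_d0 (d0 g)" by simp
  qed
  moreover have "d0_inv (ext_d A g - d0 g) = d0_inv (ext_d A g) - d0_inv (d0 g)"
    by (rule d0_inv_diff[OF fg(3,2)])
  moreover have "b_op g = - d0_inv (ext_d A g - d0 g)" by (rule b_op_def)
  ultimately show ?thesis by simp
qed

text \<open>A vanishing \<open>d0_inv\<close> means that the projection onto the range of
  \<open>d0\<close> is 0; so the exterior derivative of \<open>g\<close> is orthogonal to this
  range, that is, in the kernel of the adjoint.\<close>

lemma delta0_d_Pi_E:
  assumes "\<alpha> \<in> forms A" "d0 \<alpha> = 0" "g \<in> forms A" "g - b_op g = \<alpha>"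
  shows "delta0 (ext_d A g) = 0"
proof -
  have f: "ext_d A g \<in> forms A" using assms d_form by blast
  have "proj_im_d0 (ext_d A g) = 0"
    using d0_d0_inv[OF f] d0_inv_d_Pi_E[OF assms] d0_zero by simp
  then have "form_inner (ext_d A g) (d0 \<eta>) x = 0" if "\<eta> \<in> forms A" for \<eta> x
    using proj_im_d0_orth[OF f that, of x] by (simp only: diff_0_right)
  then show ?thesis
    by (intro delta0_eqI[OF f forms_zero]) (simp only: inner_commute_forms[of _ "ext_d A g"] inner_right)
qed

lemma Pi_E_max_weight:
  assumes a: "\<alpha> \<in> rumin_forms k" "\<alpha> \<in> weight_kforms k p"
    and max: "\<And>q \<beta>. \<beta> \<in> weight_kforms k q \<Longrightarrow> \<beta> \<noteq> 0 \<Longrightarrow> q \<le> p"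
  shows "Pi_E \<alpha> = \<alpha>"
proof -
  have \<alpha>: "\<alpha> \<in> kforms A k" "d0 \<alpha> = 0" "delta0 \<alpha> = 0" "\<alpha> \<in> weight_forms p"
    using a by (auto simp: rumin_forms_def weight_kforms_def)
  then have af: "\<alpha> \<in> forms A" using kformsD by blast
  have low: "comp r \<alpha> = 0" if "r < p" for r
    unfolding comp_eq_0_iff[OF af] using weight_forms_frame[OF \<alpha>(4)] that by auto
  have "b_op \<alpha> = 0"
  proof (rule forms_comp_eqI[OF b_form[OF af] forms_zero])
    fix q
    \<comment> \<open>Up to weight \<open>p\<close> nothing is left because \<open>b\<close> raises
      the weight; above \<open>p\<close> the component would be a homogeneous form of the same
      degree, excluded by maximality.\<close>
    show "comp q (b_op \<alpha>) = comp q 0"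
    proof (cases "q \<le> p")
      case True
      show ?thesis
        unfolding comp_zero by (rule comp_b_low[OF af, where q = p]) (use low True in auto)
    next
      case False
      have "comp q (b_op \<alpha>) \<in> weight_kforms k q"
        unfolding weight_kforms_def
        using comp_kform[OF b_kform[OF \<alpha>(1)]] comp_weight[OF b_form[OF af]] by blast
      then show ?thesis unfolding comp_zero using max False by blast
    qed
  qed
  then show ?thesis by (intro Pi_E_eq[OF af \<alpha>(2,3) af]) simp
qed

lemma d_Pi_E_lowest_weight:
  assumes a: "\<alpha> \<in> rumin_forms k"
    and low: "\<And>r. r < m \<Longrightarrow> weight_comp r (ext_d A (Pi_E \<alpha>)) = 0"
  shows "weight_comp m (ext_d A (Pi_E \<alpha>)) \<in> rumin_forms (Suc k)"
proof -
  have \<alpha>: "\<alpha> \<in> kforms A k" "d0 \<alpha> = 0" "delta0 \<alpha> = 0"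
    using a by (auto simp: rumin_forms_def)
  then have af: "\<alpha> \<in> forms A" using kformsD by blast
  obtain g where g: "g \<in> forms A" "g - b_op g = \<alpha>" "g \<in> kforms A k"
    using Id_minus_b_surj[OF af] \<alpha>(1) by blast
  have P: "Pi_E \<alpha> = g" by (rule Pi_E_eq[OF af \<alpha>(2,3) g(1,2)])
  let ?d = "ext_d A g"
  have df: "?d \<in> forms A" by (rule d_form[OF g(1)])
  have lowd: "comp r ?d = 0" if "r < m" for r
    using low[OF that] unfolding P weight_comp_eq[OF df] .
  \<comment> \<open>The hypothesis makes weight \<open>m\<close> the lowest possible one, and
    \<open>comp_d_low\<close> is used at its endpoint.\<close>
  have "comp m (ext_d A ?d) = d0 (comp m ?d)"
    by (rule comp_d_low[OF df lowd order_refl])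
  then have "d0 (comp m ?d) = 0"
    unfolding d_d[OF g(1)] comp_zero by (rule sym)
  moreover have "delta0 (comp m ?d) = 0"
    unfolding delta0_comp[OF df] delta0_d_Pi_E[OF af \<alpha>(2) g(1,2)] by (rule comp_zero)
  moreover have "comp m ?d \<in> kforms A (Suc k)"
    by (intro comp_kform d_kform g)
  ultimately show ?thesis
    unfolding P weight_comp_eq[OF df] rumin_forms_def by blast
qed

text \<open>As \<open>j\<close> increases, all summands have weight at least \<open>p + j 1\<close>.
  This turns the decomposition in the theorem into the vanishing required by
  \<open>d_Pi_E_lowest_weight\<close>.\<close>

lemma weight_comp_of_sum_low:
  fixes t :: nat and j :: "nat \<Rightarrow> int"
  assumes w: "\<omega> \<in> forms A" and j: "strict_mono_on {1..t} j"
    and sum: "\<omega> = (\<Sum>i=1..t. weight_comp (p + j i) \<omega>)" and r: "r < p + j 1"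
  shows "weight_comp r \<omega> = 0"
proof -
  have ge: "p + j 1 \<le> p + j i" if "i \<in> {1..t}" for i
    using that strict_mono_on_leD[OF j, of 1 i] by auto
  have "comp r \<omega> = 0"
    unfolding comp_eq_0_iff[OF w]
  proof (intro ballI impI allI)
    fix cs x assume cs: "cs \<in> frames" "lwt cs = r"
    have "\<omega> (map X cs) x = (\<Sum>i=1..t. weight_comp (p + j i) \<omega>) (map X cs) x"
      using sum by (rule arg_cong[where f = "\<lambda>\<omega>. \<omega> (map X cs) x"])
    also have "\<dots> = (\<Sum>i=1..t. comp (p + j i) \<omega> (map X cs) x)"
      unfolding sum_apply_fun weight_comp_eq[OF w] ..
    also have "\<dots> = 0"
    proof (rule sum.neutral, rule ballI)
      fix i assume "i \<in> {1..t}"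
      from ge[OF this] have "lwt cs \<noteq> p + j i" using cs r by simp
      then show "comp (p + j i) \<omega> (map X cs) x = 0" by (simp only: comp_frame[OF w cs(1)] if_False)
    qed
    finally show "\<omega> (map X cs) x = 0" .
  qed
  then show ?thesis unfolding weight_comp_eq[OF w] .
qed

lemma Pi_E_form: "\<alpha> \<in> rumin_forms k \<Longrightarrow> Pi_E \<alpha> \<in> forms A"
proof -
  assume "\<alpha> \<in> rumin_forms k"
  then have \<alpha>: "\<alpha> \<in> forms A" "d0 \<alpha> = 0" "delta0 \<alpha> = 0"
    by (auto simp: rumin_forms_def kforms_def)
  then obtain g where "g \<in> forms A" "g - b_op g = \<alpha>" using Id_minus_b_surj by blast
  then show ?thesis using Pi_E_eq[OF \<alpha>] by simp
qed

end

theorem proposition3p13: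
  fixes G :: "('g::{t2_space,second_countable_topology}) monoid"
    and A :: "('g, 'v::euclidean_space) atlas"
    and X :: "'v \<Rightarrow> 'g vfield"
    and V :: "int \<Rightarrow> 'v set"
    and k :: nat and p :: int and \<alpha> :: "'g form"
  assumes "positively_graded_group G A X V"
    and "1 \<le> k"
    and "\<alpha> \<in> positively_graded_group.rumin_forms G A X V (k - 1) \<inter>
             positively_graded_group.weight_kforms G A X V (k - 1) p"
  shows "((\<exists>\<beta>\<in>positively_graded_group.weight_kforms G A X V (k - 1) p. \<beta> \<noteq> 0) \<and>
          (\<forall>q. \<forall>\<beta>\<in>positively_graded_group.weight_kforms G A X V (k - 1) q. \<beta> \<noteq> 0 \<longrightarrow> q \<le> p)
          \<longrightarrow> positively_graded_group.Pi_E G A X V \<alpha> = \<alpha>) \<and>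
         (\<forall>(t::nat) (j::nat \<Rightarrow> int).
            1 \<le> t \<and> strict_mono_on {1..t} j \<and>
            ext_d A (positively_graded_group.Pi_E G A X V \<alpha>) =
              (\<Sum>i=1..t. positively_graded_group.weight_comp G A X V (p + j i)
                           (ext_d A (positively_graded_group.Pi_E G A X V \<alpha>)))
            \<longrightarrow> positively_graded_group.weight_comp G A X V (p + j 1)
                  (ext_d A (positively_graded_group.Pi_E G A X V \<alpha>))
                \<in> positively_graded_group.rumin_forms G A X V k)"
proof -
  interpret positively_graded_group G A X V by (rule assms(1))
  \<comment> \<open>The operators in the claim are defined without reference to an adapted basis, so
    any such basis may be fixed.\<close>
  obtain B wt where "adapted_basis G A X V B wt"
    using adapted_basis_exists by blast
  then interpret adapted_basis G A X V B wt .
  have \<alpha>: "\<alpha> \<in> rumin_forms (k - 1)" "\<alpha> \<in> weight_kforms (k - 1) p"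
    using assms(3) by auto
  have k: "Suc (k - 1) = k" using assms(2) by simp
  have "Pi_E \<alpha> = \<alpha>"
    if "\<forall>q. \<forall>\<beta>\<in>weight_kforms (k - 1) q. \<beta> \<noteq> 0 \<longrightarrow> q \<le> p"
    using that by (intro Pi_E_max_weight[OF \<alpha>]) blast
  moreover have "weight_comp (p + j 1) (ext_d A (Pi_E \<alpha>)) \<in> rumin_forms k"
    if "strict_mono_on {1..t} j"
      "ext_d A (Pi_E \<alpha>) = (\<Sum>i=1..t. weight_comp (p + j i) (ext_d A (Pi_E \<alpha>)))" for t :: nat and j
    using d_Pi_E_lowest_weight[OF \<alpha>(1)
        weight_comp_of_sum_low[OF d_form[OF Pi_E_form[OF \<alpha>(1)]] that]]
    unfolding k .
  ultimately show ?thesis by blast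
qed

end
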